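(* Let $\nu>-1$ and define $S=S_1\cup S_2$, where $$S_1=\bigcup_{n\ge1}[-\gamma_{\nu,2n},-\gamma_{\nu,2n-1}],\qquad S_2=\bigcup_{n\ge1}[\gamma_{\nu,2n-1},\gamma_{\nu,2n}],$$ and $\gamma_{\nu,n}$ denotes the $n$th positive zero of the function $W_\nu$. Then the following assertions hold true: (a) The function $x\mapsto\mathscr{W}_\nu(x)$ is negative on $S$ and it is strictly positive on $\mathbb{R}\setminus S$. (b) The function $x\mapsto\mathscr{W}_\nu(x)$ is strictly increasing on $(-\gamma_{\nu,1},0]$ and strictly decreasing on $[0,\gamma_{\nu,1})$. (c) The function $x\mapsto\mathscr{W}_\nu(x)$ is strictly log-concave on $\mathbb{R}\setminus S$ and strictly geometrically concave on $(0,\infty)\setminus S_2$. (d) The function $x\mapsto W_\nu(x)$ is strictly log-concave on $(0,\infty)\setminus S_2$ for all $\nu\ge-\frac12$. (e) The function $\nu\mapsto\mathscr{W}_\nu(x)$ is increasing on $(-1,\infty)$ for all $x\in(-\gamma_{\nu,1},\gamma_{\nu,1})$, and the function $\nu\mapsto x\mathscr{W}_\nu'(x)/\mathscr{W}_\nu(x)$ is increasing on $(-1,\infty)$ for all $x\in\mathbb{R}$. (f) The function $x\mapsto\left(-\log\mathscr{W}_\nu(\sqrt[4]{x})\right)'$ and the function $x\mapsto1/\mathscr{W}_\nu(\sqrt[4]{x})$ are absolutely monotonic on $(0,\gamma_{\nu,1}^4)$ for all $\nu>-1$.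
   Context: $J_\nu$ and $I_\nu$ are the Bessel and modified Bessel functions of the first kind. Their cross-product is $$W_\nu(z)=J_\nu(z)I_\nu'(z)-J_\nu'(z)I_\nu(z)=J_{\nu+1}(z)I_\nu(z)+J_\nu(z)I_{\nu+1}(z).$$ For $\nu>-1$ its positive zeros are listed as $0<\gamma_{\nu,1}<\gamma_{\nu,2}<\cdots$. The normalized function is $$\mathscr{W}_\nu(z)=2^{2\nu}z^{-2\nu-1}\Gamma(\nu+1)\Gamma(\nu+2)W_\nu(z)=\prod_{n\ge1}\left(1-\frac{z^4}{\gamma_{\nu,n}^4}\right).$$ Primes denote derivatives with respect to the argument ($x$ or $z$). A positive function $f$ is strictly log-concave if $\log f$ is strictly concave; a positive function $f$ of a positive variable is strictly geometrically concave if $t\mapsto\log f(e^t)$ is strictly concave. A function $f$ is absolutely monotonic on an interval if it has derivatives of all orders there and $f^{(m)}(x)\ge0$ for all integers $m\ge0$ and all $x$ in the interval.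
   Formalization: In (e), monotonicity of xW'/W in ν is stated on each interval of orders in (-1,∞) where the normalized W_ν(x) is nonzero, since for x≠0 it has poles there and jumps from +∞ to -∞; in (c),(d) strict concavity is meant on each interval contained in the set. *)

theory Defs
  imports "HOL-Analysis.Analysis"
begin

text \<open>Bessel functions of the first kind of real order, for a positive real argument only: the
  factor \<open>powr\<close> makes the values at \<open>x \<le> 0\<close> meaningless. With \<open>rGamma\<close>, the reciprocal Gamma
  function, the series are correct for every real order.\<close>

definition bessel_J :: "real \<Rightarrow> real \<Rightarrow> real" where
  "bessel_J \<nu> x =
     (\<Sum>n. (- 1) ^ n / fact n * rGamma (real n + \<nu> + 1) * (x / 2) powr (2 * real n + \<nu>))"

definition bessel_I :: "real \<Rightarrow> real \<Rightarrow> real" where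
  "bessel_I \<nu> x =
     (\<Sum>n. 1 / fact n * rGamma (real n + \<nu> + 1) * (x / 2) powr (2 * real n + \<nu>))"

definition bessel_cross :: "real \<Rightarrow> real \<Rightarrow> real" where
  "bessel_cross \<nu> x = bessel_J \<nu> x * deriv (bessel_I \<nu>) x - deriv (bessel_J \<nu>) x * bessel_I \<nu> x"

text \<open>The cross-product is \<open>x powr (2 * \<nu> + 1)\<close> times an everywhere convergent power series in
  \<open>x ^ 4\<close>. Hence the normalised function, given by its formula for \<open>x > 0\<close>, extends analytically
  to the real line; the extension is even and takes the value 1 at 0.\<close>

definition norm_bessel_cross :: "real \<Rightarrow> real \<Rightarrow> real" where
  "norm_bessel_cross \<nu> x =
     (if x = 0 then 1
      else 2 powr (2 * \<nu>) * \<bar>x\<bar> powr (- 2 * \<nu> - 1) * Gamma (\<nu> + 1) * Gamma (\<nu> + 2)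
             * bessel_cross \<nu> \<bar>x\<bar>)"

text \<open>The \<open>n\<close>-th positive zero, meaningful for \<open>n \<ge> 1\<close>: the positive zero \<open>x\<close> such that exactly
  \<open>n\<close> zeros lie in \<open>(0, x]\<close>. As \<open>card\<close> vanishes on infinite sets, this includes that there are
  only finitely many zeros in \<open>(0, x]\<close>.\<close>

definition bessel_cross_zero :: "real \<Rightarrow> nat \<Rightarrow> real" where
  "bessel_cross_zero \<nu> n =
     (THE x. 0 < x \<and> bessel_cross \<nu> x = 0 \<and> card {y \<in> {0<..x}. bessel_cross \<nu> y = 0} = n)"

definition S1 :: "real \<Rightarrow> real set" where
  "S1 \<nu> = (\<Union>n\<in>{1..}. {- bessel_cross_zero \<nu> (2 * n) .. - bessel_cross_zero \<nu> (2 * n - 1)})"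

definition S2 :: "real \<Rightarrow> real set" where
  "S2 \<nu> = (\<Union>n\<in>{1..}. {bessel_cross_zero \<nu> (2 * n - 1) .. bessel_cross_zero \<nu> (2 * n)})"

definition strictly_concave_on :: "real set \<Rightarrow> (real \<Rightarrow> real) \<Rightarrow> bool" where
  "strictly_concave_on A f \<longleftrightarrow> convex A \<and>
     (\<forall>x\<in>A. \<forall>y\<in>A. \<forall>t\<in>{0<..<1}. x \<noteq> y \<longrightarrow>
        (1 - t) * f x + t * f y < f ((1 - t) * x + t * y))"

text \<open>The following two notions are used on sets that are not intervals, where concavity is
  required on every interval contained in the set, i.e. on each connected component.\<close>

definition strictly_log_concave_on :: "real set \<Rightarrow> (real \<Rightarrow> real) \<Rightarrow> bool" where
  "strictly_log_concave_on A f \<longleftrightarrow> (\<forall>x\<in>A. 0 < f x) \<and>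
     (\<forall>K. K \<subseteq> A \<and> convex K \<longrightarrow> strictly_concave_on K (\<lambda>x. ln (f x)))"

definition strictly_geom_concave_on :: "real set \<Rightarrow> (real \<Rightarrow> real) \<Rightarrow> bool" where
  "strictly_geom_concave_on A f \<longleftrightarrow> A \<subseteq> {0<..} \<and> (\<forall>x\<in>A. 0 < f x) \<and>
     (\<forall>K. exp ` K \<subseteq> A \<and> convex K \<longrightarrow> strictly_concave_on K (\<lambda>t. ln (f (exp t))))"

text \<open>For open sets \<open>A\<close> (the derivatives are two-sided).\<close>

definition absolutely_monotonic_on :: "real set \<Rightarrow> (real \<Rightarrow> real) \<Rightarrow> bool" where
  "absolutely_monotonic_on A f \<longleftrightarrow>
     (\<forall>m. \<forall>x\<in>A. (deriv ^^ m) f field_differentiable (at x) \<and> 0 \<le> (deriv ^^ m) f x)"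

end

theory Submission
  imports Defs "HOL-Computational_Algebra.Fundamental_Theorem_Algebra" "HOL-Library.Diagonal_Subsequence"
begin

text \<open>
  In the variable \<open>X = x^4/16\<close> the normalised cross-product is the hypergeometric series
  \<open>\<Sum>n. (-X)^n / (n! (\<nu>+1)_n (\<nu>+2)_{2n})\<close>. The operators \<open>p \<mapsto> p + X p'/d\<close> with \<open>d > 0\<close> keep all
  zeros of a polynomial positive, because \<open>X p'/p\<close> is real at \<open>X\<close> only if \<open>X\<close> is. Applying
  them repeatedly to \<open>(1 - X/N^4)^N\<close> gives polynomials with positive zeros that converge to the
  series; the coefficient bounds control the sizes of the reciprocal zeros, so the factorisations
  pass to the limit and yield a product \<open>\<Prod>(1 - a_i X)\<close> with \<open>a_i > 0\<close> and \<open>\<Sum> a_i < \<infinity>\<close>. The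
  signs, the concavity statements and absolute monotonicity are read off this product and its
  logarithmic derivative. A double zero would persist when the parameter of the first Pochhammer
  symbol is raised by 1, again and again, whereas \<open>\<Sum> a_i\<close> then tends to 0; hence all zeros are
  simple.
  Monotonicity in \<open>\<nu>\<close> holds for the approximating polynomials, where the derivative in \<open>\<nu>\<close> of the
  logarithmic derivative is a positive combination of Laguerre expressions, and passes to the limit.
\<close>

section \<open>Polynomials with positive zeros\<close>

text \<open>The whole argument stays with real power series; complex numbers enter only through the
  zeros of polynomials. The point that carries the passage to the limit is the uniform bound
  C^n/(n!)^2 for the coefficients of the approximating polynomials: it forces the reciprocal zeros
  to be O(1/i^2), so that a diagonal subsequence converges and dominated convergence applies to the
  values and to the products alike. The series itself comes from the Bessel equations: in t = x^2/4
  the Wronskian, the product and the product of the Euler derivatives satisfy a closed linear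
  system, and the Wronskian is odd in t. The two Pochhammer parameters are kept independent because
  the proof of simplicity raises the first one alone and thereby leaves the Bessel family. In the
  comparison of orders the approximants must not vanish on a whole interval of orders; a compactness
  argument provides this for all large N.\<close>

definition theta :: "'a::{comm_semiring_1,semiring_no_zero_divisors,semiring_char_0} poly \<Rightarrow> 'a poly" where
  "theta p = pCons 0 (pderiv p)"

lemma coeff_theta [simp]: "coeff (theta p) n = of_nat n * coeff p n"
  by (cases n) (auto simp: theta_def coeff_pderiv)

lemma theta_mult:
  fixes p q :: "'a::{idom,ring_char_0} poly"
  shows "theta (p * q) = theta p * q + p * theta q"
  by (rule poly_eqI) (simp add: theta_def pderiv_mult algebra_simps)

lemma theta_add: "theta (p + q) = theta p + theta q"
  for p q :: "'a::{idom,ring_char_0} poly"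
  by (rule poly_eqI) (simp add: algebra_simps)

lemma theta_linear: "theta [:1, a:] = [:0, a:]" for a :: "'a::{idom,ring_char_0}"
  by (simp add: theta_def pderiv_pCons)

text \<open>Reciprocal zeros with constant term 1, rather than zeros with a leading coefficient: the
  degree may grow along a sequence, and zeros that escape to infinity become factors 1 in the
  limit.\<close>

definition positive_rooted :: "real poly \<Rightarrow> bool" where
  "positive_rooted p \<longleftrightarrow> (\<exists>A. (\<forall>a\<in>#A. 0 < a) \<and> p = (\<Prod>a\<in>#A. [:1, - a:]))"

text \<open>With t_a = a z/(1 - a z) one has X p'/p = - \<Sum> t_a, so at a new zero the t_a add up
  to d. Each t_a is a positive multiple of z - a |z|^2: the imaginary parts all have the sign of Im
  z, and for Re z \<le> 0 all real parts are at most 0. Neither is compatible with a sum d > 0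
  unless z is real and positive.\<close>

lemma positive_rooted_root_theta:
  fixes A :: "real multiset" and z :: complex
  assumes A: "\<And>a. a \<in># A \<Longrightarrow> 0 < a" and d: "0 < d"
    and root: "poly (\<Prod>a\<in>#A. [:1, - of_real a:]) z
      + of_real (1 / d) * poly (theta (\<Prod>a\<in>#A. [:1, - of_real a:])) z = 0"
  shows "Im z = 0 \<and> Re z > 0"
proof (cases "poly (\<Prod>a\<in>#A. [:1, - of_real a:]) z = 0")
  case True
  then obtain a where a: "a \<in># A" "1 - of_real a * z = 0"
    by (auto simp: poly_prod_mset prod_mset_zero_iff algebra_simps)
  then have "z = of_real (1 / a)"
    using A[of a] by (auto simp: field_simps)
  with A[of a] a show ?thesis by auto
next
  case False
  define t where "t a = of_real a * z / (1 - of_real a * z)" for a :: real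
  \<comment> \<open>Stated for submultisets, so that during the induction every factor is still
    known not to vanish at z.\<close>
  have log_deriv: "poly (theta (\<Prod>a\<in>#B. [:1, - of_real a:])) z
      = - (\<Sum>a\<in>#B. t a) * poly (\<Prod>a\<in>#B. [:1, - of_real a:]) z"
    if "B \<subseteq># A" for B
    using that
  proof (induction B)
    case (add a B)
    have "a \<in># A" using add.prems by (auto dest: mset_subset_eqD)
    then have "1 - of_real a * z \<noteq> 0"
      using False by (auto simp: poly_prod_mset prod_mset_zero_iff algebra_simps)
    moreover have "B \<subseteq># A" using add.prems by (meson mset_subset_eq_insertD subset_mset.less_imp_le)
    ultimately have IH: "poly (theta (\<Prod>a\<in>#B. [:1, - of_real a:])) z
        = - (\<Sum>a\<in>#B. t a) * poly (\<Prod>a\<in>#B. [:1, - of_real a:]) z"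
      and ta: "of_real a * z = t a * (1 - of_real a * z)"
      using add.IH by (auto simp: t_def)
    have "poly (theta (\<Prod>a\<in>#add_mset a B. [:1, - of_real a:])) z
      = - (of_real a * z) * poly (\<Prod>a\<in>#B. [:1, - of_real a:]) z
        + (1 - of_real a * z) * poly (theta (\<Prod>a\<in>#B. [:1, - of_real a:])) z"
      by (simp add: theta_mult theta_linear algebra_simps del: mult_pCons_left)
    also have "\<dots> = - (t a + (\<Sum>a\<in>#B. t a))
        * ((1 - of_real a * z) * poly (\<Prod>a\<in>#B. [:1, - of_real a:]) z)"
      unfolding IH using ta by algebra
    also have "(1 - of_real a * z) * poly (\<Prod>a\<in>#B. [:1, - of_real a:]) z
        = poly (\<Prod>a\<in>#add_mset a B. [:1, - of_real a:]) z"
      by (simp add: algebra_simps)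
    finally show ?case by simp
  qed (simp add: theta_def pderiv_1)
  have "(1 - (\<Sum>a\<in>#A. t a) / of_real d) * poly (\<Prod>a\<in>#A. [:1, - of_real a:]) z = 0"
    using root log_deriv[of A] by (simp add: algebra_simps)
  then have sum: "(\<Sum>a\<in>#A. t a) = of_real d"
    using False d by (simp add: field_simps)
  define w where "w a = a / (cmod (1 - of_real a * z))\<^sup>2" for a :: real
  have nz: "1 - of_real a * z \<noteq> 0" if "a \<in># A" for a
    using that False by (auto simp: poly_prod_mset prod_mset_zero_iff algebra_simps)
  have expand: "u / v = u * cnj v / (v * cnj v)" if "v \<noteq> 0" for u v :: complex
    using mult_divide_mult_cancel_right[of "cnj v" u v] that by (metis complex_cnj_zero_iff)
  have t: "t a = of_real (w a) * (z - of_real (a * (cmod z)\<^sup>2))" if "a \<in># A" for a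
  proof -
    have "t a = of_real a * z * cnj (1 - of_real a * z) / of_real ((cmod (1 - of_real a * z))\<^sup>2)"
      unfolding t_def complex_norm_square by (rule expand[OF nz[OF that]])
    also have "of_real a * z * cnj (1 - of_real a * z) = of_real a * (z - of_real (a * (cmod z)\<^sup>2))"
      unfolding of_real_mult complex_norm_square by (simp add: algebra_simps)
    finally show ?thesis by (simp add: w_def)
  qed
  have w: "w a > 0" if "a \<in># A" for a
    using nz[OF that] A[OF that] by (simp add: w_def)
  have "Im (\<Sum>a\<in>#A. t a) = (\<Sum>a\<in>#A. Im (t a))" by (induction A) auto
  also have "\<dots> = (\<Sum>a\<in>#A. w a * Im z)"
    by (intro arg_cong[where f = sum_mset] image_mset_cong) (simp add: t)
  also have "\<dots> = (\<Sum>a\<in>#A. w a) * Im z" by (simp add: sum_mset_distrib_right)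
  finally have im: "(\<Sum>a\<in>#A. w a) * Im z = 0" using sum by simp
  have "A \<noteq> {#}" using sum d by auto
  then obtain a B where "A = add_mset a B" by (meson multiset_cases)
  moreover have "0 \<le> (\<Sum>b\<in>#B. w b)" if "B \<subseteq># A" for B
    using that
  proof (induction B)
    case (add b B)
    then show ?case
      using w[of b] by (metis add_nonneg_nonneg image_mset_add_mset less_imp_le mset_subset_eq_insertD
          subset_mset.less_imp_le sum_mset.add_mset)
  qed simp
  ultimately have "(\<Sum>a\<in>#A. w a) > 0"
    using w[of a] by (simp add: add_pos_nonneg)
  with im have Imz: "Im z = 0" by simp
  have "Re z > 0"
  proof (rule ccontr)
    assume neg: "\<not> Re z > 0"
    have "Re (\<Sum>a\<in>#A. t a) = (\<Sum>a\<in>#A. Re (t a))" by (induction A) auto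
    moreover have "(\<Sum>a\<in>#B. Re (t a)) \<le> 0" if "B \<subseteq># A" for B
      using that
    proof (induction B)
      case (add b B)
      have b: "b \<in># A" using add.prems by (auto dest: mset_subset_eqD)
      have "Re (t b) \<le> 0"
        using t[OF b] w[OF b] neg A[OF b]
        by (auto simp: intro!: mult_nonneg_nonpos) (smt (verit) mult_nonneg_nonneg zero_le_power2)
      moreover have "B \<subseteq># A" using add.prems by (meson mset_subset_eq_insertD subset_mset.less_imp_le)
      ultimately show ?case using add.IH by auto
    qed simp
    ultimately show False using sum d by (metis Re_complex_of_real not_less subset_mset.order_refl)
  qed
  with Imz show ?thesis by simp
qed

text \<open>The zeros are found over the complex numbers, where the polynomial splits; being real
  and positive, they give a real factorisation.\<close>

lemma positive_rooted_theta:
  assumes "positive_rooted p" "0 < d"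
  shows "positive_rooted (p + smult (1 / d) (theta p))"
proof -
  obtain A where A: "\<And>a. a \<in># A \<Longrightarrow> 0 < a" and p: "p = (\<Prod>a\<in>#A. [:1, - a:])"
    using assms(1) by (auto simp: positive_rooted_def)
  define q where "q = p + smult (1 / d) (theta p)"
  define h where "h = (map_poly complex_of_real)"
  have h_coeff: "coeff (h r) n = of_real (coeff r n)" for r n
    by (simp add: h_def coeff_map_poly)
  have h_mult: "h (r * s) = h r * h s" for r s
    by (rule poly_eqI) (simp add: h_coeff coeff_mult)
  have h_linear: "h [:1, - a:] = [:1, - of_real a:]" and h_1: "h 1 = 1" for a
    by (simp_all add: h_def map_poly_pCons)
  have h_prod: "h (\<Prod>a\<in>#B. [:1, - a:]) = (\<Prod>a\<in>#B. [:1, - of_real a:])" for B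
    by (induction B) (simp_all add: h_mult h_linear h_1 del: mult_pCons_left)
  have hq: "h q = h p + smult (of_real (1 / d)) (theta (h p))"
    by (rule poly_eqI) (simp add: h_coeff q_def)
  have p0: "coeff p 0 = 1" 
    unfolding p by (induction A) (auto simp: coeff_mult_0)
  then have q0: "coeff (h q) 0 = 1" by (simp add: h_coeff q_def)
  then have "h q \<noteq> 0" by auto
  then obtain Z where Z: "h q = smult (lead_coeff (h q)) (\<Prod>x\<in>#Z. [:- x, 1:])"
    using alg_closed_imp_factorization by blast
  have roots: "Im z = 0 \<and> Re z > 0" if "z \<in># Z" for z
  proof (rule positive_rooted_root_theta[OF A assms(2)])
    have "poly (h q) z = 0"
      using that by (subst Z) (auto simp: poly_prod_mset prod_mset_zero_iff)
    then show "poly (\<Prod>a\<in>#A. [:1, - of_real a:]) z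
      + of_real (1 / d) * poly (theta (\<Prod>a\<in>#A. [:1, - of_real a:])) z = 0"
      unfolding hq p h_prod by simp
  qed
  define B where "B = image_mset (\<lambda>z. 1 / Re z) Z"
  \<comment> \<open>As x = Re x \<noteq> 0, the monic factor is - x times the normalised one. The
    scalars collect in k, which the constant term 1 later identifies as 1.\<close>
  have factor: "\<exists>k. (\<Prod>x\<in>#Y. [:- x, 1:]) = smult k (\<Prod>x\<in>#Y. [:1, - of_real (1 / Re x):])"
    if "Y \<subseteq># Z" for Y
    using that
  proof (induction Y)
    case empty
    show ?case by (rule exI[of _ 1]) simp
  next
    case (add x Y)
    have x: "x \<in># Z" using add.prems by (auto dest: mset_subset_eqD)
    have "Y \<subseteq># Z" using add.prems by (meson mset_subset_eq_insertD subset_mset.less_imp_le)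
    then obtain k where k: "(\<Prod>x\<in>#Y. [:- x, 1:]) = smult k (\<Prod>x\<in>#Y. [:1, - of_real (1 / Re x):])"
      using add.IH by blast
    have "x = of_real (Re x)" "Re x \<noteq> 0" using roots[OF x] by (auto simp: complex_eq_iff)
    then have "[:- x, 1:] = smult (- x) [:1, - of_real (1 / Re x):]"
      by (simp add: complex_eq_iff)
    then have "(\<Prod>x\<in>#add_mset x Y. [:- x, 1:])
        = smult (k * - x) (\<Prod>x\<in>#add_mset x Y. [:1, - of_real (1 / Re x):])"
      by (simp only: image_mset_add_mset prod_mset.add_mset k mult_smult_left mult_smult_right smult_smult)
    then show ?case by (rule exI)
  qed
  obtain k0 where "(\<Prod>x\<in>#Z. [:- x, 1:]) = smult k0 (\<Prod>x\<in>#Z. [:1, - of_real (1 / Re x):])"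
    using factor[OF subset_mset.order_refl] by blast
  with Z have "h q = smult (lead_coeff (h q) * k0) (\<Prod>x\<in>#Z. [:1, - of_real (1 / Re x):])"
    by (simp only: smult_smult)
  then obtain k where k: "h q = smult k (\<Prod>x\<in>#Z. [:1, - of_real (1 / Re x):])"
    by (rule that)
  have hB: "h (\<Prod>b\<in>#B. [:1, - b:]) = (\<Prod>x\<in>#Z. [:1, - of_real (1 / Re x):])"
    unfolding h_prod B_def by (simp add: image_mset.compositionality o_def)
  have "coeff (\<Prod>b\<in>#B. [:1, - b:]) 0 = 1" by (induction B) (auto simp: coeff_mult_0)
  then have "coeff (\<Prod>x\<in>#Z. [:1, - of_real (1 / Re x):]) 0 = (1 :: complex)"
    by (simp only: hB[symmetric] h_coeff of_real_1)
  with q0 have "k = 1" unfolding k coeff_smult by simp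
  then have hq_eq: "h q = h (\<Prod>b\<in>#B. [:1, - b:])" by (simp only: k hB smult_1_left)
  have "q = (\<Prod>b\<in>#B. [:1, - b:])"
    by (rule poly_eqI) (use arg_cong[OF hq_eq, of "\<lambda>r. coeff r _"] in \<open>simp only: h_coeff of_real_eq_iff\<close>)
  moreover have "\<forall>b\<in>#B. 0 < b" using roots by (auto simp: B_def)
  ultimately show ?thesis unfolding q_def positive_rooted_def by blast
qed

lemma positive_rooted_binomial:
  assumes "0 < s"
  shows "positive_rooted ([:1, - s:] ^ N)"
  unfolding positive_rooted_def
  by (rule exI[of _ "replicate_mset N s"]) (use assms in \<open>auto simp: prod_mset_replicate_mset\<close>)

text \<open>On coefficients, p + X p'/d is multiplication by 1 + n/d, so any finite family of such
  multipliers can be applied to (1 - s X)^N.\<close>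

lemma positive_rooted_multiplier:
  assumes "finite J" "\<And>j. j \<in> J \<Longrightarrow> 0 < d j" "0 < s"
  shows "\<exists>p. positive_rooted p \<and>
    (\<forall>n. coeff p n = (- s) ^ n * of_nat (N choose n) * (\<Prod>j\<in>J. 1 + real n / d j))"
  using assms(1,2)
proof (induction J)
  case empty
  have "coeff ([:1, - s:] ^ N) n = (- s) ^ n * of_nat (N choose n)" for n
  proof (cases "n \<le> N")
    case True
    then show ?thesis using coeff_linear_poly_power[of n N 1 "- s"] by (simp)
  next
    case False
    then have "degree ([:1, - s:] ^ N) < n"
      using degree_power_le[of "[:1, - s:]" N] assms(3) by (auto simp: )
    then show ?thesis using False by (simp add: coeff_eq_0 binomial_eq_0)
  qed
  with positive_rooted_binomial[OF assms(3)] show ?case by auto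
next
  case (insert j J)
  then obtain p where p: "positive_rooted p"
    "\<And>n. coeff p n = (- s) ^ n * of_nat (N choose n) * (\<Prod>j\<in>J. 1 + real n / d j)"
    by auto
  have "positive_rooted (p + smult (1 / d j) (theta p))"
    using p insert.prems by (intro positive_rooted_theta) auto
  moreover have "coeff (p + smult (1 / d j) (theta p)) n
      = (- s) ^ n * of_nat (N choose n) * (\<Prod>j\<in>insert j J. 1 + real n / d j)" for n
    using insert.hyps p(2) by (simp add: field_simps)
  ultimately show ?case by blast
qed

text \<open>With \<theta> the Euler operator, D p = - p^2 \<theta>(\<theta>p/p), so D p/p^2 is
  additive over factors; a linear factor contributes D = a x \<ge> 0.\<close>

lemma positive_rooted_laguerre:
  assumes "positive_rooted p" "0 \<le> x"
  shows "poly p x * poly (theta (theta p)) x \<le> (poly (theta p) x)\<^sup>2"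
proof -
  define D where "D p = (poly (theta p) x)\<^sup>2 - poly p x * poly (theta (theta p)) x" for p
  have mult: "D (p * q) = D p * (poly q x)\<^sup>2 + (poly p x)\<^sup>2 * D q" for p q
    unfolding D_def by (simp add: theta_mult theta_add) algebra
  obtain A where A: "\<forall>a\<in>#A. 0 < a" "p = (\<Prod>a\<in>#A. [:1, - a:])"
    using assms(1) by (auto simp: positive_rooted_def)
  have "0 \<le> D (\<Prod>a\<in>#A. [:1, - a:])"
    using A(1)
  proof (induction A)
    case (add a A)
    have "D [:1, - a:] = a * x"
      by (simp add: D_def theta_def pderiv_pCons algebra_simps power2_eq_square)
    then have "0 \<le> D [:1, - a:]" using add.prems assms(2) by simp
    then show ?case using add by (simp add: mult del: mult_pCons_left)
  qed (simp add: D_def theta_def)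
  then show ?thesis using A(2) by (simp add: D_def)
qed

section \<open>Limits of polynomials with positive zeros\<close>

text \<open>Sorted decreasingly and padded by zeros, which stand for factors 1, the reciprocal zeros
  of all polynomials share one index set whatever the degree. Only then do limits index by index
  make sense.\<close>

lemma positive_rooted_sequence:
  assumes "positive_rooted p"
  shows "\<exists>a m. decseq a \<and> (\<forall>i::nat. 0 \<le> a i) \<and> (\<forall>n\<ge>m. p = (\<Prod>i<n. [:1, - a i:]))"
proof -
  obtain A where A: "\<forall>a\<in>#A. 0 < a" "p = (\<Prod>a\<in>#A. [:1, - a:])"
    using assms by (auto simp: positive_rooted_def)
  define xs where "xs = rev (sorted_list_of_multiset A)"
  define a where "a i = (if i < length xs then xs ! i else 0)" for i
  have "set xs = set_mset A" by (simp add: xs_def)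
  then have pos: "xs ! i > 0" if "i < length xs" for i
    using A(1) that nth_mem by blast
  have sorted: "sorted_wrt (\<ge>) xs"
    by (simp add: xs_def sorted_wrt_rev)
  have "decseq a"
    unfolding decseq_def a_def
    using sorted pos by (force simp: sorted_wrt_iff_nth_less order.order_iff_strict)
  moreover have "\<forall>i. 0 \<le> a i"
    using pos by (auto simp: a_def less_imp_le)
  moreover have "p = (\<Prod>i<n. [:1, - a i:])" if "n \<ge> length xs" for n
  proof -
    have "p = prod_list (map (\<lambda>a. [:1, - a:]) xs)"
      using A(2) prod_mset_prod_list[of "map (\<lambda>a. [:1, - a:]) xs"] by (simp add: xs_def)
    also have "\<dots> = (\<Prod>i<length xs. [:1, - a i:])"
      by (simp add: prod.list_conv_set_nth atLeast0LessThan a_def)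
    also have "\<dots> = (\<Prod>i<n. [:1, - a i:])"
      using that by (intro prod.mono_neutral_left) (auto simp: a_def one_pCons)
    finally show ?thesis .
  qed
  ultimately show ?thesis by blast
qed

text \<open>Up to sign the coefficient is an elementary symmetric function of nonnegative numbers,
  and the product of the first k of them is one of its summands.\<close>

lemma prod_le_coeff_prod:
  fixes a :: "nat \<Rightarrow> real"
  assumes "\<And>i. 0 \<le> a i" "k \<le> n"
  shows "(\<Prod>i<k. a i) \<le> \<bar>coeff (\<Prod>i<n. [:1, - a i:]) k\<bar>"
proof -
  define e where "e n k = (- 1) ^ k * coeff (\<Prod>i<n. [:1, - a i:]) k" for n k
  have e_Suc: "e (Suc n) (Suc k) = e n (Suc k) + a n * e n k" for n k
    by (simp add: e_def algebra_simps)
  have e_0: "e n 0 = 1" for n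
    by (induction n) (auto simp: e_def coeff_mult_0)
  have e_0': "e 0 (Suc k) = 0" for k
    by (simp add: e_def)
  have e_nonneg: "0 \<le> e n k" for n k
  proof (induction n arbitrary: k)
    case 0
    then show ?case by (cases k) (simp_all add: e_0 e_0')
  next
    case (Suc n)
    then show ?case using assms(1) by (cases k) (simp_all add: e_0 e_Suc)
  qed
  have diag: "(\<Prod>i<k. a i) \<le> e k k" for k
  proof (induction k)
    case (Suc k)
    have "(\<Prod>i<Suc k. a i) = a k * (\<Prod>i<k. a i)" by simp
    also have "\<dots> \<le> a k * e k k" using Suc assms(1) by (intro mult_left_mono)
    also have "\<dots> \<le> e (Suc k) (Suc k)" using e_nonneg by (simp add: e_Suc)
    finally show ?case .
  qed (simp add: e_0)
  have "e k k \<le> e n k"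
    using assms(2)
  proof (induction n rule: dec_induct)
    case (step n)
    then show ?case
      using e_nonneg[of n] assms(1)[of n] by (cases k) (simp_all add: e_0 e_Suc add_increasing2)
  qed simp
  moreover have "e n k = \<bar>coeff (\<Prod>i<n. [:1, - a i:]) k\<bar>"
    using abs_of_nonneg[OF e_nonneg[of n k]] by (simp add: e_def abs_mult power_abs)
  ultimately show ?thesis using diag[of k] by simp
qed

text \<open>A single term of the series of exp n; a crude form of Stirling's bound.\<close>

lemma power_le_exp_fact: "real n ^ n \<le> exp (real n) * fact n"
proof -
  have s: "summable (\<lambda>k. real n ^ k / fact k)"
    using summable_exp[of "real n"] by (simp add: field_simps)
  have "(\<Sum>k\<in>{n}. real n ^ k / fact k) \<le> (\<Sum>k. real n ^ k / fact k)"
    by (rule sum_le_suminf[OF s]) auto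
  then have "real n ^ n / fact n \<le> exp (real n)"
    by (simp add: exp_def field_simps)
  then show ?thesis by (simp add: field_simps)
qed

text \<open>The entry a i is the least of the first k = i + 1 ones, so its k-th power is below their
  product, hence below the k-th coefficient. With k! \<ge> (k/e)^k that coefficient is at most (C
  e^2/k^2)^k, and a k-th root remains to be taken. The bound no longer mentions p.\<close>

lemma zero_bound:
  fixes a :: "nat \<Rightarrow> real"
  assumes "decseq a" "\<And>i. 0 \<le> a i" "\<And>n. n \<ge> m \<Longrightarrow> p = (\<Prod>i<n. [:1, - a i:])"
    and C: "0 \<le> C" "\<And>n. \<bar>coeff p n\<bar> \<le> C ^ n / (fact n)\<^sup>2"
  shows "a i \<le> C * exp 2 / (real (Suc i))\<^sup>2"
proof -
  let ?k = "Suc i"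
  have "a i ^ ?k = (\<Prod>j<?k. a i)" by simp
  also have "\<dots> \<le> (\<Prod>j<?k. a j)"
    by (rule prod_mono) (use assms(1,2) in \<open>auto simp: decseq_def less_Suc_eq_le\<close>)
  also have "\<dots> \<le> \<bar>coeff p ?k\<bar>"
    using prod_le_coeff_prod[of a ?k "max m ?k", OF assms(2)] assms(3)[of "max m ?k"] by simp
  also have "\<dots> \<le> C ^ ?k / (fact ?k)\<^sup>2" by (rule C)
  also have "\<dots> \<le> C ^ ?k / (real ?k ^ ?k / exp (real ?k))\<^sup>2"
    using power_le_exp_fact[of ?k] C(1)
    by (intro divide_left_mono power_mono mult_pos_pos zero_less_power)
       (auto simp: field_simps simp del: fact_Suc of_nat_Suc power_Suc)
  also have "\<dots> = (C * exp 2 / (real ?k)\<^sup>2) ^ ?k"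
    by (simp add: power_divide power_mult_distrib exp_of_nat_mult[symmetric] power_mult[symmetric]
        mult.commute del: of_nat_Suc power_Suc)
  finally show ?thesis
    using C(1) by (subst (asm) power_mono_iff) (auto simp: assms(2))
qed

text \<open>Division of each factor by 1 + B i brings it into [-1, 1], where a difference of
  products is at most the sum of the differences; what was divided out is at most exp (\<Sum> B
  i).\<close>

lemma prod_diff_le:
  fixes u v B :: "nat \<Rightarrow> real"
  assumes "\<And>i. \<bar>u i\<bar> \<le> B i" "\<And>i. \<bar>v i\<bar> \<le> B i"
  shows "\<bar>(\<Prod>i<n. 1 - u i) - (\<Prod>i<n. 1 - v i)\<bar> \<le> exp (\<Sum>i<n. B i) * (\<Sum>i<n. \<bar>u i - v i\<bar>)"
proof -
  have B: "0 \<le> B i" for i using assms(1)[of i] by simp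
  have split: "(\<Prod>i<n. 1 - w i) = (\<Prod>i<n. 1 + B i) * (\<Prod>i<n. (1 - w i) / (1 + B i))" for w
  proof -
    have "1 + B i \<noteq> 0" for i using B[of i] by simp
    then show ?thesis by (simp flip: prod.distrib)
  qed
  have "\<bar>(\<Prod>i<n. 1 - u i) - (\<Prod>i<n. 1 - v i)\<bar>
      = (\<Prod>i<n. 1 + B i) * \<bar>(\<Prod>i<n. (1 - u i) / (1 + B i)) - (\<Prod>i<n. (1 - v i) / (1 + B i))\<bar>"
    unfolding split[of u] split[of v] right_diff_distrib[symmetric] abs_mult
    using B by (simp add: prod_nonneg)
  also have "\<dots> \<le> (\<Prod>i<n. 1 + B i) * (\<Sum>i<n. \<bar>u i - v i\<bar>)"
  proof (rule mult_left_mono)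
    have norm_le: "norm ((1 - w i) / (1 + B i)) \<le> 1" if "\<bar>w i\<bar> \<le> B i" for w i
      using that B[of i] by (auto simp: field_simps abs_le_iff)
    have "\<bar>(\<Prod>i<n. (1 - u i) / (1 + B i)) - (\<Prod>i<n. (1 - v i) / (1 + B i))\<bar>
        \<le> (\<Sum>i<n. \<bar>(1 - u i) / (1 + B i) - (1 - v i) / (1 + B i)\<bar>)"
      using norm_prod_diff[of "{..<n}" "\<lambda>i. (1 - u i) / (1 + B i)" "\<lambda>i. (1 - v i) / (1 + B i)",
          OF norm_le[of u] norm_le[of v]] assms by (simp only: real_norm_def)
    also have "\<dots> \<le> (\<Sum>i<n. \<bar>u i - v i\<bar>)"
    proof (rule sum_mono)
      fix i
      have "\<bar>(1 - u i) / (1 + B i) - (1 - v i) / (1 + B i)\<bar> = \<bar>u i - v i\<bar> / (1 + B i)"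
        using B[of i] by (simp add: abs_minus_commute flip: diff_divide_distrib)
      also have "\<dots> \<le> \<bar>u i - v i\<bar>" using B[of i] by (simp add: field_simps mult_nonneg_nonneg)
      finally show "\<bar>(1 - u i) / (1 + B i) - (1 - v i) / (1 + B i)\<bar> \<le> \<bar>u i - v i\<bar>" .
    qed
    finally show "\<bar>(\<Prod>i<n. (1 - u i) / (1 + B i)) - (\<Prod>i<n. (1 - v i) / (1 + B i))\<bar>
      \<le> (\<Sum>i<n. \<bar>u i - v i\<bar>)" .
  qed (use B in \<open>auto intro!: prod_nonneg\<close>)
  also have "(\<Prod>i<n. 1 + B i) \<le> exp (\<Sum>i<n. B i)"
    unfolding exp_sum[OF finite_lessThan] using B by (intro prod_mono) (auto simp: exp_ge_add_one_self)
  finally show ?thesis by (auto simp: mult_right_mono sum_nonneg)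
qed

text \<open>Sequential compactness of a countable product of intervals, by Cantor's diagonal
  argument.\<close>

lemma convergent_subsequence_pointwise:
  fixes b :: "nat \<Rightarrow> nat \<Rightarrow> real"
  assumes "\<And>N i. 0 \<le> b N i" "\<And>N i. b N i \<le> M i"
  shows "\<exists>r a. strict_mono (r :: nat \<Rightarrow> nat) \<and> (\<forall>i. (\<lambda>N. b (r N) i) \<longlonglongrightarrow> a i)"
proof -
  let ?P = "\<lambda>i s. convergent (\<lambda>k. b (s k) i)"
  interpret nat: subseqs ?P
  proof (unfold_locales)
    fix i :: nat and s :: "nat \<Rightarrow> nat" assume s: "strict_mono s"
    have "\<forall>k. b (s k) i \<in> {0..M i}" using assms by auto
    then obtain l s' where "strict_mono (s' :: nat \<Rightarrow> nat)" "((\<lambda>k. b (s k) i) \<circ> s') \<longlonglongrightarrow> l"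
      using compact_Icc[of 0 "M i"] compact_imp_seq_compact seq_compactE by metis
    then show "\<exists>r'. strict_mono (r' :: nat \<Rightarrow> nat) \<and> ?P i (s \<circ> r')"
      by (auto simp: comp_def convergent_def)
  qed
  define d where "d = nat.diagseq"
  have "?P i d" for i
  proof -
    have "?P i (d \<circ> ((+) (Suc i)))"
      unfolding d_def
    proof (rule nat.diagseq_holds)
      fix r s :: "nat \<Rightarrow> nat" and n
      assume "strict_mono r" "?P n s"
      then show "?P n (s \<circ> r)"
        using convergent_subseq_convergent[of "\<lambda>k. b (s k) n" r] by (simp add: o_def)
    qed
    then obtain L where "(\<lambda>k. b (d (k + Suc i)) i) \<longlonglongrightarrow> L"
      by (auto simp: add.commute convergent_def o_def)
    then have "(\<lambda>k. b (d k) i) \<longlonglongrightarrow> L"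
      by (rule LIMSEQ_offset)
    then show ?thesis by (auto simp: convergent_def)
  qed
  then have "(\<lambda>k. b (d k) i) \<longlonglongrightarrow> lim (\<lambda>k. b (d k) i)" for i
    by (simp add: convergent_LIMSEQ_iff)
  moreover have "strict_mono d"
    unfolding d_def by (rule nat.subseq_diagseq)
  ultimately show ?thesis
    by (intro exI[of _ d] exI[of _ "\<lambda>i. lim (\<lambda>k. b (d k) i)"] conjI allI)
qed

text \<open>Along a subsequence the padded reciprocal zeros converge index by index. The majorant M
  of order 1/i^2, common to all polynomials, turns this into convergence in l^1, and that carries
  the products over to the limit.\<close>

theorem positive_rooted_limit:
  fixes p :: "nat \<Rightarrow> real poly" and f :: "nat \<Rightarrow> real"
  assumes rooted: "\<And>N. positive_rooted (p N)"
    and C: "0 \<le> C" "\<And>N n. \<bar>coeff (p N) n\<bar> \<le> C ^ n / (fact n)\<^sup>2"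
    and lim: "\<And>n. (\<lambda>N. coeff (p N) n) \<longlonglongrightarrow> (- 1) ^ n * f n"
    and f: "\<And>n. 0 < f n"
  shows "\<exists>a. decseq a \<and> (\<forall>i::nat. 0 < a i) \<and> summable a \<and>
    (\<forall>x. (\<lambda>n. \<Prod>i<n. 1 - a i * x) \<longlonglongrightarrow> (\<Sum>n. (- 1) ^ n * f n * x ^ n))"
proof -
  have "\<forall>N. \<exists>a m. decseq a \<and> (\<forall>i::nat. 0 \<le> a i) \<and> (\<forall>n\<ge>m. p N = (\<Prod>i<n. [:1, - a i:]))"
    using positive_rooted_sequence[OF rooted] by blast
  then obtain b m where b: "\<And>N. decseq (b N)" "\<And>N i. 0 \<le> b N i"
    "\<And>N n. m N \<le> n \<Longrightarrow> p N = (\<Prod>i<n. [:1, - b N i:])"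
    by metis
  define M where "M i = C * exp 2 * (1 / real (Suc i) ^ 2)" for i
  have M: "summable M"
  proof -
    have "summable (\<lambda>i. inverse (real i ^ 2))"
      by (rule inverse_power_summable) simp
    then have "summable (\<lambda>i. inverse (real (Suc i) ^ 2))"
      by (subst summable_Suc_iff)
    then show ?thesis
      unfolding M_def by (intro summable_mult) (simp only: inverse_eq_divide)
  qed
  have bM: "b N i \<le> M i" for N i
    using zero_bound[OF b(1,2,3) C] by (simp add: M_def)
  obtain r a where r: "strict_mono (r :: nat \<Rightarrow> nat)" and a: "\<And>i. (\<lambda>N. b (r N) i) \<longlonglongrightarrow> a i"
    using convergent_subsequence_pointwise[of b M, OF b(2) bM] by blast
  have a0: "0 \<le> a i" for i by (rule LIMSEQ_le_const[OF a]) (use b in auto)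
  have aM: "a i \<le> M i" for i by (rule LIMSEQ_le_const2[OF a]) (use bM in auto)
  have dec: "decseq a"
    unfolding decseq_def
  proof (intro allI impI)
    fix i j :: nat
    assume "i \<le> j"
    then have "b (r N) j \<le> b (r N) i" for N
      using b(1)[of "r N"] by (simp add: decseq_def)
    then show "a j \<le> a i"
      by (intro LIMSEQ_le[OF a a]) auto
  qed
  have sum_a: "summable a"
    by (rule summable_comparison_test'[OF M, of 0]) (use a0 aM in auto)
  define F where "F x = (\<Sum>n. (- 1) ^ n * f n * x ^ n)" for x
  have fC: "f n \<le> C ^ n / (fact n)\<^sup>2" for n
  proof (rule LIMSEQ_le_const2)
    show "(\<lambda>N. \<bar>coeff (p N) n\<bar>) \<longlonglongrightarrow> f n"
      using tendsto_rabs[OF lim[of n]] f[of n] by (simp add: abs_mult)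
  qed (use C in auto)
  have dom: "summable (\<lambda>n. C ^ n / (fact n)\<^sup>2 * \<bar>x\<bar> ^ n)" for x
  proof (rule summable_comparison_test'[OF summable_exp[of "C * \<bar>x\<bar>"], of 0])
    fix n
    have "1 / (fact n)\<^sup>2 \<le> inverse (fact n :: real)"
      using fact_ge_1[of n, where 'a = real] by (simp add: field_simps power2_eq_square)
    then show "norm (C ^ n / (fact n)\<^sup>2 * \<bar>x\<bar> ^ n) \<le> inverse (fact n) * (C * \<bar>x\<bar>) ^ n"
      using C mult_right_mono[of "1 / (fact n)\<^sup>2" "inverse (fact n)" "(C * \<bar>x\<bar>) ^ n"]
      by (simp add: power_mult_distrib power_abs abs_mult)
  qed
  \<comment> \<open>Convergence of coefficients becomes convergence of values by dominated
    convergence, with the terms of \<open>dom\<close> as majorant.\<close>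
  have poly_lim: "(\<lambda>N. poly (p N) x) \<longlonglongrightarrow> F x" for x
  proof -
    have "(\<lambda>N. \<Sum>n. coeff (p N) n * x ^ n) \<longlonglongrightarrow> (\<Sum>n. (- 1) ^ n * f n * x ^ n)"
    proof (rule tannerys_theorem[THEN conjunct2, THEN conjunct2])
      show "eventually (\<lambda>(n, N). norm (coeff (p N) n * x ^ n) \<le> C ^ n / (fact n)\<^sup>2 * \<bar>x\<bar> ^ n)
          (at_top \<times>\<^sub>F sequentially)"
        using mult_right_mono[OF C(2), of "\<bar>x\<bar> ^ _"]
        by (intro always_eventually) (auto simp: abs_mult power_abs)
    qed (intro tendsto_mult lim tendsto_const, rule dom, simp)
    moreover have "(\<Sum>n. coeff (p N) n * x ^ n) = poly (p N) x" for N
      unfolding poly_altdef by (rule suminf_finite) (auto simp: coeff_eq_0)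
    ultimately show ?thesis by (simp add: F_def)
  qed
  have prod_lim: "(\<lambda>n. \<Prod>i<n. 1 - a i * x) \<longlonglongrightarrow> F x" for x
  proof -
    define S where "S = exp (\<Sum>i. M i * \<bar>x\<bar>)"
    define D where "D N = (\<Sum>i. \<bar>b (r N) i - a i\<bar>)" for N
    have diffM: "\<bar>b N i - a i\<bar> \<le> M i" for N i
      using bM[of N i] aM[of i] a0[of i] b(2)[of N i] by auto
    have diff_sum: "summable (\<lambda>i. \<bar>b (r N) i - a i\<bar>)" for N
      by (rule summable_comparison_test'[OF M, of 0]) (use diffM in auto)
    have "D \<longlonglongrightarrow> (\<Sum>i. 0)"
      unfolding D_def
    proof (rule tannerys_theorem[THEN conjunct2, THEN conjunct2])
      show "(\<lambda>N. \<bar>b (r N) i - a i\<bar>) \<longlonglongrightarrow> 0" for i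
        using tendsto_rabs[OF tendsto_diff[OF a[of i] tendsto_const[of "a i"]]] by simp
      show "eventually (\<lambda>(i, N). norm \<bar>b (r N) i - a i\<bar> \<le> M i) (at_top \<times>\<^sub>F sequentially)"
        by (rule always_eventually) (auto simp: diffM)
    qed (rule M, simp)
    then have D: "D \<longlonglongrightarrow> 0" by simp
    have lim_r: "(\<lambda>N. poly (p (r N)) x) \<longlonglongrightarrow> F x"
      using LIMSEQ_subseq_LIMSEQ[OF poly_lim r] by (simp add: o_def)
    \<comment> \<open>S bounds all the exponentials and D N is the l^1 distance of the two
      sequences, so the estimate is uniform in n. Below, N is fixed before n tends to
      infinity.\<close>
    have close: "\<bar>(\<Prod>i<n. 1 - a i * x) - poly (p (r N)) x\<bar> \<le> S * (\<bar>x\<bar> * D N)"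
      if "m (r N) \<le> n" for n N
    proof -
      have "poly (p (r N)) x = (\<Prod>i<n. 1 - b (r N) i * x)"
        unfolding b(3)[OF that] by (simp add: poly_prod mult.commute)
      then have "\<bar>(\<Prod>i<n. 1 - a i * x) - poly (p (r N)) x\<bar>
          \<le> exp (\<Sum>i<n. M i * \<bar>x\<bar>) * (\<Sum>i<n. \<bar>a i * x - b (r N) i * x\<bar>)"
        using prod_diff_le[of "\<lambda>i. a i * x" "\<lambda>i. M i * \<bar>x\<bar>" "\<lambda>i. b (r N) i * x" n] a0 aM bM b(2)
        by (simp add: abs_mult mult_right_mono)
      also have "(\<Sum>i<n. \<bar>a i * x - b (r N) i * x\<bar>) = \<bar>x\<bar> * (\<Sum>i<n. \<bar>b (r N) i - a i\<bar>)"
        unfolding sum_distrib_left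
        by (rule sum.cong) (simp_all add: abs_minus_commute flip: abs_mult, simp add: algebra_simps)
      also have "exp (\<Sum>i<n. M i * \<bar>x\<bar>) * (\<bar>x\<bar> * (\<Sum>i<n. \<bar>b (r N) i - a i\<bar>)) \<le> S * (\<bar>x\<bar> * D N)"
        unfolding S_def D_def
        using a0 aM order_trans
        by (intro mult_mono) (auto intro!: sum_le_suminf summable_mult2 M diff_sum sum_nonneg
            mult_nonneg_nonneg suminf_nonneg intro: order_trans[OF a0 aM])
      finally show ?thesis .
    qed
    show ?thesis
    proof (rule LIMSEQ_I)
      fix e :: real assume "0 < e"
      have "(\<lambda>N. S * (\<bar>x\<bar> * D N)) \<longlonglongrightarrow> S * (\<bar>x\<bar> * 0)" by (intro tendsto_intros D)
      then have "eventually (\<lambda>N. S * (\<bar>x\<bar> * D N) < e / 2) sequentially"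
        using order_tendstoD(2)[of _ 0 sequentially "e / 2"] \<open>0 < e\<close> by simp
      moreover have "eventually (\<lambda>N. \<bar>poly (p (r N)) x - F x\<bar> < e / 2) sequentially"
        using tendstoD[OF lim_r, of "e / 2"] \<open>0 < e\<close> by (simp add: dist_real_def)
      ultimately have "eventually (\<lambda>N. S * (\<bar>x\<bar> * D N) < e / 2 \<and> \<bar>poly (p (r N)) x - F x\<bar> < e / 2) sequentially"
        by eventually_elim simp
      then obtain N where N: "S * (\<bar>x\<bar> * D N) < e / 2" "\<bar>poly (p (r N)) x - F x\<bar> < e / 2"
        by (auto simp: eventually_sequentially)
      have "norm ((\<Prod>i<n. 1 - a i * x) - F x) < e" if "m (r N) \<le> n" for n
        unfolding real_norm_def using close[OF that] N by linarith
      then show "\<exists>no. \<forall>n\<ge>no. norm ((\<Prod>i<n. 1 - a i * x) - F x) < e" by blast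
    qed
  qed
  \<comment> \<open>If a vanished from index k on, F would be a polynomial of degree at most k. But
    at - x all terms of the series are positive, so F (- x) \<ge> f (k + 1) x^(k+1), which outgrows
    ((1 + a 0) x)^k.\<close>
  have pos: "0 < a k" for k
  proof (rule ccontr)
    assume "\<not> 0 < a k"
    then have z: "a i = 0" if "k \<le> i" for i
      using dec a0 that by (metis antisym decseq_def not_less)
    have F: "F x = (\<Prod>i<k. 1 - a i * x)" for x
    proof (rule LIMSEQ_unique[OF prod_lim])
      have "(\<Prod>i<n. 1 - a i * x) = (\<Prod>i<k. 1 - a i * x)" if "k \<le> n" for n
        using that z by (intro prod.mono_neutral_right) auto
      then show "(\<lambda>n. \<Prod>i<n. 1 - a i * x) \<longlonglongrightarrow> (\<Prod>i<k. 1 - a i * x)"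
        by (intro tendsto_eventually eventually_sequentiallyI[of k])
    qed
    have bound: "x * f (Suc k) \<le> (1 + a 0) ^ k" if "1 \<le> x" for x
    proof -
      have "f (Suc k) * x ^ Suc k = (\<Sum>n\<in>{Suc k}. f n * x ^ n)" by simp
      also have "\<dots> \<le> (\<Sum>n. f n * x ^ n)"
      proof (rule sum_le_suminf)
        show "summable (\<lambda>n. f n * x ^ n)"
          by (rule summable_comparison_test'[OF dom[of x], of 0])
             (use mult_right_mono[OF fC, of "x ^ _"] f that in \<open>simp add: abs_mult abs_of_pos\<close>)
      qed (use f that in \<open>auto simp: less_imp_le\<close>)
      also have "\<dots> = F (- x)"
        unfolding F_def by (intro suminf_cong) (simp add: mult_ac flip: power_mult_distrib)
      also have "\<dots> = (\<Prod>i<k. 1 + a i * x)" by (simp add: F)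
      also have "\<dots> \<le> (\<Prod>i<k. (1 + a 0) * x)"
      proof (rule prod_mono)
        fix i
        have "a i * x \<le> a 0 * x" using dec that by (intro mult_right_mono) (auto simp: decseq_def)
        moreover have "0 \<le> a i * x" using that a0[of i] by simp
        ultimately show "0 \<le> 1 + a i * x \<and> 1 + a i * x \<le> (1 + a 0) * x"
          using that unfolding distrib_right by linarith
      qed
      also have "\<dots> = (1 + a 0) ^ k * x ^ k" by (simp add: power_mult_distrib)
      finally have "x * f (Suc k) * x ^ k \<le> (1 + a 0) ^ k * x ^ k" by (simp add: mult_ac)
      then show ?thesis using that by simp
    qed
    define y where "y = max 1 ((1 + a 0) ^ k / f (Suc k) + 1)"
    have "y * f (Suc k) > (1 + a 0) ^ k"
      using f[of "Suc k"] by (auto simp: y_def max_def field_simps)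
    with bound[of y] show False by (simp add: y_def)
  qed
  show ?thesis
    using dec pos sum_a prod_lim unfolding F_def by blast
qed

section \<open>Strict concavity and absolute monotonicity\<close>

text \<open>Two applications of the mean value theorem, one on each side of the intermediate point,
  compare the slopes of the two chords.\<close>

lemma strictly_concave_on_deriv:
  fixes f f' :: "real \<Rightarrow> real"
  assumes "convex K" and deriv: "\<And>x. x \<in> K \<Longrightarrow> (f has_real_derivative f' x) (at x)"
    and anti: "\<And>x y. x \<in> K \<Longrightarrow> y \<in> K \<Longrightarrow> x < y \<Longrightarrow> f' y < f' x"
  shows "strictly_concave_on K f"
proof -
  have less: "(1 - t) * f x + t * f y < f ((1 - t) * x + t * y)"
    if "x \<in> K" "y \<in> K" "0 < t" "t < 1" "x < y" for x y t
  proof -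
    define z where "z = (1 - t) * x + t * y"
    have zx: "z - x = t * (y - x)" and yz: "y - z = (1 - t) * (y - x)"
      by (simp_all add: z_def algebra_simps)
    have "x < z" "z < y"
      using that zx yz by (metis diff_gt_0_iff_gt mult_pos_pos)+
    have K: "w \<in> K" if "x \<le> w" "w \<le> y" for w
      using \<open>convex K\<close> \<open>x \<in> K\<close> \<open>y \<in> K\<close> that by (meson atLeastAtMost_iff convex_contains_segment
          closed_segment_eq_real_ivl in_mono is_interval_convex_1 mem_is_interval_1_I)
    obtain u where u: "x < u" "u < z" "f z - f x = (z - x) * f' u"
      using MVT2[OF \<open>x < z\<close>, of f f'] deriv K \<open>z < y\<close> by force
    obtain v where v: "z < v" "v < y" "f y - f z = (y - z) * f' v"
      using MVT2[OF \<open>z < y\<close>, of f f'] deriv K \<open>x < z\<close> by force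
    have "f' v < f' u" using anti[of u v] K u v \<open>x < z\<close> \<open>z < y\<close> by auto
    have "f z - ((1 - t) * f x + t * f y) = (1 - t) * (f z - f x) - t * (f y - f z)"
      by (simp add: algebra_simps)
    also have "\<dots> = t * (1 - t) * (y - x) * (f' u - f' v)"
      unfolding u(3) v(3) zx yz by (simp add: algebra_simps)
    also have "\<dots> > 0" using that \<open>f' v < f' u\<close> by simp
    finally show ?thesis by (simp add: z_def)
  qed
  show ?thesis
    unfolding strictly_concave_on_def
  proof (intro conjI ballI impI)
    fix x y t :: real
    assume *: "x \<in> K" "y \<in> K" "t \<in> {0<..<1}" "x \<noteq> y"
    show "(1 - t) * f x + t * f y < f ((1 - t) * x + t * y)"
    proof (cases "x < y")
      case True
      then show ?thesis using less[of x y t] * by auto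
    next
      case False
      then show ?thesis using less[of y x "1 - t"] * by (simp add: add.commute)
    qed
  qed (rule assms)
qed

text \<open>Absolute monotonicity up to order m, with the derivative taken first: this recursion
  lets induction over m handle sums and products directly. Differentiability is recorded only for
  the orders below m.\<close>

primrec nonneg_derivs :: "nat \<Rightarrow> real set \<Rightarrow> (real \<Rightarrow> real) \<Rightarrow> bool" where
  "nonneg_derivs 0 A f \<longleftrightarrow> (\<forall>x\<in>A. 0 \<le> f x)"
| "nonneg_derivs (Suc m) A f \<longleftrightarrow>
     (\<forall>x\<in>A. 0 \<le> f x \<and> f field_differentiable (at x)) \<and> nonneg_derivs m A (deriv f)"

lemma nonneg_derivs_SucD: "nonneg_derivs (Suc m) A f \<Longrightarrow> nonneg_derivs m A f"
  by (induction m arbitrary: f) auto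

text \<open>Openness of A turns equality on A into equality near each point, on which derivatives
  depend.\<close>

lemma nonneg_derivs_cong:
  assumes "open A" "\<And>x. x \<in> A \<Longrightarrow> f x = g x" "nonneg_derivs m A f"
  shows "nonneg_derivs m A g"
  using assms(2,3)
proof (induction m arbitrary: f g)
  case (Suc m)
  have ev: "eventually (\<lambda>y. f y = g y) (nhds x)" if "x \<in> A" for x
    using eventually_nhds_in_open[OF assms(1) that] by eventually_elim (rule Suc.prems)
  have "deriv f x = deriv g x" if "x \<in> A" for x
    by (rule deriv_cong_ev[OF ev[OF that] refl])
  then have "nonneg_derivs m A (deriv g)"
    by (rule Suc.IH) (use Suc.prems(2) in simp_all)
  moreover have "g field_differentiable (at x)" if "x \<in> A" for x
  proof -
    have "f field_differentiable (at x)" using Suc.prems(2) that by simp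
    then obtain D where "(f has_field_derivative D) (at x)"
      unfolding field_differentiable_def ..
    then have "(g has_field_derivative D) (at x)"
      by (subst (asm) DERIV_cong_ev[OF refl ev[OF that] refl])
    then show ?thesis by (auto simp: field_differentiable_def)
  qed
  ultimately show ?case using Suc.prems by auto
qed auto

lemma nonneg_derivs_SucI:
  assumes "open A" "\<And>x. x \<in> A \<Longrightarrow> 0 \<le> f x" "\<And>x. x \<in> A \<Longrightarrow> (f has_real_derivative g x) (at x)"
    "nonneg_derivs m A g"
  shows "nonneg_derivs (Suc m) A f"
proof -
  have "nonneg_derivs m A (deriv f)"
    by (rule nonneg_derivs_cong[OF assms(1) _ assms(4)]) (use assms(3) DERIV_imp_deriv in metis)
  then show ?thesis using assms by (auto simp: field_differentiable_def)
qed

lemma nonneg_derivs_SucE: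
  assumes "nonneg_derivs (Suc m) A f" "x \<in> A"
  shows "(f has_real_derivative deriv f x) (at x)"
  using assms by (simp add: field_differentiable_derivI)

lemma nonneg_derivs_add:
  assumes "open A" "nonneg_derivs m A f" "nonneg_derivs m A g"
  shows "nonneg_derivs m A (\<lambda>x. f x + g x)"
  using assms(2,3)
proof (induction m arbitrary: f g)
  case (Suc m)
  show ?case
  proof (rule nonneg_derivs_SucI[OF assms(1)])
    show "nonneg_derivs m A (\<lambda>x. deriv f x + deriv g x)" using Suc by auto
  qed (use Suc.prems in \<open>auto intro!: DERIV_add nonneg_derivs_SucE\<close>)
qed auto

lemma nonneg_derivs_mult:
  assumes "open A" "nonneg_derivs m A f" "nonneg_derivs m A g"
  shows "nonneg_derivs m A (\<lambda>x. f x * g x)"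
  using assms(2,3)
proof (induction m arbitrary: f g)
  case (Suc m)
  show ?case
  proof (rule nonneg_derivs_SucI[OF assms(1)])
    show "nonneg_derivs m A (\<lambda>x. deriv f x * g x + deriv g x * f x)"
      by (intro nonneg_derivs_add[OF assms(1)] Suc.IH)
        (use Suc.prems nonneg_derivs_SucD in auto)
  qed (use Suc.prems in \<open>auto intro!: DERIV_mult nonneg_derivs_SucE\<close>)
qed auto

lemma nonneg_derivs_const: "0 \<le> c \<Longrightarrow> nonneg_derivs m A (\<lambda>x. c)"
  by (induction m arbitrary: c) auto

lemma absolutely_monotonic_onI:
  assumes "\<And>m. nonneg_derivs m A f"
  shows "absolutely_monotonic_on A f"
proof -
  \<comment> \<open>Differentiability of the m-th derivative is recorded only one level higher,
    hence \<open>Suc m\<close>.\<close>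
  have higher: "nonneg_derivs (Suc m) A f \<Longrightarrow> x \<in> A \<Longrightarrow>
      (deriv ^^ m) f field_differentiable (at x) \<and> 0 \<le> (deriv ^^ m) f x" for m x f
    by (induction m arbitrary: f) (auto simp: funpow_Suc_right simp del: funpow.simps)
  show ?thesis unfolding absolutely_monotonic_on_def using higher[OF assms] by blast
qed

section \<open>Products with positive zeros\<close>

text \<open>The numbers 1 / a i are the zeros of F in nondecreasing order. Differentiability is a
  separate assumption because a pointwise limit of products does not provide it; the power series
  will.\<close>

locale zero_product =
  fixes a :: "nat \<Rightarrow> real" and F :: "real \<Rightarrow> real"
  assumes dec: "decseq a" and pos: "\<And>i. 0 < a i" and summ: "summable a"
    and lim: "\<And>x. (\<lambda>n. \<Prod>i<n. 1 - a i * x) \<longlonglongrightarrow> F x"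
    and diff: "\<And>x. F field_differentiable (at x)"
begin

text \<open>Avoidance of the zeros 1 / a i, expressed without F so that it is available before
  \<open>F_zero_iff\<close> links it to F x \<noteq> 0.\<close>

definition regular :: "real \<Rightarrow> bool" where
  "regular x \<longleftrightarrow> (\<forall>i. a i * x \<noteq> 1)"

text \<open>S 1 is - F'/F, and at regular points the (m - 1)-th derivative of S 1 is (m - 1)! S
  m.\<close>

definition S :: "nat \<Rightarrow> real \<Rightarrow> real" where
  "S m x = (\<Sum>i. (a i / (1 - a i * x)) ^ m)"

lemma a_le: "a i \<le> a 0"
  using dec by (simp add: decseq_def)

lemma small_tail: "\<exists>n. \<forall>i\<ge>n. a i * r \<le> 1 / 2"
proof -
  have "(\<lambda>i. a i * r) \<longlonglongrightarrow> 0 * r"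
    by (intro tendsto_mult summable_LIMSEQ_zero[OF summ] tendsto_const)
  then have "eventually (\<lambda>i. a i * r < 1 / 2) sequentially"
    by (rule order_tendstoD) simp
  then show ?thesis unfolding eventually_sequentially using less_imp_le by blast
qed

text \<open>One lower bound for all factors near x, which makes the termwise majorants uniform. Only
  finitely many factors can be small: the others have a i |y| \<le> 1/2.\<close>

lemma regular_gap:
  assumes "regular x"
  obtains \<delta> e where "0 < \<delta>" "0 < e" "\<And>y i. \<bar>y - x\<bar> < e \<Longrightarrow> \<delta> \<le> \<bar>1 - a i * y\<bar>"
proof -
  obtain n where n: "\<And>i. i \<ge> n \<Longrightarrow> a i * (\<bar>x\<bar> + 1) \<le> 1 / 2"
    using small_tail by blast
  define d where "d = Min (insert 1 ((\<lambda>i. \<bar>1 - a i * x\<bar>) ` {..<n}))"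
  have "0 < d" using assms by (auto simp: d_def regular_def)
  have "d \<le> 1" and d: "\<And>i. i < n \<Longrightarrow> d \<le> \<bar>1 - a i * x\<bar>"
    by (auto simp: d_def intro!: Min_le)
  \<comment> \<open>Radius at most 1 serves the tail, and d / (2 * a 0) moves each of the first n
    factors by at most d / 2. The 1 inserted in the minimum gives d / 2 \<le> 1 / 2, as the tail
    requires.\<close>
  define e where "e = min 1 (d / (2 * a 0))"
  have "0 < e" using \<open>0 < d\<close> pos[of 0] by (simp add: e_def)
  have "d / 2 \<le> \<bar>1 - a i * y\<bar>" if y: "\<bar>y - x\<bar> < e" for y i
  proof (cases "i < n")
    case True
    have "\<bar>a i * y - a i * x\<bar> = a i * \<bar>y - x\<bar>"
      using pos[of i] by (simp add: abs_mult flip: right_diff_distrib)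
    also have "\<dots> \<le> a 0 * (d / (2 * a 0))"
      using a_le[of i] pos[of i] y by (intro mult_mono) (auto simp: e_def)
    also have "\<dots> = d / 2" using pos[of 0] by simp
    finally show ?thesis using d[OF True] by linarith
  next
    case False
    have "\<bar>a i * y\<bar> = a i * \<bar>y\<bar>" using pos[of i] by (simp add: abs_mult)
    also have "\<dots> \<le> a i * (\<bar>x\<bar> + 1)" using pos[of i] y by (intro mult_left_mono) (auto simp: e_def)
    also have "\<dots> \<le> 1 / 2" using n False by simp
    finally show ?thesis using \<open>d \<le> 1\<close> by linarith
  qed
  then show ?thesis using that[of "d / 2" e] \<open>0 < d\<close> \<open>0 < e\<close> by simp
qed

lemma summable_power_a: "1 \<le> m \<Longrightarrow> summable (\<lambda>i. (a i / \<delta>) ^ m)"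
proof (rule summable_comparison_test'[where N = 0])
  assume m: "1 \<le> m"
  show "summable (\<lambda>i. a i * (a 0 ^ (m - 1) / \<bar>\<delta>\<bar> ^ m))"
    by (rule summable_mult2[OF summ])
  fix i
  have "a i ^ m = a i * a i ^ (m - 1)" using m by (cases m) auto
  also have "\<dots> \<le> a i * a 0 ^ (m - 1)"
    using pos a_le by (intro mult_left_mono power_mono) (auto simp: less_imp_le)
  finally show "norm ((a i / \<delta>) ^ m) \<le> a i * (a 0 ^ (m - 1) / \<bar>\<delta>\<bar> ^ m)"
    using pos[of i] by (simp add: power_divide power_abs divide_right_mono)
qed

lemma term_le:
  assumes "0 < \<delta>" "\<delta> \<le> \<bar>1 - a i * y\<bar>"
  shows "norm ((a i / (1 - a i * y)) ^ m) \<le> (a i / \<delta>) ^ m"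
  unfolding norm_power
  using assms pos[of i] by (intro power_mono) (auto intro!: divide_left_mono mult_pos_pos)

lemma regular_summable:
  assumes "regular x" "1 \<le> m"
  shows "summable (\<lambda>i. (a i / (1 - a i * x)) ^ m)"
proof -
  obtain \<delta> e where de: "0 < \<delta>" "0 < e" "\<And>y i. \<bar>y - x\<bar> < e \<Longrightarrow> \<delta> \<le> \<bar>1 - a i * y\<bar>"
    using regular_gap[OF assms(1)] by blast
  show ?thesis
    by (rule summable_comparison_test'[OF summable_power_a[OF assms(2), of \<delta>], of 0])
       (use term_le[OF de(1) de(3)[of x]] de(2) in auto)
qed

lemma S_deriv:
  assumes "regular x" "1 \<le> m"
  shows "(S m has_real_derivative real m * S (Suc m) x) (at x)"
proof -
  obtain \<delta> e where de: "0 < \<delta>" "0 < e" "\<And>y i. \<bar>y - x\<bar> < e \<Longrightarrow> \<delta> \<le> \<bar>1 - a i * y\<bar>"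
    using regular_gap[OF assms(1)] by blast
  have B: "\<bar>y - x\<bar> < e" if "y \<in> ball x e" for y
    using that by (simp add: dist_real_def abs_minus_commute)
  have "((\<lambda>y. \<Sum>i. (a i / (1 - a i * y)) ^ m) has_field_derivative
      (\<Sum>i. real m * (a i / (1 - a i * x)) ^ Suc m)) (at x)"
  proof (rule has_field_derivative_series'(2))
    show "convex (ball x e)" by simp
    fix i y assume y: "y \<in> ball x e"
    have nz: "1 - a i * y \<noteq> 0" using de(1) de(3)[OF B[OF y], of i] by auto
    have "((\<lambda>y. (a i / (1 - a i * y)) ^ m) has_field_derivative
       real m * (a i / (1 - a i * y)) ^ (m - 1) * (a i * a i / (1 - a i * y)\<^sup>2)) (at y within ball x e)"
      by (rule derivative_eq_intros refl nz)+ (simp add: power2_eq_square)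
    moreover have "(a i / (1 - a i * y)) ^ (m - 1) * (a i * a i / (1 - a i * y)\<^sup>2) = (a i / (1 - a i * y)) ^ Suc m"
      using assms(2) by (cases m) (simp_all add: power2_eq_square)
    ultimately show "((\<lambda>y. (a i / (1 - a i * y)) ^ m) has_field_derivative
       real m * (a i / (1 - a i * y)) ^ Suc m) (at y within ball x e)"
      by (simp only: mult.assoc)
  next
    show "uniformly_convergent_on (ball x e) (\<lambda>n y. \<Sum>i<n. real m * (a i / (1 - a i * y)) ^ Suc m)"
    proof (rule Weierstrass_m_test')
      show "summable (\<lambda>i. real m * (a i / \<delta>) ^ Suc m)"
        by (intro summable_mult summable_power_a) simp
      fix i y assume "y \<in> ball x e"
      then have "real m * norm ((a i / (1 - a i * y)) ^ Suc m) \<le> real m * (a i / \<delta>) ^ Suc m"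
        by (intro mult_left_mono term_le de B) auto
      then show "norm (real m * (a i / (1 - a i * y)) ^ Suc m) \<le> real m * (a i / \<delta>) ^ Suc m"
        by (simp only: real_norm_def abs_mult abs_of_nat)
    qed
  next
    show "x \<in> ball x e" "x \<in> interior (ball x e)" using de(2) by auto
    show "summable (\<lambda>i. (a i / (1 - a i * x)) ^ m)" by (rule regular_summable[OF assms])
  qed
  then show ?thesis
    using suminf_mult[OF regular_summable[OF assms(1), of "Suc m"], of "real m"]
    unfolding S_def[abs_def] by simp
qed

lemma F_nonzero_deriv:
  assumes "regular x"
  shows "F x \<noteq> 0" "(F has_real_derivative - S 1 x * F x) (at x)"
proof -
  obtain \<delta> e where de: "0 < \<delta>" "0 < e" "\<And>y i. \<bar>y - x\<bar> < e \<Longrightarrow> \<delta> \<le> \<bar>1 - a i * y\<bar>"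
    using regular_gap[OF assms(1)] by blast
  have B: "\<bar>y - x\<bar> < e" if "y \<in> ball x e" for y
    using that by (simp add: dist_real_def abs_minus_commute)
  \<comment> \<open>\<open>U\<close> is \<open>ln (F\<^sup>2)\<close>; squaring avoids tracking the signs of the factors.\<close>
  define U where "U y = (\<Sum>i. ln ((1 - a i * y)\<^sup>2))" for y
  have nz: "1 - a i * y \<noteq> 0" if "y \<in> ball x e" for i y using de(1) de(3)[OF B[OF that], of i] by auto
  have base: "summable (\<lambda>i. ln ((1 - a i * x)\<^sup>2))"
  proof -
    obtain n where n: "\<And>i. i \<ge> n \<Longrightarrow> a i * \<bar>x\<bar> \<le> 1 / 2" using small_tail by blast
    show ?thesis
    proof (rule summable_comparison_test'[where N = n])
      \<comment> \<open>The 4 is a 2 from the square times a 2 from |ln (1 + t)| \<le> 2 |t|, valid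
        for |t| \<le> 1/2.\<close>
      show "summable (\<lambda>i. a i * (4 * \<bar>x\<bar>))" by (rule summable_mult2[OF summ])
      fix i assume i: "n \<le> i"
      define t where "t = - a i * x"
      have t: "\<bar>t\<bar> = a i * \<bar>x\<bar>" using pos[of i] by (simp add: t_def abs_mult)
      have t2: "\<bar>t\<bar> \<le> 1 / 2" using n[OF i] t by simp
      have "\<bar>ln (1 + t)\<bar> \<le> \<bar>t\<bar> + 2 * t\<^sup>2"
        using abs_ln_one_plus_x_minus_x_bound[OF t2] by linarith
      also have "2 * t\<^sup>2 \<le> \<bar>t\<bar>"
        using mult_right_mono[OF t2, of "\<bar>t\<bar>"] by (simp add: power2_eq_square)
      finally have "\<bar>ln (1 + t)\<bar> \<le> 2 * \<bar>t\<bar>" by simp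
      moreover have "ln ((1 - a i * x)\<^sup>2) = 2 * ln (1 + t)"
        using t2 by (simp add: t_def ln_realpow)
      ultimately show "norm (ln ((1 - a i * x)\<^sup>2)) \<le> a i * (4 * \<bar>x\<bar>)"
        using t by (simp add: abs_mult mult_ac)
    qed
  qed
  have U: "summable (\<lambda>i. ln ((1 - a i * y)\<^sup>2))"
    "(U has_field_derivative (\<Sum>i. - 2 * (a i / (1 - a i * y)) ^ 1)) (at y)" if y: "y \<in> ball x e" for y
  proof -
    have 1: "(\<And>n z. z \<in> ball x e \<Longrightarrow> ((\<lambda>y. ln ((1 - a n * y)\<^sup>2)) has_field_derivative
        - 2 * (a n / (1 - a n * z)) ^ 1) (at z within ball x e))"
    proof -
      fix i z assume "z \<in> ball x e"
      note nz = nz[OF this, of i]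
      then have "0 < (1 - a i * z)\<^sup>2" by simp
      then have "((\<lambda>y. ln ((1 - a i * y)\<^sup>2)) has_field_derivative
          inverse ((1 - a i * z)\<^sup>2) * (2 * (1 - a i * z) * (- a i))) (at z within ball x e)"
        by (auto intro!: derivative_eq_intros simp: power2_eq_square divide_simps)
      moreover have "inverse (u\<^sup>2) * (2 * u * (- a i)) = - 2 * (a i / u) ^ 1" if "u \<noteq> 0" for u
        using that by (simp add: power2_eq_square field_simps)
      ultimately show "((\<lambda>y. ln ((1 - a i * y)\<^sup>2)) has_field_derivative - 2 * (a i / (1 - a i * z)) ^ 1) (at z within ball x e)"
        using nz by metis
    qed
    have 2: "uniformly_convergent_on (ball x e) (\<lambda>n y. \<Sum>i<n. - 2 * (a i / (1 - a i * y)) ^ 1)"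
    proof (rule Weierstrass_m_test')
      show "summable (\<lambda>i. 2 * (a i / \<delta>) ^ 1)"
        by (intro summable_mult summable_power_a) simp
      fix i y assume "y \<in> ball x e"
      then show "norm (- 2 * (a i / (1 - a i * y)) ^ 1) \<le> 2 * (a i / \<delta>) ^ 1"
        using term_le[OF de(1) de(3)[OF B], of y i 1] by (simp add: abs_mult)
    qed
    have 3: "x \<in> ball x e" "y \<in> interior (ball x e)" using de(2) y by auto
    show "summable (\<lambda>i. ln ((1 - a i * y)\<^sup>2))"
      by (rule has_field_derivative_series'(1)[OF _ 1 2 3(1) base 3(2)]) auto
    show "(U has_field_derivative (\<Sum>i. - 2 * (a i / (1 - a i * y)) ^ 1)) (at y)"
      unfolding U_def[abs_def]
      by (rule has_field_derivative_series'(2)[OF _ 1 2 3(1) base 3(2)]) auto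
  qed
  have F2: "(F y)\<^sup>2 = exp (U y)" if y: "y \<in> ball x e" for y
  proof (rule LIMSEQ_unique)
    show "(\<lambda>n. (\<Prod>i<n. 1 - a i * y)\<^sup>2) \<longlonglongrightarrow> (F y)\<^sup>2" by (intro tendsto_power lim)
    have "(\<lambda>n. exp (\<Sum>i<n. ln ((1 - a i * y)\<^sup>2))) \<longlonglongrightarrow> exp (U y)"
      unfolding U_def by (intro tendsto_exp summable_LIMSEQ U(1)[OF y])
    moreover have "exp (\<Sum>i<n. ln ((1 - a i * y)\<^sup>2)) = (\<Prod>i<n. 1 - a i * y)\<^sup>2" for n
      unfolding exp_sum[OF finite_lessThan] prod_power_distrib
      using nz[OF y] by (intro prod.cong) auto
    ultimately show "(\<lambda>n. (\<Prod>i<n. 1 - a i * y)\<^sup>2) \<longlonglongrightarrow> exp (U y)" by simp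
  qed
  have x: "x \<in> ball x e" using de(2) by simp
  have "(F x)\<^sup>2 > 0" using F2[OF x] by simp
  then show nzF: "F x \<noteq> 0" by auto
  have S: "(\<Sum>i. - 2 * (a i / (1 - a i * x)) ^ 1) = - 2 * S 1 x"
    unfolding S_def by (rule suminf_mult[OF regular_summable[OF assms]]) simp
  \<comment> \<open>Some derivative D exists by \<open>diff\<close>; differentiating both sides of
    F^2 = exp U determines it, as F x \<noteq> 0.\<close>
  obtain D where D: "(F has_field_derivative D) (at x)"
    using diff by (auto simp: field_differentiable_def)
  have "((\<lambda>y. (F y)\<^sup>2) has_field_derivative 2 * F x * D) (at x)"
    using D by (auto intro!: derivative_eq_intros)
  moreover have "((\<lambda>y. exp (U y)) has_field_derivative exp (U x) * (- 2 * S 1 x)) (at x)"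
    using U(2)[OF x] unfolding S by (auto intro!: derivative_eq_intros)
  then have "((\<lambda>y. (F y)\<^sup>2) has_field_derivative exp (U x) * (- 2 * S 1 x)) (at x)"
    by (rule has_field_derivative_transform_within_open[of _ _ _ "ball x e"]) (use F2 x in auto)
  ultimately have "2 * F x * D = (F x)\<^sup>2 * (- 2 * S 1 x)"
    using DERIV_unique F2[OF x] by metis
  then have "(2 * F x) * D = (2 * F x) * (- S 1 x * F x)" by algebra
  then have "D = - S 1 x * F x" using nzF by (subst (asm) mult_left_cancel) auto
  with D show "(F has_real_derivative - S 1 x * F x) (at x)" by simp
qed

lemma F_zero_iff: "F x = 0 \<longleftrightarrow> \<not> regular x"
proof
  assume "\<not> regular x"
  then obtain i where "a i * x = 1" by (auto simp: regular_def)
  then have "(\<Prod>i<n. 1 - a i * x) = 0" if "n \<ge> Suc i" for n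
    using that by (intro prod_zero) (auto intro!: bexI[of _ i])
  then have "(\<lambda>n. \<Prod>i<n. 1 - a i * x) \<longlonglongrightarrow> 0"
    by (intro tendsto_eventually eventually_sequentiallyI[of "Suc i"])
  with lim show "F x = 0" by (rule LIMSEQ_unique)
qed (use F_nonzero_deriv in auto)

lemma F_0: "F 0 = 1"
  using LIMSEQ_unique[OF lim[of 0]] by simp

lemma F_deriv: "F x \<noteq> 0 \<Longrightarrow> (F has_real_derivative - S 1 x * F x) (at x)"
  using F_nonzero_deriv F_zero_iff by blast

lemma sum_a: "suminf a = S 1 0"
  by (simp add: S_def)

lemma S_pos:
  assumes "a 0 * x < 1" "1 \<le> m"
  shows "0 < S m x"
proof -
  have t: "0 < 1 - a i * x" for i
  proof (cases "0 \<le> x")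
    case True
    then show ?thesis using mult_right_mono[OF a_le[of i] True] assms(1) by simp
  next
    case False
    then show ?thesis using mult_pos_neg[OF pos[of i], of x] by simp
  qed
  have "a i * x \<noteq> 1" for i using t[of i] by simp
  then have "regular x" by (simp add: regular_def)
  then show ?thesis
    unfolding S_def using t pos assms(2) by (intro suminf_pos regular_summable) auto
qed

text \<open>This is the derivative of x S 1 x. Termwise, with u = 1 - a i x, it equals a i (u + a i
  x)/u^2 = a i/u^2 > 0, whatever the sign of u: the Laguerre inequality for the product.\<close>

lemma S_Laguerre:
  assumes "regular x"
  shows "0 < S 1 x + x * S 2 x"
proof -
  have s: "summable (\<lambda>i. a i / (1 - a i * x))" "summable (\<lambda>i. x * (a i / (1 - a i * x))\<^sup>2)"
    using regular_summable[OF assms, of 1] summable_mult[OF regular_summable[OF assms, of 2]] by simp_all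
  have "S 1 x + x * S 2 x = (\<Sum>i. a i / (1 - a i * x) + x * (a i / (1 - a i * x))\<^sup>2)"
    unfolding S_def using suminf_add[OF s] suminf_mult[OF regular_summable[OF assms, of 2], of x] by simp
  also have "\<dots> > 0"
  proof (rule suminf_pos)
    fix i
    have nz: "1 - a i * x \<noteq> 0" using assms by (auto simp: regular_def)
    have "a i / u + x * (a i / u)\<^sup>2 = a i * (u + a i * x) / u\<^sup>2" if "u \<noteq> 0" for u
      using that by (simp add: field_simps power2_eq_square)
    from this[OF nz] have "a i / (1 - a i * x) + x * (a i / (1 - a i * x))\<^sup>2 = a i / (1 - a i * x)\<^sup>2"
      by simp
    then show "0 < a i / (1 - a i * x) + x * (a i / (1 - a i * x))\<^sup>2"
      using pos[of i] nz by simp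
  qed (intro summable_add s)
  finally show ?thesis .
qed

lemma S_2_pos: "regular x \<Longrightarrow> 0 < S 2 x"
  unfolding S_def using pos
  by (intro suminf_pos regular_summable) (auto simp: regular_def less_imp_neq[THEN not_sym])

text \<open>Two equal factors contribute (a i)^2 (y - x)^2 and the other factors stay bounded near
  x, so F is O((y - x)^2).\<close>

lemma double_zero:
  assumes "i \<noteq> j" "a i = a j"
  shows "(F has_real_derivative 0) (at (1 / a i))"
proof -
  define x where "x = 1 / a i"
  \<comment> \<open>For |y - x| < 1 each remaining factor is at most exp (a k (|x| + 1)) in absolute
    value.\<close>
  define K where "K = (a i)\<^sup>2 * exp (suminf a * (\<bar>x\<bar> + 1))"
  have bound: "\<bar>F y\<bar> \<le> K * (y - x)\<^sup>2" if y: "\<bar>y - x\<bar> < 1" for y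
  proof (rule LIMSEQ_le_const2[OF tendsto_rabs[OF lim]])
    have "\<bar>\<Prod>k<n. 1 - a k * y\<bar> \<le> K * (y - x)\<^sup>2" if n: "n \<ge> Suc (max i j)" for n
    proof -
      have "(\<Prod>k<n. 1 - a k * y) = (1 - a i * y) * ((1 - a j * y) * (\<Prod>k\<in>{..<n} - {i} - {j}. 1 - a k * y))"
        using n assms(1) by (subst prod.remove[of _ i], simp, simp, subst prod.remove[of _ j]) auto
      moreover have "\<bar>A * (A * R)\<bar> = A\<^sup>2 * \<bar>R\<bar>" for A R :: real
        by (metis abs_mult abs_power2 mult.assoc power2_eq_square)
      ultimately have eq: "\<bar>\<Prod>k<n. 1 - a k * y\<bar> = (1 - a i * y)\<^sup>2 * \<bar>\<Prod>k\<in>{..<n} - {i} - {j}. 1 - a k * y\<bar>"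
        using assms(2) by simp
      have "\<bar>\<Prod>k\<in>{..<n} - {i} - {j}. 1 - a k * y\<bar> = (\<Prod>k\<in>{..<n} - {i} - {j}. \<bar>1 - a k * y\<bar>)"
        by (rule abs_prod)
      also have "\<dots> \<le> (\<Prod>k\<in>{..<n} - {i} - {j}. exp (a k * (\<bar>x\<bar> + 1)))"
      proof (rule prod_mono)
        fix k
        have "\<bar>a k * y\<bar> \<le> a k * (\<bar>x\<bar> + 1)"
          using pos[of k] y by (auto simp: abs_mult intro!: mult_left_mono)
        then show "0 \<le> \<bar>1 - a k * y\<bar> \<and> \<bar>1 - a k * y\<bar> \<le> exp (a k * (\<bar>x\<bar> + 1))"
          using exp_ge_add_one_self[of "a k * (\<bar>x\<bar> + 1)"] by linarith
      qed
      also have "\<dots> = exp (\<Sum>k\<in>{..<n} - {i} - {j}. a k * (\<bar>x\<bar> + 1))"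
        by (simp add: exp_sum)
      also have "\<dots> \<le> exp (suminf a * (\<bar>x\<bar> + 1))"
        unfolding sum_distrib_right[symmetric]
        using pos by (auto intro!: mult_right_mono sum_le_suminf summ simp: less_imp_le)
      finally have le: "\<bar>\<Prod>k\<in>{..<n} - {i} - {j}. 1 - a k * y\<bar> \<le> exp (suminf a * (\<bar>x\<bar> + 1))" .
      have "(1 - a i * y)\<^sup>2 = (a i)\<^sup>2 * (y - x)\<^sup>2"
        using pos[of i] by (simp add: x_def field_simps power2_eq_square)
      then show ?thesis
        using mult_left_mono[OF le, of "(1 - a i * y)\<^sup>2"] unfolding eq K_def by (simp add: mult_ac)
    qed
    then show "\<exists>N. \<forall>n\<ge>N. \<bar>\<Prod>k<n. 1 - a k * y\<bar> \<le> K * (y - x)\<^sup>2" by blast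
  qed
  have Fx: "F x = 0" using bound[of x] by simp
  have "((\<lambda>y. (F y - F x) / (y - x)) \<longlongrightarrow> 0) (at x)"
  proof (rule Lim_null_comparison)
    have "eventually (\<lambda>y. \<bar>y - x\<bar> < 1) (at x)"
      unfolding eventually_at by (rule exI[of _ 1]) (auto simp: dist_real_def)
    then show "eventually (\<lambda>y. norm ((F y - F x) / (y - x)) \<le> K * \<bar>y - x\<bar>) (at x)"
    proof eventually_elim
      case (elim y)
      then show ?case
        using bound[OF elim] Fx by (cases "y = x") (auto simp: field_simps power2_eq_square abs_mult_self_eq)
    qed
    show "((\<lambda>y. K * \<bar>y - x\<bar>) \<longlongrightarrow> 0) (at x)"
      by (auto intro!: tendsto_eq_intros)
  qed
  then show ?thesis
    unfolding x_def[symmetric] by (simp add: has_field_derivative_iff)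
qed

text \<open>In \<open>F (1 - y S 1 y / d)\<close>, which is \<open>F + y F'/d\<close>, the second factor is strictly monotone where
  \<open>F \<noteq> 0\<close>, so a double zero of \<open>F + y F'/d\<close> can only come from a double zero of \<open>F\<close>.\<close>

lemma double_zero_shift:
  assumes "0 < d" "0 < x" and G: "F x + x * deriv F x / d = 0"
    and G': "((\<lambda>y. F y + y * deriv F y / d) has_real_derivative 0) (at x)"
  shows "F x = 0 \<and> deriv F x = 0"
proof -
  have "F x = 0"
  proof (rule ccontr)
    assume nz: "F x \<noteq> 0"
    then have reg: "regular x" using F_zero_iff by blast
    have cont: "continuous_on UNIV F"
      using diff by (intro continuous_at_imp_continuous_on) (auto intro: field_differentiable_imp_continuous_at)
    define A where "A = {y. F y \<noteq> 0}"
    have "open A"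
      unfolding A_def using open_Collect_neq[OF cont continuous_on_const, of 0] .
    have dF: "deriv F y = - S 1 y * F y" if "y \<in> A" for y
      using F_deriv that by (auto simp: A_def intro!: DERIV_imp_deriv)
    have "(S 1 has_real_derivative S 2 x) (at x)"
      using S_deriv[OF reg, of 1] by (simp add: numeral_2_eq_2)
    from DERIV_mult[OF DERIV_ident this]
    have "((\<lambda>y. y * S 1 y) has_real_derivative S 1 x + x * S 2 x) (at x)"
      by (simp add: mult.commute)
    from DERIV_diff[OF DERIV_const[of 1] DERIV_cdivide[OF this, of d]]
    have inner: "((\<lambda>y. 1 - y * S 1 y / d) has_real_derivative - (S 1 x + x * S 2 x) / d) (at x)"
      by (simp only: diff_0 minus_divide_left)
    have "((\<lambda>y. F y * (1 - y * S 1 y / d)) has_real_derivative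
        (- S 1 x * F x) * (1 - x * S 1 x / d) + (- (S 1 x + x * S 2 x) / d) * F x) (at x)"
      by (rule DERIV_mult[OF F_deriv[OF nz] inner])
    then have "((\<lambda>y. F y + y * deriv F y / d) has_real_derivative
        (- S 1 x * F x) * (1 - x * S 1 x / d) + (- (S 1 x + x * S 2 x) / d) * F x) (at x)"
      by (rule has_field_derivative_transform_within_open[OF _ \<open>open A\<close>])
         (use nz dF in \<open>auto simp: A_def algebra_simps\<close>)
    with G' have "(- S 1 x * F x) * (1 - x * S 1 x / d) + (- (S 1 x + x * S 2 x) / d) * F x = 0"
      using DERIV_unique by blast
    moreover have "F x * (1 - x * S 1 x / d) = 0"
      using G dF[of x] nz by (simp add: A_def algebra_simps)
    \<comment> \<open>With this factor zero, the derivative reduces to its second summand, a nonzero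
      multiple of S 1 x + x S 2 x.\<close>
    then have z: "1 - x * S 1 x / d = 0" using nz by (simp only: mult_eq_0_iff simp_thms)
    ultimately have "(- (S 1 x + x * S 2 x) / d) * F x = 0"
      by (simp only: z mult_zero_right add_0)
    then have "S 1 x + x * S 2 x = 0"
      using nz \<open>0 < d\<close> by (simp only: mult_eq_0_iff divide_eq_0_iff neg_equal_0_iff_equal) simp
    then show False using S_Laguerre[OF reg] by simp
  qed
  with assms show ?thesis by simp
qed

text \<open>Exactly the first m factors are negative. The limit preserves only a weak inequality;
  strictness comes from F x \<noteq> 0.\<close>

lemma sign:
  assumes "\<And>i. i < m \<Longrightarrow> 1 < a i * x" "\<And>i. m \<le> i \<Longrightarrow> a i * x < 1"
  shows "0 < (- 1) ^ m * F x"
proof -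
  have "regular x"
    unfolding regular_def using assms by (metis less_irrefl not_less)
  then have "F x \<noteq> 0" using F_zero_iff by blast
  have "0 \<le> (- 1) ^ m * (\<Prod>i<n. 1 - a i * x)" if "m \<le> n" for n
  proof -
    have "(\<Prod>i<n. 1 - a i * x) = (\<Prod>i<m. 1 - a i * x) * (\<Prod>i\<in>{m..<n}. 1 - a i * x)"
      using that by (metis atLeast0LessThan prod.atLeastLessThan_concat zero_le)
    moreover have "(- 1) ^ m * (\<Prod>i<m. 1 - a i * x) = (\<Prod>i<m. a i * x - 1)"
      using prod.distrib[of "\<lambda>_. - 1" "\<lambda>i. 1 - a i * x" "{..<m}"] by simp
    moreover have "0 \<le> (\<Prod>i<m. a i * x - 1)" "0 \<le> (\<Prod>i\<in>{m..<n}. 1 - a i * x)"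
      using assms by (auto intro!: prod_nonneg simp: less_imp_le)
    ultimately show ?thesis by (simp flip: mult.assoc)
  qed
  then have "0 \<le> (- 1) ^ m * F x"
    by (intro LIMSEQ_le_const[OF tendsto_mult[OF tendsto_const lim]]) blast
  moreover have "(- 1) ^ m * F x \<noteq> 0" using \<open>F x \<noteq> 0\<close> by simp
  ultimately show ?thesis by linarith
qed

end

section \<open>The hypergeometric series\<close>

definition cross_coeff :: "real \<Rightarrow> real \<Rightarrow> nat \<Rightarrow> real" where
  "cross_coeff b c n = 1 / (fact n * pochhammer b n * pochhammer c (2 * n))"

text \<open>Since (c)_(2n) = 4^n (c/2)_n ((c+1)/2)_n, this is the hypergeometric function 0F3 with
  lower parameters b, c/2, (c+1)/2 at the point - x/4.\<close>

definition cross_fun :: "real \<Rightarrow> real \<Rightarrow> real \<Rightarrow> real" where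
  "cross_fun b c x = (\<Sum>n. (- 1) ^ n * cross_coeff b c n * x ^ n)"

text \<open>For fixed n the binomial grows like N^n/n! and the two products like N^n/(b)_n and
  N^(2n)/(c)_(2n), so division by N^(4n) leaves \<open>cross_coeff\<close> in the limit.\<close>

definition approx_coeff :: "nat \<Rightarrow> real \<Rightarrow> real \<Rightarrow> nat \<Rightarrow> real" where
  "approx_coeff N b c n = of_nat (N choose n) / real N ^ (4 * n)
     * (\<Prod>k<N. 1 + real n / (b + real k)) * (\<Prod>k<N. 1 + real (2 * n) / (c + real k))"

lemma cross_fun_0: "cross_fun b c 0 = 1"
proof -
  have "cross_fun b c 0 = (\<Sum>n. if n = 0 then 1 else 0)"
    unfolding cross_fun_def by (rule suminf_cong) (auto simp: cross_coeff_def)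
  also have "\<dots> = 1" using sums_single[of 0 "\<lambda>_. 1 :: real"] by (simp add: sums_iff)
  finally show ?thesis .
qed

text \<open>Both sides are (b)_(N+n) / ((b)_N (b)_n). A product of N factors is traded for products
  of n factors, in which N can tend to infinity.\<close>

lemma prod_shift_eq_pochhammer:
  fixes b :: real
  assumes "0 < b"
  shows "(\<Prod>k<N. 1 + real n / (b + real k)) = pochhammer (b + real N) n / pochhammer b n"
proof -
  have pos: "0 < pochhammer b m" for m using assms by (rule pochhammer_pos)
  have "(\<Prod>k<N. 1 + real n / (b + real k)) = (\<Prod>k<N. (b + real n + real k) / (b + real k))"
    using assms by (intro prod.cong) (auto simp: field_simps)
  also have "\<dots> = pochhammer (b + real n) N / pochhammer b N"
    by (simp add: prod_dividef pochhammer_prod atLeast0LessThan)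
  also have "\<dots> = pochhammer (b + real N) n / pochhammer b n"
    using pochhammer_product'[of b n N] pochhammer_product'[of b N n] pos[of n] pos[of N]
    by (simp add: add.commute field_simps)
  finally show ?thesis .
qed

lemma approx_coeff_eq:
  assumes "0 < b" "0 < c"
  shows "approx_coeff N b c n = of_nat (N choose n) / real N ^ n
    * (pochhammer (b + real N) n / real N ^ n) * (pochhammer (c + real N) (2 * n) / real N ^ (2 * n))
    / (pochhammer b n * pochhammer c (2 * n))"
proof -
  have "real N ^ (4 * n) = real N ^ n * real N ^ n * real N ^ (2 * n)"
    by (simp flip: power_add)
  then show ?thesis
    unfolding approx_coeff_def prod_shift_eq_pochhammer[OF assms(1)] prod_shift_eq_pochhammer[OF assms(2)]
    by simp
qed

section \<open>Bounds and limits of the approximating coefficients\<close>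

lemma pochhammer_power_eq_prod:
  assumes "0 < N"
  shows "pochhammer (b + real N) n / real N ^ n = (\<Prod>j<n. 1 + (b + real j) / real N)"
proof -
  have "(\<Prod>j<n. 1 + (b + real j) / real N) = (\<Prod>j<n. (b + real N + real j) / real N)"
    using assms by (intro prod.cong) (auto simp: field_simps)
  then show ?thesis by (simp add: prod_dividef pochhammer_prod atLeast0LessThan)
qed

lemma pochhammer_ge:
  fixes b m :: real
  assumes "0 < m" "m \<le> b" "m \<le> 1"
  shows "m ^ n * fact n \<le> pochhammer b n"
proof (induction n)
  case (Suc n)
  have "m * (1 + real n) \<le> b + real n"
    using assms mult_right_mono[of m 1 "real n"] by (simp add: algebra_simps)
  then have "(m ^ n * fact n) * (m * (1 + real n)) \<le> pochhammer b n * (b + real n)"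
    using Suc assms by (intro mult_mono) (auto simp: pochhammer_nonneg)
  then show ?case by (simp add: pochhammer_Suc algebra_simps)
qed simp

lemma cross_coeff_pos: "0 < b \<Longrightarrow> 0 < c \<Longrightarrow> 0 < cross_coeff b c n"
  by (simp add: cross_coeff_def pochhammer_pos)

text \<open>One power of m in m^3 comes from the first symbol and two from the second, whose
  factorial is discarded. The n! kept here and the n! of the coefficient make up the (n!)^2 that
  \<open>zero_bound\<close> asks for.\<close>

lemma inverse_pochhammer_le:
  fixes b c m :: real
  assumes "0 < m" "m \<le> 1" "m \<le> b" "m \<le> c"
  shows "1 / (pochhammer b n * pochhammer c (2 * n)) \<le> (1 / m ^ 3) ^ n / fact n"
proof -
  have "m ^ (2 * n) * 1 \<le> m ^ (2 * n) * fact (2 * n)"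
    using assms by (intro mult_left_mono) (auto simp: fact_ge_1)
  also have "\<dots> \<le> pochhammer c (2 * n)" using assms by (intro pochhammer_ge) auto
  finally have "(m ^ n * fact n) * m ^ (2 * n) \<le> pochhammer b n * pochhammer c (2 * n)"
    using assms pochhammer_ge[of m b n] by (intro mult_mono) (auto simp: pochhammer_nonneg)
  then have "1 / (pochhammer b n * pochhammer c (2 * n)) \<le> 1 / ((m ^ n * fact n) * m ^ (2 * n))"
    using assms by (intro divide_left_mono) (auto intro!: mult_pos_pos pochhammer_pos)
  also have "(m ^ n * fact n) * m ^ (2 * n) = (m ^ 3) ^ n * fact n"
    by (simp add: mult_ac flip: power_mult power_add)
  finally show ?thesis by (simp add: power_one_over)
qed

lemma cross_coeff_le:
  assumes "0 < m" "m \<le> 1" "m \<le> b" "m \<le> c"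
  shows "cross_coeff b c n \<le> (1 / m ^ 3) ^ n / (fact n)\<^sup>2"
  using divide_right_mono[OF inverse_pochhammer_le[OF assms, of n], of "fact n"]
  by (simp add: cross_coeff_def power2_eq_square mult_ac)

text \<open>Uniform in N and in parameters from a compact range: the former for the infinite
  product, the latter for limits in which the order varies.\<close>

lemma approx_coeff_le:
  assumes m: "0 < m" "m \<le> 1" "m \<le> b" "m \<le> c" and B: "b \<le> B" "c \<le> B" and N: "0 < N"
  shows "0 \<le> approx_coeff N b c n"
    "approx_coeff N b c n \<le> ((B + 3) ^ 3 / m ^ 3) ^ n / (fact n)\<^sup>2"
proof -
  have bc: "0 < b" "0 < c" using m by auto
  show "0 \<le> approx_coeff N b c n"
    unfolding approx_coeff_def using bc by (intro mult_nonneg_nonneg prod_nonneg) auto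
  show "approx_coeff N b c n \<le> ((B + 3) ^ 3 / m ^ 3) ^ n / (fact n)\<^sup>2"
  proof (cases "n \<le> N")
    case False
    then have "approx_coeff N b c n = 0" by (simp add: approx_coeff_def binomial_eq_0)
    then show ?thesis using m B by simp
  next
    case True
    \<comment> \<open>B + 3 is 1 + B + 2: from j \<le> 2n \<le> 2N the quotient j/N is at most 2,
      and N \<ge> 1 bounds d/N by B.\<close>
    have le: "1 + (d + real j) / real N \<le> B + 3" if "0 < d" "d \<le> B" "j \<le> 2 * n" for d j
    proof -
      have "d / real N \<le> B / 1" using that N by (intro frac_le) auto
      moreover have "real j / real N \<le> 2"
        using that True N by (simp add: divide_le_eq)
      ultimately show ?thesis by (simp add: add_divide_distrib)
    qed
    have 1: "pochhammer (b + real N) n / real N ^ n \<le> (B + 3) ^ n"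
      unfolding pochhammer_power_eq_prod[OF N]
      using prod_mono[of "{..<n}" "\<lambda>j. 1 + (b + real j) / real N" "\<lambda>_. B + 3"] le[of b] bc B by simp
    have 2: "pochhammer (c + real N) (2 * n) / real N ^ (2 * n) \<le> (B + 3) ^ (2 * n)"
      unfolding pochhammer_power_eq_prod[OF N]
      using prod_mono[of "{..<2 * n}" "\<lambda>j. 1 + (c + real j) / real N" "\<lambda>_. B + 3"] le[of c] bc B by simp
    have "real (N choose n) * fact n \<le> real N ^ n"
      using binomial_fact_pow[of N n] by (metis of_nat_fact of_nat_le_iff of_nat_mult of_nat_power)
    then have 3: "real (N choose n) / real N ^ n \<le> 1 / fact n"
      using N by (simp add: field_simps)
    have "approx_coeff N b c n \<le> (1 / fact n * (B + 3) ^ n * (B + 3) ^ (2 * n))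
        * (1 / (pochhammer b n * pochhammer c (2 * n)))"
      unfolding approx_coeff_eq[OF bc] using 1 2 3 bc B
      by (subst divide_inverse, subst inverse_eq_divide, intro mult_mono)
         (auto intro!: mult_nonneg_nonneg divide_nonneg_nonneg simp: pochhammer_nonneg)
    also have "\<dots> \<le> (1 / fact n * (B + 3) ^ n * (B + 3) ^ (2 * n)) * ((1 / m ^ 3) ^ n / fact n)"
      using bc B by (intro mult_left_mono inverse_pochhammer_le m) auto
    also have "\<dots> = ((B + 3) ^ 3 / m ^ 3) ^ n / (fact n)\<^sup>2"
    proof -
      have "(B + 3) ^ n * (B + 3) ^ (2 * n) = ((B + 3) ^ 3) ^ n"
        by (simp flip: power_mult power_add)
      then show ?thesis by (simp add: power2_eq_square power_divide)
    qed
    finally show ?thesis .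
  qed
qed

lemma tendsto_binomial_power:
  "(\<lambda>N. real (N choose n) / real N ^ n) \<longlonglongrightarrow> 1 / fact n"
proof -
  have "(\<lambda>N. (\<Prod>j<n. 1 - real j / real N) / fact n) \<longlonglongrightarrow> (\<Prod>j<n. 1 - 0) / fact n"
    by (intro tendsto_intros tendsto_divide_0[OF tendsto_const] filterlim_real_sequentially
        filterlim_at_top_imp_at_infinity) auto
  moreover have "eventually (\<lambda>N. (\<Prod>j<n. 1 - real j / real N) / fact n = real (N choose n) / real N ^ n) sequentially"
    using eventually_gt_at_top[of 0]
  proof eventually_elim
    case (elim N)
    have "real (N choose n) = (\<Prod>j<n. real N - real j) / fact n"
      by (simp add: binomial_gbinomial gbinomial_prod_rev atLeast0LessThan)
    moreover have "(\<Prod>j<n. 1 - real j / real N) = (\<Prod>j<n. (real N - real j) / real N)"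
      using elim by (intro prod.cong) (auto simp: field_simps)
    ultimately show ?case by (simp add: prod_dividef)
  qed
  ultimately show ?thesis using tendsto_cong by force
qed

text \<open>The parameters move together with N because the compactness argument in the order
  produces both as sequences.\<close>

lemma tendsto_approx_coeff:
  fixes b c :: "nat \<Rightarrow> real"
  assumes "b \<longlonglongrightarrow> b'" "c \<longlonglongrightarrow> c'" "0 < b'" "0 < c'" "\<And>k. 0 < b k" "\<And>k. 0 < c k"
    and N: "filterlim N at_top sequentially"
  shows "(\<lambda>k. approx_coeff (N k) (b k) (c k) n) \<longlonglongrightarrow> cross_coeff b' c' n"
proof -
  have "filterlim (\<lambda>k. real (N k)) at_infinity sequentially"
    by (intro filterlim_at_top_imp_at_infinity filterlim_compose[OF filterlim_real_sequentially N])
  then have inf: "((\<lambda>k. (d k + real j) / real (N k)) \<longlonglongrightarrow> 0)" if "d \<longlonglongrightarrow> d'" for d d' j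
    by (intro tendsto_divide_0[of _ "d' + real j"] tendsto_intros that)
  have poch: "(\<lambda>k. pochhammer (d k + real (N k)) j / real (N k) ^ j) \<longlonglongrightarrow> 1" if "d \<longlonglongrightarrow> d'" for d d' j
  proof -
    have "(\<lambda>k. \<Prod>i<j. 1 + (d k + real i) / real (N k)) \<longlonglongrightarrow> (\<Prod>i<j. 1 + 0)"
      by (intro tendsto_intros inf[OF that])
    moreover have "eventually (\<lambda>k. (\<Prod>i<j. 1 + (d k + real i) / real (N k))
        = pochhammer (d k + real (N k)) j / real (N k) ^ j) sequentially"
      using eventually_compose_filterlim[OF eventually_gt_at_top[of 0] N]
      by eventually_elim (simp add: pochhammer_power_eq_prod)
    ultimately show ?thesis using tendsto_cong by force
  qed
  have poch_lim: "(\<lambda>k. pochhammer (d k) j) \<longlonglongrightarrow> pochhammer d' j"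
    if "d \<longlonglongrightarrow> d'" for d :: "nat \<Rightarrow> real" and d' j
    unfolding pochhammer_prod by (intro tendsto_intros that)
  have "(\<lambda>k. real (N k choose n) / real (N k) ^ n * (pochhammer (b k + real (N k)) n / real (N k) ^ n)
      * (pochhammer (c k + real (N k)) (2 * n) / real (N k) ^ (2 * n))
      / (pochhammer (b k) n * pochhammer (c k) (2 * n)))
    \<longlonglongrightarrow> 1 / fact n * 1 * 1 / (pochhammer b' n * pochhammer c' (2 * n))"
    using pochhammer_pos[OF assms(3), of n] pochhammer_pos[OF assms(4), of "2 * n"]
    by (intro tendsto_intros poch[OF assms(1)] poch[OF assms(2)] poch_lim assms
        filterlim_compose[OF tendsto_binomial_power N]) auto
  then show ?thesis
    using assms(5,6) by (simp add: approx_coeff_eq cross_coeff_def mult.assoc)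
qed

text \<open>The factor for \<open>c\<close> is \<open>1 + 2n/(c + k)\<close>, hence \<open>1 + n/d\<close> with \<open>d = (c + k)/2\<close>.\<close>

definition approx_factor :: "nat \<Rightarrow> real \<Rightarrow> real \<Rightarrow> nat \<Rightarrow> real" where
  "approx_factor N b c j = (if j < N then b + real j else (c + real (j - N)) / 2)"

lemma approx_coeff_factor:
  "approx_coeff N b c n = of_nat (N choose n) / real N ^ (4 * n)
     * (\<Prod>j<2 * N. 1 + real n / approx_factor N b c j)"
proof -
  have "(\<Prod>j<2 * N. 1 + real n / approx_factor N b c j)
      = (\<Prod>j<N. 1 + real n / approx_factor N b c j) * (\<Prod>j\<in>{N..<2 * N}. 1 + real n / approx_factor N b c j)"
    by (metis atLeast0LessThan le_add1 mult_2 prod.atLeastLessThan_concat zero_le)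
  also have "(\<Prod>j<N. 1 + real n / approx_factor N b c j) = (\<Prod>k<N. 1 + real n / (b + real k))"
    by (intro prod.cong) (auto simp: approx_factor_def)
  also have "(\<Prod>j\<in>{N..<2 * N}. 1 + real n / approx_factor N b c j) = (\<Prod>k<N. 1 + real n / approx_factor N b c (k + N))"
    using prod.shift_bounds_nat_ivl[of "\<lambda>j. 1 + real n / approx_factor N b c j" 0 N N]
    by (simp add: mult_2 atLeast0LessThan)
  also have "\<dots> = (\<Prod>k<N. 1 + real (2 * n) / (c + real k))"
    by (intro prod.cong) (auto simp: approx_factor_def)
  finally show ?thesis by (simp add: approx_coeff_def)
qed

lemma approx_factor_pos: "0 < b \<Longrightarrow> 0 < c \<Longrightarrow> 0 < approx_factor N b c j"
  by (auto simp: approx_factor_def)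

lemma positive_rooted_approx:
  assumes "0 < b" "0 < c" "0 < N"
  shows "\<exists>p. positive_rooted p \<and> (\<forall>n. coeff p n = (- 1) ^ n * approx_coeff N b c n)"
proof -
  obtain p where p: "positive_rooted p" "\<And>n. coeff p n = (- (1 / real N ^ 4)) ^ n * of_nat (N choose n)
      * (\<Prod>j<2 * N. 1 + real n / approx_factor N b c j)"
    using positive_rooted_multiplier[of "{..<2 * N}" "approx_factor N b c" "1 / real N ^ 4" N] assms
    by (auto simp: approx_factor_pos)
  have "coeff p n = (- 1) ^ n * approx_coeff N b c n" for n
    unfolding p(2) approx_coeff_factor power_minus[of "1 / real N ^ 4"]
    by (simp add: power_one_over power_mult)
  with p(1) show ?thesis by blast
qed

section \<open>Convergence, Euler derivative and product of the limit series\<close>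

lemma summable_cross_coeff:
  assumes "0 < b" "0 < c"
  shows "summable (\<lambda>n. (- 1) ^ n * cross_coeff b c n * x ^ n)"
proof -
  define m where "m = min 1 (min b c)"
  have m: "0 < m" "m \<le> 1" "m \<le> b" "m \<le> c" using assms by (auto simp: m_def)
  show ?thesis
  proof (rule summable_comparison_test'[OF summable_exp[of "1 / m ^ 3 * \<bar>x\<bar>"], of 0])
    fix n
    have "(1 / m ^ 3) ^ n / (fact n)\<^sup>2 \<le> (1 / m ^ 3) ^ n / fact n"
      using m fact_ge_1[of n, where 'a = real] by (intro divide_left_mono) (auto simp: power2_eq_square)
    with cross_coeff_le[OF m, of n] have "cross_coeff b c n \<le> (1 / m ^ 3) ^ n / fact n" by linarith
    from mult_right_mono[OF this, of "\<bar>x\<bar> ^ n"]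
    show "norm ((- 1) ^ n * cross_coeff b c n * x ^ n) \<le> inverse (fact n) * (1 / m ^ 3 * \<bar>x\<bar>) ^ n"
      using cross_coeff_pos[OF assms, of n]
      by (simp add: abs_mult power_abs power_mult_distrib field_simps)
  qed
qed

lemma cross_fun_deriv:
  assumes "0 < b" "0 < c"
  shows "(cross_fun b c has_real_derivative (\<Sum>n. diffs (\<lambda>n. (- 1) ^ n * cross_coeff b c n) n * x ^ n)) (at x)"
  unfolding cross_fun_def[abs_def]
  by (rule termdiffs_strong_converges_everywhere) (rule summable_cross_coeff[OF assms])

lemma cross_fun_theta:
  assumes "0 < b" "0 < c"
  shows "(\<lambda>n. (- 1) ^ n * cross_coeff b c n * real n * x ^ n) sums (x * deriv (cross_fun b c) x)"
proof -
  have "summable (\<lambda>n. diffs (\<lambda>n. (- 1) ^ n * cross_coeff b c n) n * x ^ n)"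
    by (rule termdiff_converges_all) (rule summable_cross_coeff[OF assms])
  then have "(\<lambda>n. x * (diffs (\<lambda>n. (- 1) ^ n * cross_coeff b c n) n * x ^ n)) sums (x * deriv (cross_fun b c) x)"
    using DERIV_imp_deriv[OF cross_fun_deriv[OF assms, of x]] summable_sums by (intro sums_mult) auto
  then have "(\<lambda>n. (- 1) ^ Suc n * cross_coeff b c (Suc n) * real (Suc n) * x ^ Suc n) sums (x * deriv (cross_fun b c) x)"
    by (simp add: diffs_def mult_ac)
  then show ?thesis
    by (subst (asm) sums_Suc_iff) simp
qed

lemma cross_coeff_shift:
  assumes "0 < b" "0 < c"
  shows "cross_coeff b c n = cross_coeff (b + 1) c n * (1 + real n / b)"
proof -
  have "b * pochhammer (b + 1) n = (b + real n) * pochhammer b n"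
    using pochhammer_rec[of b n] pochhammer_rec'[of b n] by simp
  moreover have "0 < pochhammer b n" "0 < pochhammer (b + 1) n" "0 < pochhammer c (2 * n)"
    using assms by (auto intro!: pochhammer_pos)
  ultimately show ?thesis
    using assms(1) unfolding cross_coeff_def by (simp add: divide_simps) algebra
qed

text \<open>By b (b+1)_n = (b + n) (b)_n, lowering b + 1 to b is the operator F + x F'/d with d = b.
  Read backwards, this passes a double zero from b to b + 1.\<close>

lemma cross_fun_shift:
  assumes "0 < b" "0 < c"
  shows "cross_fun b c x = cross_fun (b + 1) c x + x * deriv (cross_fun (b + 1) c) x / b"
proof -
  have "(\<lambda>n. (- 1) ^ n * cross_coeff (b + 1) c n * x ^ n
      + (- 1) ^ n * cross_coeff (b + 1) c n * real n * x ^ n / b)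
    sums (cross_fun (b + 1) c x + x * deriv (cross_fun (b + 1) c) x / b)"
    unfolding cross_fun_def[of "b + 1"]
    using assms by (intro sums_add sums_divide cross_fun_theta[unfolded cross_fun_def[abs_def]]
        summable_sums summable_cross_coeff) auto
  also have "(\<lambda>n. (- 1) ^ n * cross_coeff (b + 1) c n * x ^ n
      + (- 1) ^ n * cross_coeff (b + 1) c n * real n * x ^ n / b)
    = (\<lambda>n. (- 1) ^ n * cross_coeff b c n * x ^ n)"
    by (rule ext) (simp add: cross_coeff_shift[OF assms] algebra_simps)
  finally show ?thesis unfolding cross_fun_def[of b] by (simp add: sums_iff)
qed

lemma cross_fun_product:
  assumes "0 < b" "0 < c"
  shows "\<exists>a. decseq a \<and> (\<forall>i::nat. 0 < a i) \<and> summable a \<and>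
    (\<forall>x. (\<lambda>n. \<Prod>i<n. 1 - a i * x) \<longlonglongrightarrow> cross_fun b c x)"
proof -
  define m where "m = min 1 (min b c)"
  define B where "B = max b c"
  have m: "0 < m" "m \<le> 1" "m \<le> b" "m \<le> c" "b \<le> B" "c \<le> B" using assms by (auto simp: m_def B_def)
  obtain p where p: "\<And>N. positive_rooted (p N)" "\<And>N n. coeff (p N) n = (- 1) ^ n * approx_coeff (Suc N) b c n"
    using positive_rooted_approx[OF assms zero_less_Suc] by metis
  show ?thesis
    unfolding cross_fun_def
  proof (rule positive_rooted_limit[OF p(1)])
    show "0 \<le> (B + 3) ^ 3 / m ^ 3" using m by auto
    show "\<bar>coeff (p N) n\<bar> \<le> ((B + 3) ^ 3 / m ^ 3) ^ n / (fact n)\<^sup>2" for N n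
      using approx_coeff_le[OF m zero_less_Suc, of N n] by (simp add: p(2) abs_mult)
    show "(\<lambda>N. coeff (p N) n) \<longlonglongrightarrow> (- 1) ^ n * cross_coeff b c n" for n
      unfolding p(2) using assms
      by (intro tendsto_mult tendsto_const tendsto_approx_coeff filterlim_Suc) auto
  qed (rule cross_coeff_pos[OF assms])
qed

text \<open>Values (e = 0) and Euler derivatives (e = 1) together: n^e \<le> n! uses up one of the
  two factorials, and an exponential series remains as majorant.\<close>

lemma tannery_powser:
  fixes u :: "nat \<Rightarrow> nat \<Rightarrow> real"
  assumes "\<And>n. (\<lambda>k. u k n) \<longlonglongrightarrow> v n" "\<And>k n. \<bar>u k n\<bar> \<le> C ^ n / (fact n)\<^sup>2" "0 \<le> C"
    and x: "x \<longlonglongrightarrow> x'" and e: "e \<le> 1"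
  shows "(\<lambda>k. \<Sum>n. u k n * real n ^ e * x k ^ n) \<longlonglongrightarrow> (\<Sum>n. v n * real n ^ e * x' ^ n)"
proof -
  obtain X where X: "\<And>k. \<bar>x k\<bar> \<le> X"
    using convergent_imp_Bseq[OF convergentI[OF x]] by (auto simp: Bseq_def)
  have "0 \<le> X" using X[of 0] by linarith
  show ?thesis
  proof (rule tannerys_theorem[THEN conjunct2, THEN conjunct2])
    show "eventually (\<lambda>(n, k). norm (u k n * real n ^ e * x k ^ n) \<le> inverse (fact n) * (C * X) ^ n)
        (at_top \<times>\<^sub>F sequentially)"
    proof (rule always_eventually, clarify)
      fix n k
      have "real n \<le> fact n"
        using fact_ge_self[of n] by (metis of_nat_fact of_nat_le_iff)
      moreover have "e = 0 \<or> e = 1" using e by auto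
      ultimately have "real n ^ e \<le> fact n"
        using fact_ge_1[of n, where 'a = real] by auto
      then have "\<bar>u k n\<bar> * real n ^ e * \<bar>x k\<bar> ^ n \<le> C ^ n / (fact n)\<^sup>2 * fact n * X ^ n"
        using assms(2,3) X \<open>0 \<le> X\<close> by (intro mult_mono power_mono) auto
      also have "\<dots> = inverse (fact n) * (C * X) ^ n"
        by (simp add: power_mult_distrib power2_eq_square field_simps)
      finally show "norm (u k n * real n ^ e * x k ^ n) \<le> inverse (fact n) * (C * X) ^ n"
        by (simp add: abs_mult power_abs)
    qed
  qed (intro tendsto_intros assms, rule summable_exp, simp)
qed

section \<open>The cross-product of Bessel functions\<close>

text \<open>J (s = - 1) and I (s = 1) without the power (x/2)^\<nu>, as formal series in t =
  x^2/4.\<close>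

definition bessel_fps :: "real \<Rightarrow> real \<Rightarrow> real fps" where
  "bessel_fps s \<nu> = Abs_fps (\<lambda>n. s ^ n / fact n * rGamma (real n + \<nu> + 1))"

lemma fps_XD_mult: "fps_XD (f * g) = fps_XD f * g + f * fps_XD (g :: real fps)"
  by (simp add: fps_XD_def algebra_simps)

lemma rGamma_shift:
  assumes "- 1 < (\<nu> :: real)"
  shows "rGamma (real n + \<nu> + 1) = rGamma (\<nu> + 1) / pochhammer (\<nu> + 1) n"
  using pochhammer_rGamma[of "\<nu> + 1" n] pochhammer_pos[of "\<nu> + 1" n] assms
  by (simp add: field_simps)

text \<open>Bessel's equation in Euler form, equivalent to the recurrence n (n + \<nu>) g_n = s
  g_(n-1) of the coefficients.\<close>

lemma bessel_fps_ode:
  assumes "- 1 < \<nu>"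
  shows "fps_XD (fps_XD (bessel_fps s \<nu>)) = fps_const s * fps_X * bessel_fps s \<nu> - fps_const \<nu> * fps_XD (bessel_fps s \<nu>)"
proof (rule fps_ext)
  fix n
  show "fps_nth (fps_XD (fps_XD (bessel_fps s \<nu>))) n
    = fps_nth (fps_const s * fps_X * bessel_fps s \<nu> - fps_const \<nu> * fps_XD (bessel_fps s \<nu>)) n"
  proof (cases n)
    case (Suc m)
    define R where "R = rGamma (real m + \<nu> + 1 + 1)"
    have "(1 + real m) * (1 + real m + \<nu>) * fps_nth (bessel_fps s \<nu>) (Suc m)
        = (1 + real m) * (1 + real m + \<nu>) * (s * s ^ m / ((1 + real m) * fact m) * R)"
      by (simp add: bessel_fps_def R_def add_ac)
    also have "\<dots> = s * (s ^ m / fact m * ((real m + \<nu> + 1) * R))"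
    proof -
      have "M * L * (s * t / (M * f) * R) = s * (t / f * (L * R))" if "M \<noteq> 0" for L M t f
        using that by simp
      from this[of "1 + real m" "1 + real m + \<nu>" "s ^ m" "fact m"]
      show ?thesis by (simp add: add_ac)
    qed
    also have "(real m + \<nu> + 1) * R = rGamma (real m + \<nu> + 1)"
      unfolding R_def by (rule rGamma_plus1)
    also have "s ^ m / fact m * rGamma (real m + \<nu> + 1) = fps_nth (bessel_fps s \<nu>) m"
      by (simp add: bessel_fps_def)
    finally have "(1 + real m) * (1 + real m + \<nu>) * fps_nth (bessel_fps s \<nu>) (Suc m)
        = s * fps_nth (bessel_fps s \<nu>) m" .
    then show ?thesis
      unfolding Suc by (simp add: algebra_simps)
  qed (simp add: mult.assoc)
qed

lemma fps_conv_radius_bessel: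
  assumes "- 1 < \<nu>"
  shows "fps_conv_radius (bessel_fps s \<nu>) = \<infinity>"
  unfolding fps_conv_radius_def
proof (rule conv_radius_inftyI'')
  fix z :: real
  define m where "m = min 1 (\<nu> + 1)"
  have m: "0 < m" "m \<le> \<nu> + 1" "m \<le> 1" using assms by (auto simp: m_def)
  show "summable (\<lambda>n. fps_nth (bessel_fps s \<nu>) (n) * z ^ n)"
  proof (rule summable_comparison_test'[where N = 0])
    show "summable (\<lambda>n. rGamma (\<nu> + 1) * (inverse (fact n) * (\<bar>s * z\<bar> / m) ^ n))"
      by (intro summable_mult summable_exp)
    fix n
    have "m ^ n * 1 \<le> m ^ n * fact n" using m by (intro mult_left_mono) (auto simp: fact_ge_1)
    with pochhammer_ge[OF m, of n] have "m ^ n \<le> pochhammer (\<nu> + 1) n" by simp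
    then have "1 / pochhammer (\<nu> + 1) n \<le> 1 / m ^ n"
      using m assms by (intro divide_left_mono) (auto intro!: mult_pos_pos pochhammer_pos)
    from mult_left_mono[OF this, of "\<bar>s * z\<bar> ^ n / fact n * rGamma (\<nu> + 1)"]
    have "\<bar>s * z\<bar> ^ n / fact n * rGamma (\<nu> + 1) * (1 / pochhammer (\<nu> + 1) n)
        \<le> \<bar>s * z\<bar> ^ n / fact n * rGamma (\<nu> + 1) * (1 / m ^ n)"
      using assms by (simp add: rGamma_inverse_Gamma Gamma_real_nonneg)
    moreover have "0 \<le> rGamma (\<nu> + 1)"
      using assms by (simp add: rGamma_inverse_Gamma Gamma_real_nonneg)
    moreover have "0 < pochhammer (\<nu> + 1) n" using assms by (intro pochhammer_pos) simp
    ultimately show "norm (fps_nth (bessel_fps s \<nu>) (n) * z ^ n) \<le> rGamma (\<nu> + 1) * (inverse (fact n) * (\<bar>s * z\<bar> / m) ^ n)"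
      unfolding bessel_fps_def fps_nth_Abs_fps rGamma_shift[OF assms]
      by (simp add: abs_mult power_mult_distrib power_abs power_divide divide_inverse mult_ac power_inverse)
  qed
qed

text \<open>Replacing t by - t exchanges j and i, so p is even and w odd in t. Hence w is t times a
  series in t^2 = x^4/16, which is why the fourth power of x appears everywhere.\<close>

lemma bessel_fps_wronskian:
  assumes \<nu>: "- 1 < \<nu>"
  defines "j \<equiv> bessel_fps (- 1) \<nu>" and "i \<equiv> bessel_fps 1 \<nu>"
  defines "w \<equiv> j * fps_XD i - fps_XD j * i"
  shows "fps_nth w (2 * n) = 0"
    and "fps_nth w (2 * n + 1) = 2 * rGamma (\<nu> + 1) * rGamma (\<nu> + 2) * (- 1) ^ n * cross_coeff (\<nu> + 1) (\<nu> + 2) n"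
proof -
  define p where "p = j * i"
  define q where "q = fps_XD j * fps_XD i"
  let ?c = "fps_const \<nu>"
  \<comment> \<open>The differential equations of \<open>J\<close> and \<open>I\<close> close up on \<open>w\<close>, \<open>p\<close>, \<open>q\<close> and give a two-step recurrence for the coefficients of \<open>w\<close>.\<close>
  have J: "fps_XD (fps_XD j) = - fps_X * j - ?c * fps_XD j"
    using bessel_fps_ode[OF \<nu>, of "- 1"] by (simp add: j_def flip: fps_const_neg)
  have I: "fps_XD (fps_XD i) = fps_X * i - ?c * fps_XD i"
    using bessel_fps_ode[OF \<nu>, of 1] by (simp add: i_def)
  have minus: "fps_XD (f - g) = fps_XD f - fps_XD g" for f g :: "real fps"
    by (simp add: fps_XD_def algebra_simps)
  have two: "fps_const 2 * f = f + f" for f :: "real fps"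
    by (rule fps_ext) simp
  have Dw: "fps_XD w + ?c * w = fps_const 2 * (fps_X * p)"
    unfolding two w_def p_def minus fps_XD_mult J I by (simp add: algebra_simps)
  have Dp: "fps_XD (fps_XD p) + ?c * fps_XD p = fps_const 2 * q"
    unfolding two q_def p_def fps_XD_add fps_XD_mult J I by (simp add: algebra_simps)
  have Dq: "fps_XD q + fps_const 2 * (?c * q) = - (fps_X * w)"
    unfolding two q_def w_def fps_XD_mult J I by (simp add: algebra_simps)
  have wn: "(real (Suc n) + \<nu>) * fps_nth w (Suc n) = 2 * fps_nth p n" for n
    using arg_cong[OF Dw, of "\<lambda>f. fps_nth f (Suc n)"]
    by (simp add: distrib_right distrib_left mult.assoc mult.left_commute)
  have pn: "real n * (real n + \<nu>) * fps_nth p n = 2 * fps_nth q n" for n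
    using arg_cong[OF Dp, of "\<lambda>f. fps_nth f n"]
    by (simp add: distrib_right distrib_left mult.assoc mult.left_commute)
  have qn: "(real (Suc n) + 2 * \<nu>) * fps_nth q (Suc n) = - fps_nth w n" for n
    using arg_cong[OF Dq, of "\<lambda>f. fps_nth f (Suc n)"]
    by (simp add: distrib_right distrib_left mult.assoc mult.left_commute)
  have ji: "fps_nth j k = (- 1) ^ k * fps_nth i k" for k
    by (simp add: j_def i_def bessel_fps_def)
  have p_odd: "fps_nth p n = 0" if "odd n" for n
  proof -
    have "fps_nth p n = (\<Sum>k=0..n. (- 1) ^ k * fps_nth i k * fps_nth i (n - k))"
      by (simp add: p_def fps_mult_nth ji)
    also have "\<dots> = (\<Sum>k=0..n. (- 1) ^ (n - k) * fps_nth i (n - k) * fps_nth i k)"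
      by (subst sum.atLeastAtMost_rev) (auto intro!: sum.cong)
    also have "\<dots> = (\<Sum>k=0..n. - ((- 1) ^ k * fps_nth i k * fps_nth i (n - k)))"
    proof (rule sum.cong)
      fix k assume "k \<in> {0..n}"
      then have "(- 1 :: real) ^ (n - k) = - ((- 1) ^ k)"
        using that by (cases "even k") (auto simp: )
      then show "(- 1) ^ (n - k) * fps_nth i (n - k) * fps_nth i k = - ((- 1) ^ k * fps_nth i k * fps_nth i (n - k))" by simp
    qed simp
    also have "\<dots> = - fps_nth p n"
      by (simp add: p_def fps_mult_nth ji sum_negf)
    finally show ?thesis by simp
  qed
  show even: "fps_nth w (2 * n) = 0"
  proof (cases n)
    case 0
    then show ?thesis by (simp add: w_def)
  next
    case (Suc k)
    have "(real (2 * n) + \<nu>) * fps_nth w (2 * n) = 0"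
      using wn[of "2 * k + 1"] p_odd[of "2 * k + 1"] Suc by simp
    moreover have "real (2 * n) + \<nu> > 0" using Suc \<nu> by simp
    ultimately show ?thesis by simp
  qed
  have rG: "(\<nu> + 1) * rGamma (\<nu> + 2) = rGamma (\<nu> + 1)"
    using rGamma_plus1[of "\<nu> + 1"] by (simp add: add.assoc)
  show "fps_nth w (2 * n + 1) = 2 * rGamma (\<nu> + 1) * rGamma (\<nu> + 2) * (- 1) ^ n * cross_coeff (\<nu> + 1) (\<nu> + 2) n"
  proof (induction n)
    case 0
    have "fps_nth p 0 = rGamma (\<nu> + 1) * rGamma (\<nu> + 1)"
      by (simp add: p_def j_def i_def bessel_fps_def)
    moreover have "(1 + \<nu>) * fps_nth w 1 = 2 * fps_nth p 0"
      using wn[of 0] by simp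
    ultimately have "(1 + \<nu>) * fps_nth w 1 = (1 + \<nu>) * (2 * rGamma (\<nu> + 1) * rGamma (\<nu> + 2))"
      using rG by algebra
    then show ?case using \<nu> by (simp add: cross_coeff_def)
  next
    case (Suc n)
    define N where "N = real n + 1"
    define P where "P = fps_nth p (2 * n + 2)"
    define Q where "Q = fps_nth q (2 * n + 2)"
    define w' where "w' = fps_nth w (2 * n + 3)"
    have N: "0 < N" "0 < N + \<nu>" "0 < 2 * N + \<nu>" "0 < 2 * N + 1 + \<nu>" using \<nu> by (auto simp: N_def)
    have e1: "(2 * N + 1 + \<nu>) * w' = 2 * P"
      using wn[of "2 * n + 2"] by (simp add: N_def P_def w'_def algebra_simps numeral_3_eq_3)
    have e2: "N * (2 * N + \<nu>) * P = Q"
      using pn[of "2 * n + 2"] by (simp add: N_def P_def Q_def algebra_simps)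
    have e3: "2 * (N + \<nu>) * Q = - fps_nth w (2 * n + 1)"
      using qn[of "2 * n + 1"] by (simp add: N_def Q_def algebra_simps)
    \<comment> \<open>With b = \<nu> + 1 and c = \<nu> + 2 this is (n + 1) (b + n) (c + 2n) (c + 2n
      + 1), the ratio of consecutive denominators of \<open>cross_coeff\<close>.\<close>
    define K where "K = N * (2 * N + \<nu>) * (N + \<nu>) * (2 * N + 1 + \<nu>)"
    have "K * w' = - fps_nth w (2 * n + 1)"
      unfolding K_def using e1 e2 e3 by algebra
    moreover have "0 < K" using N by (simp add: K_def)
    ultimately have "w' = - fps_nth w (2 * n + 1) / K"
      by (simp add: field_simps)
    moreover have "cross_coeff (\<nu> + 1) (\<nu> + 2) (Suc n)
        = cross_coeff (\<nu> + 1) (\<nu> + 2) n / K"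
      by (simp add: cross_coeff_def pochhammer_Suc N_def K_def algebra_simps)
    moreover have "fps_nth w (2 * Suc n + 1) = w'" by (simp add: w'_def numeral_3_eq_3)
    ultimately show ?case using Suc.IH by simp
  qed
qed

section \<open>From formal series to the Bessel functions\<close>

lemma bessel_series:
  assumes "- 1 < \<nu>" "0 < x"
  shows "(\<Sum>n. s ^ n / fact n * rGamma (real n + \<nu> + 1) * (x / 2) powr (2 * real n + \<nu>))
    = (x / 2) powr \<nu> * eval_fps (bessel_fps s \<nu>) (x\<^sup>2 / 4)"
proof -
  have "(x / 2) powr (2 * real n + \<nu>) = (x / 2) powr \<nu> * (x\<^sup>2 / 4) ^ n" for n
  proof -
    have "(x / 2) powr (2 * real n) = (x / 2) ^ (2 * n)"
      using assms(2) powr_realpow[of "x / 2" "2 * n"] by simp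
    then show ?thesis by (simp add: powr_add power_mult power_divide)
  qed
  then have "(\<Sum>n. s ^ n / fact n * rGamma (real n + \<nu> + 1) * (x / 2) powr (2 * real n + \<nu>))
      = (\<Sum>n. (x / 2) powr \<nu> * (fps_nth (bessel_fps s \<nu>) (n) * (x\<^sup>2 / 4) ^ n))"
    by (simp add: bessel_fps_def mult_ac)
  also have "\<dots> = (x / 2) powr \<nu> * eval_fps (bessel_fps s \<nu>) (x\<^sup>2 / 4)"
    unfolding eval_fps_def
    by (rule suminf_mult, rule summable_fps) (simp add: fps_conv_radius_bessel[OF assms(1)])
  finally show ?thesis .
qed

text \<open>In t = x^2/4 the operator x d/dx is 2 t d/dt, and it multiplies (x/2)^\<nu> by
  \<nu>.\<close>

lemma bessel_deriv:
  assumes "- 1 < \<nu>" "0 < x" and f: "\<And>y. 0 < y \<Longrightarrow> f y = (y / 2) powr \<nu> * eval_fps (bessel_fps s \<nu>) (y\<^sup>2 / 4)"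
  shows "x * deriv f x = (x / 2) powr \<nu> *
    (\<nu> * eval_fps (bessel_fps s \<nu>) (x\<^sup>2 / 4) + 2 * eval_fps (fps_XD (bessel_fps s \<nu>)) (x\<^sup>2 / 4))"
proof -
  let ?g = "bessel_fps s \<nu>"
  let ?t = "x\<^sup>2 / 4"
  have D: "(eval_fps ?g has_field_derivative eval_fps (fps_deriv ?g) ?t) (at ?t)"
    by (rule has_field_derivative_eval_fps) (simp add: fps_conv_radius_bessel[OF assms(1)])
  have "((\<lambda>y. y\<^sup>2 / 4) has_field_derivative x / 2) (at x)"
    by (auto intro!: derivative_eq_intros)
  from DERIV_chain2[OF D this]
  have D2: "((\<lambda>y. eval_fps ?g (y\<^sup>2 / 4)) has_field_derivative eval_fps (fps_deriv ?g) ?t * (x / 2)) (at x)" .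
  have "((\<lambda>y. (y / 2) powr \<nu>) has_field_derivative \<nu> * (x / 2) powr \<nu> / x) (at x)"
    using assms(2) by (auto intro!: derivative_eq_intros simp: powr_diff field_simps)
  from DERIV_mult[OF this D2]
  have "((\<lambda>y. (y / 2) powr \<nu> * eval_fps ?g (y\<^sup>2 / 4)) has_field_derivative
     \<nu> * (x / 2) powr \<nu> / x * eval_fps ?g ?t + eval_fps (fps_deriv ?g) ?t * (x / 2) * (x / 2) powr \<nu>) (at x)" .
  then have "(f has_field_derivative
     \<nu> * (x / 2) powr \<nu> / x * eval_fps ?g ?t + eval_fps (fps_deriv ?g) ?t * (x / 2) * (x / 2) powr \<nu>) (at x)"
    by (rule has_field_derivative_transform_within_open[of _ _ _ "{0<..}"]) (use assms in auto)
  then have "deriv f x = \<nu> * (x / 2) powr \<nu> / x * eval_fps ?g ?t + eval_fps (fps_deriv ?g) ?t * (x / 2) * (x / 2) powr \<nu>"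
    by (rule DERIV_imp_deriv)
  moreover have "eval_fps (fps_XD ?g) ?t = ?t * eval_fps (fps_deriv ?g) ?t"
  proof -
    have "fps_conv_radius (fps_deriv ?g) = \<infinity>"
      using fps_conv_radius_deriv[of ?g] fps_conv_radius_bessel[OF assms(1), of s] by simp
    then show ?thesis by (simp add: fps_XD_def eval_fps_mult)
  qed
  moreover have "x * (\<nu> * P / x * E + D * (x / 2) * P) = P * (\<nu> * E + 2 * (x\<^sup>2 / 4 * D))" for P E D
    using assms(2) by (simp add: field_simps power2_eq_square)
  ultimately show ?thesis by (simp only:)
qed

text \<open>The terms with factor \<nu> in the two Euler derivatives cancel in the cross-product,
  which leaves 2 (x/2)^(2\<nu>) w(t).\<close>

lemma bessel_cross_eq:
  assumes "- 1 < \<nu>" "0 < x"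
  shows "x * bessel_cross \<nu> x = 4 * (x / 2) powr (2 * \<nu>) * (x\<^sup>2 / 4) * rGamma (\<nu> + 1) * rGamma (\<nu> + 2)
    * cross_fun (\<nu> + 1) (\<nu> + 2) (x ^ 4 / 16)"
proof -
  define j where "j = bessel_fps (- 1) \<nu>"
  define i where "i = bessel_fps 1 \<nu>"
  define w where "w = j * fps_XD i - fps_XD j * i"
  let ?t = "x\<^sup>2 / 4"
  have J: "bessel_J \<nu> y = (y / 2) powr \<nu> * eval_fps j (y\<^sup>2 / 4)" if "0 < y" for y
    using bessel_series[OF assms(1) that, of "- 1"] by (simp add: bessel_J_def j_def)
  have I: "bessel_I \<nu> y = (y / 2) powr \<nu> * eval_fps i (y\<^sup>2 / 4)" if "0 < y" for y
    using bessel_series[OF assms(1) that, of 1] by (simp add: bessel_I_def i_def)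
  have dJ: "x * deriv (bessel_J \<nu>) x = (x / 2) powr \<nu> * (\<nu> * eval_fps j ?t + 2 * eval_fps (fps_XD j) ?t)"
    using J unfolding j_def by (rule bessel_deriv[OF assms])
  have dI: "x * deriv (bessel_I \<nu>) x = (x / 2) powr \<nu> * (\<nu> * eval_fps i ?t + 2 * eval_fps (fps_XD i) ?t)"
    using I unfolding i_def by (rule bessel_deriv[OF assms])
  have rad: "fps_conv_radius j = \<infinity>" "fps_conv_radius i = \<infinity>"
    by (simp_all add: j_def i_def fps_conv_radius_bessel[OF assms(1)])
  have radD: "fps_conv_radius (fps_XD j) = \<infinity>" "fps_conv_radius (fps_XD i) = \<infinity>"
    using fps_conv_radius_deriv[of j] fps_conv_radius_deriv[of i] rad
      fps_conv_radius_mult[of fps_X "fps_deriv j"] fps_conv_radius_mult[of fps_X "fps_deriv i"]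
    by (simp_all add: fps_XD_def)
  have radM: "fps_conv_radius (j * fps_XD i) = \<infinity>" "fps_conv_radius (fps_XD j * i) = \<infinity>"
    using fps_conv_radius_mult[of j "fps_XD i"] fps_conv_radius_mult[of "fps_XD j" i] rad radD by simp_all
  have ev: "eval_fps w ?t = eval_fps j ?t * eval_fps (fps_XD i) ?t - eval_fps (fps_XD j) ?t * eval_fps i ?t"
    using rad radD radM by (simp add: w_def eval_fps_diff eval_fps_mult)
  have "x * bessel_cross \<nu> x = bessel_J \<nu> x * (x * deriv (bessel_I \<nu>) x) - x * deriv (bessel_J \<nu>) x * bessel_I \<nu> x"
    by (simp add: bessel_cross_def algebra_simps)
  also have "\<dots> = 2 * ((x / 2) powr \<nu> * (x / 2) powr \<nu>) * eval_fps w ?t"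
    unfolding dJ dI J[OF assms(2)] I[OF assms(2)] ev by (simp add: algebra_simps)
  also have "(x / 2) powr \<nu> * (x / 2) powr \<nu> = (x / 2) powr (2 * \<nu>)"
    by (simp flip: powr_add)
  also have "eval_fps w ?t = 2 * rGamma (\<nu> + 1) * rGamma (\<nu> + 2) * ?t * cross_fun (\<nu> + 1) (\<nu> + 2) (x ^ 4 / 16)"
  proof -
    have w_even: "fps_nth w n = 0" if "even n" for n
      using bessel_fps_wronskian(1)[OF assms(1), of "n div 2"] that by (simp add: w_def j_def i_def)
    have w_odd: "fps_nth w (2 * n + 1) = 2 * rGamma (\<nu> + 1) * rGamma (\<nu> + 2) * (- 1) ^ n * cross_coeff (\<nu> + 1) (\<nu> + 2) n" for n
      using bessel_fps_wronskian(2)[OF assms(1), of n] by (simp add: w_def j_def i_def)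
    have "fps_conv_radius w = \<infinity>"
      using fps_conv_radius_diff[of "j * fps_XD i" "fps_XD j * i"] radM by (simp add: w_def)
    then have "(\<lambda>n. fps_nth w n * ?t ^ n) sums eval_fps w ?t"
      by (intro sums_eval_fps) simp
    then have "(\<lambda>n. fps_nth w (2 * n + 1) * ?t ^ (2 * n + 1)) sums eval_fps w ?t"
    proof (subst sums_mono_reindex[of "\<lambda>n. 2 * n + 1" "\<lambda>n. fps_nth w n * ?t ^ n"])
      show "fps_nth w n * ?t ^ n = 0" if "n \<notin> range (\<lambda>n. 2 * n + 1)" for n
      proof -
        have "even n"
        proof (rule ccontr)
          assume "odd n"
          then obtain k where "n = 2 * k + 1" by (rule oddE)
          with that show False by blast
        qed
        then show ?thesis by (simp add: w_even)
      qed
    qed (auto simp: strict_mono_def)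
    moreover have "fps_nth w (2 * n + 1) * ?t ^ (2 * n + 1) = 2 * rGamma (\<nu> + 1) * rGamma (\<nu> + 2) * ?t
        * ((- 1) ^ n * cross_coeff (\<nu> + 1) (\<nu> + 2) n * (x ^ 4 / 16) ^ n)" for n
    proof -
      have "?t ^ (2 * n + 1) = ?t * (x ^ 4 / 16) ^ n"
      proof -
        have "x ^ 4 / 16 = ?t\<^sup>2" by (simp add: power_divide flip: power_mult)
        then show ?thesis by (simp only: power_add power_mult[of ?t 2 n] power_one_right) (rule mult.commute)
      qed
      then show ?thesis unfolding w_odd by (simp only: mult_ac)
    qed
    moreover have "(\<lambda>n. 2 * rGamma (\<nu> + 1) * rGamma (\<nu> + 2) * ?t
        * ((- 1) ^ n * cross_coeff (\<nu> + 1) (\<nu> + 2) n * (x ^ 4 / 16) ^ n))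
      sums (2 * rGamma (\<nu> + 1) * rGamma (\<nu> + 2) * ?t * cross_fun (\<nu> + 1) (\<nu> + 2) (x ^ 4 / 16))"
      unfolding cross_fun_def using assms
      by (intro sums_mult summable_sums summable_cross_coeff) auto
    ultimately show ?thesis by (simp only: sums_iff)
  qed
  also have "2 * A * (2 * B * C * T * D) = 4 * A * T * B * C * D" for A B C T D :: real
    by simp
  finally show ?thesis .
qed

text \<open>The series depends on x only through x^4 and is 1 at 0, in accordance with the absolute
  value and the special case in the definition.\<close>

lemma norm_bessel_cross_eq:
  assumes "- 1 < \<nu>"
  shows "norm_bessel_cross \<nu> x = cross_fun (\<nu> + 1) (\<nu> + 2) (x ^ 4 / 16)"
proof (cases "x = 0")
  case True
  then show ?thesis by (simp add: norm_bessel_cross_def cross_fun_0)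
next
  case False
  define y where "y = \<bar>x\<bar>"
  have y: "0 < y" "x ^ 4 = y ^ 4" using False by (auto simp: y_def)
  have G: "Gamma (\<nu> + 1) \<noteq> 0" "Gamma (\<nu> + 2) \<noteq> 0"
    using Gamma_real_pos[of "\<nu> + 1"] Gamma_real_pos[of "\<nu> + 2"] assms by linarith+
  have "bessel_cross \<nu> y = (4 * (y / 2) powr (2 * \<nu>) * (y\<^sup>2 / 4) * rGamma (\<nu> + 1) * rGamma (\<nu> + 2)
    * cross_fun (\<nu> + 1) (\<nu> + 2) (y ^ 4 / 16)) / y"
    using bessel_cross_eq[OF assms y(1)] y(1) by (simp add: field_simps)
  moreover have "y powr (- 2 * \<nu> - 1) * y powr (2 * \<nu>) = 1 / y"
    using y(1) by (simp add: powr_minus_divide flip: powr_add)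
  moreover have "2 powr (2 * \<nu>) * (y / 2) powr (2 * \<nu>) = y powr (2 * \<nu>)"
    using y(1) by (simp add: powr_divide)
  moreover have "P1 * Q * G1 * G2 * ((4 * P2 * (y\<^sup>2 / 4) * inverse G1 * inverse G2 * C) / y)
      = (Q * (P1 * P2)) * y * C" if "G1 \<noteq> 0" "G2 \<noteq> 0" for P1 P2 Q G1 G2 C :: real
    using that y(1) by (simp add: field_simps power2_eq_square)
  note this[OF G]
  ultimately show ?thesis
    using False y unfolding norm_bessel_cross_def y_def[symmetric] rGamma_inverse_Gamma
    by simp
qed

text \<open>On the positive axis the two functions share zeros and signs, and where they are
  positive their logarithms differ by (2\<nu> + 1) ln x plus a constant.\<close>

lemma bessel_cross_norm:
  assumes "- 1 < \<nu>"
  obtains k where "0 < k" "\<And>x. 0 < x \<Longrightarrow> bessel_cross \<nu> x = k * x powr (2 * \<nu> + 1) * norm_bessel_cross \<nu> x"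
proof
  define K where "K = 2 powr (2 * \<nu>) * Gamma (\<nu> + 1) * Gamma (\<nu> + 2)"
  have "0 < K" using assms by (simp add: K_def Gamma_real_pos)
  then show "0 < 1 / K" by simp
  fix x :: real assume x: "0 < x"
  have "x powr (2 * \<nu> + 1) * x powr (- 2 * \<nu> - 1) = 1"
    using x by (simp flip: powr_add)
  then have "x powr (2 * \<nu> + 1) * norm_bessel_cross \<nu> x = K * bessel_cross \<nu> x"
    using x unfolding norm_bessel_cross_def K_def by (simp add: algebra_simps)
  then show "bessel_cross \<nu> x = 1 / K * x powr (2 * \<nu> + 1) * norm_bessel_cross \<nu> x"
    using \<open>0 < K\<close> by (simp add: field_simps)
qed

section \<open>Monotonicity in the order\<close>

lemma poly_eq_sum_le:
  fixes q :: "real poly"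
  assumes "\<And>n. N < n \<Longrightarrow> coeff q n = 0"
  shows "poly q x = (\<Sum>n\<le>N. coeff q n * x ^ n)"
proof -
  have "degree q \<le> N" by (rule degree_le) (use assms in auto)
  then show ?thesis
    unfolding poly_altdef by (intro sum.mono_neutral_left) (auto simp: coeff_eq_0)
qed

text \<open>V A e is the e-fold Euler derivative at x of the polynomial built with the operators in
  A only. Differentiation in \<mu> brings down factors - n d'/d^2, so the derivative of the quotient
  has as numerator a sum, with weights W j \<ge> 0, of Laguerre expressions, each for the polynomial
  with the j-th operator removed.\<close>

lemma log_deriv_mono_approx:
  fixes d :: "nat \<Rightarrow> real \<Rightarrow> real" and d' :: "nat \<Rightarrow> real" and N :: nat
  assumes J: "finite J" and pos: "\<And>j \<mu>. \<mu> \<in> {\<mu>1..\<mu>2} \<Longrightarrow> 0 < d j \<mu>"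
    and d: "\<And>j \<mu>. (d j has_real_derivative d' j) (at \<mu>)" and d': "\<And>j. 0 \<le> d' j"
    and s: "0 < s" and x: "0 \<le> x" and le: "\<mu>1 \<le> \<mu>2"
  defines "V \<equiv> \<lambda>A e \<mu>. \<Sum>n\<le>N. (- s) ^ n * of_nat (N choose n) * (\<Prod>j\<in>A. 1 + real n / d j \<mu>) * real n ^ e * x ^ n"
  assumes nz: "\<And>\<mu>. \<mu> \<in> {\<mu>1..\<mu>2} \<Longrightarrow> V J 0 \<mu> \<noteq> 0"
  shows "V J 1 \<mu>1 / V J 0 \<mu>1 \<le> V J 1 \<mu>2 / V J 0 \<mu>2"
proof -
  have laguerre: "V A 0 \<mu> * V A 2 \<mu> \<le> (V A 1 \<mu>)\<^sup>2" if \<mu>: "\<mu> \<in> {\<mu>1..\<mu>2}" and A: "A \<subseteq> J" for A \<mu>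
  proof -
    obtain p where p: "positive_rooted p"
      "\<And>n. coeff p n = (- s) ^ n * of_nat (N choose n) * (\<Prod>j\<in>A. 1 + real n / d j \<mu>)"
      using positive_rooted_multiplier[of A "\<lambda>j. d j \<mu>" s N] finite_subset[OF A J] pos[OF \<mu>] s
      by auto
    have "coeff p n = 0" if "N < n" for n
      using that by (simp add: p(2) binomial_eq_0)
    then have "poly p x = V A 0 \<mu>" "poly (theta p) x = V A 1 \<mu>" "poly (theta (theta p)) x = V A 2 \<mu>"
      unfolding V_def by (auto simp: poly_eq_sum_le[of N] p(2) power2_eq_square mult_ac intro!: sum.cong)
    then show ?thesis using positive_rooted_laguerre[OF p(1) x] by simp
  qed
  have remove: "V J e \<mu> = V (J - {j}) e \<mu> + V (J - {j}) (Suc e) \<mu> / d j \<mu>" if "j \<in> J" for j e \<mu>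
    unfolding V_def sum_divide_distrib sum.distrib[symmetric]
    by (rule sum.cong) (simp_all add: prod.remove[OF J that] algebra_simps)
  define W where "W j \<mu> = d' j / (d j \<mu>)\<^sup>2" for j \<mu>
  have deriv: "(V J e has_real_derivative - (\<Sum>j\<in>J. W j \<mu> * V (J - {j}) (Suc e) \<mu>)) (at \<mu>)"
    if \<mu>: "\<mu> \<in> {\<mu>1..\<mu>2}" for e \<mu>
  proof -
    have "((\<lambda>\<mu>. \<Prod>j\<in>J. 1 + real n / d j \<mu>) has_real_derivative
        (\<Sum>j\<in>J. - (real n * W j \<mu>) * (\<Prod>i\<in>J - {j}. 1 + real n / d i \<mu>))) (at \<mu>)" for n
    proof (rule has_field_derivative_prod)
      fix j
      have "((\<lambda>\<mu>. 1 + real n / d j \<mu>) has_real_derivative 0 + (0 * d j \<mu> - real n * d' j) / (d j \<mu> * d j \<mu>)) (at \<mu>)"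
        using pos[OF \<mu>, of j] by (intro DERIV_add DERIV_const DERIV_divide d) auto
      then show "((\<lambda>\<mu>. 1 + real n / d j \<mu>) has_real_derivative - (real n * W j \<mu>)) (at \<mu>)"
        by (simp add: W_def power2_eq_square)
    qed
    then have "(V J e has_real_derivative (\<Sum>n\<le>N. (- s) ^ n * of_nat (N choose n)
        * (\<Sum>j\<in>J. - (real n * W j \<mu>) * (\<Prod>i\<in>J - {j}. 1 + real n / d i \<mu>)) * real n ^ e * x ^ n)) (at \<mu>)"
      unfolding V_def by (intro DERIV_sum DERIV_cmult_right DERIV_cmult)
    also have "(\<Sum>n\<le>N. (- s) ^ n * of_nat (N choose n)
        * (\<Sum>j\<in>J. - (real n * W j \<mu>) * (\<Prod>i\<in>J - {j}. 1 + real n / d i \<mu>)) * real n ^ e * x ^ n)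
      = (\<Sum>n\<le>N. \<Sum>j\<in>J. - W j \<mu> * ((- s) ^ n * of_nat (N choose n)
        * (\<Prod>i\<in>J - {j}. 1 + real n / d i \<mu>) * real n ^ Suc e * x ^ n))"
      by (simp add: sum_distrib_left sum_distrib_right mult_ac)
    also have "\<dots> = - (\<Sum>j\<in>J. W j \<mu> * V (J - {j}) (Suc e) \<mu>)"
      unfolding V_def by (subst sum.swap) (simp add: sum_distrib_left sum_negf)
    finally show ?thesis .
  qed
  show ?thesis
  proof (rule DERIV_nonneg_imp_nondecreasing[OF le])
    fix \<mu> assume "\<mu>1 \<le> \<mu>" "\<mu> \<le> \<mu>2"
    then have \<mu>: "\<mu> \<in> {\<mu>1..\<mu>2}" by simp
    let ?D = "((- (\<Sum>j\<in>J. W j \<mu> * V (J - {j}) (Suc 1) \<mu>)) * V J 0 \<mu>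
      - V J 1 \<mu> * (- (\<Sum>j\<in>J. W j \<mu> * V (J - {j}) (Suc 0) \<mu>))) / (V J 0 \<mu> * V J 0 \<mu>)"
    have "((\<lambda>\<mu>. V J 1 \<mu> / V J 0 \<mu>) has_real_derivative ?D) (at \<mu>)"
      by (rule DERIV_divide[OF deriv[OF \<mu>] deriv[OF \<mu>] nz[OF \<mu>]])
    moreover have "0 \<le> ?D"
    proof (rule divide_nonneg_nonneg)
      have "(- (\<Sum>j\<in>J. W j \<mu> * V (J - {j}) (Suc 1) \<mu>)) * V J 0 \<mu>
          - V J 1 \<mu> * (- (\<Sum>j\<in>J. W j \<mu> * V (J - {j}) (Suc 0) \<mu>))
        = (\<Sum>j\<in>J. W j \<mu> * (V J 1 \<mu> * V (J - {j}) 1 \<mu> - V J 0 \<mu> * V (J - {j}) 2 \<mu>))"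
        by (simp add: sum_distrib_left sum_distrib_right sum_subtractf algebra_simps numeral_2_eq_2)
      also have "0 \<le> \<dots>"
      proof (intro sum_nonneg mult_nonneg_nonneg)
        fix j assume j: "j \<in> J"
        show "0 \<le> W j \<mu>" using d' by (simp add: W_def)
        \<comment> \<open>With V0, V1, V2 the values for J - {j}, the left side is (V1 + V2/d) V1 -
          (V0 + V1/d) V2, where the terms with d cancel.\<close>
        have "V J 1 \<mu> * V (J - {j}) 1 \<mu> - V J 0 \<mu> * V (J - {j}) 2 \<mu>
          = (V (J - {j}) 1 \<mu>)\<^sup>2 - V (J - {j}) 0 \<mu> * V (J - {j}) 2 \<mu>"
          using remove[OF j, of 0 \<mu>] remove[OF j, of 1 \<mu>]
          by (simp add: numeral_2_eq_2 algebra_simps)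
        then show "0 \<le> V J 1 \<mu> * V (J - {j}) 1 \<mu> - V J 0 \<mu> * V (J - {j}) 2 \<mu>"
          using laguerre[OF \<mu>, of "J - {j}"] by auto
      qed
      finally show "0 \<le> (- (\<Sum>j\<in>J. W j \<mu> * V (J - {j}) (Suc 1) \<mu>)) * V J 0 \<mu>
          - V J 1 \<mu> * (- (\<Sum>j\<in>J. W j \<mu> * V (J - {j}) (Suc 0) \<mu>))" .
    qed simp
    ultimately show "\<exists>y. ((\<lambda>\<mu>. V J 1 \<mu> / V J 0 \<mu>) has_real_derivative y) (at \<mu>) \<and> 0 \<le> y" by blast
  qed
qed

lemma tendsto_approx_sum:
  assumes "- 1 < \<mu>1" "\<And>k. \<mu> k \<in> {\<mu>1..\<mu>2}" "\<mu> \<longlonglongrightarrow> \<mu>'" "\<And>k. 0 < N k" "filterlim N at_top sequentially" "e \<le> 1"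
  shows "(\<lambda>k. \<Sum>n. (- 1) ^ n * approx_coeff (N k) (\<mu> k + 1) (\<mu> k + 2) n * real n ^ e * x ^ n)
    \<longlonglongrightarrow> (\<Sum>n. (- 1) ^ n * cross_coeff (\<mu>' + 1) (\<mu>' + 2) n * real n ^ e * x ^ n)"
proof -
  define m where "m = min 1 (\<mu>1 + 1)"
  have m: "0 < m" "m \<le> 1" "m \<le> \<mu>1 + 1" using assms(1) by (auto simp: m_def)
  have ge: "\<mu>1 \<le> \<mu>'" by (rule LIMSEQ_le_const[OF assms(3)]) (use assms(2) in auto)
  have "\<mu>1 \<le> \<mu>2" using assms(2)[of 0] by simp
  show ?thesis
  proof (rule tannery_powser)
    show "0 \<le> (\<mu>2 + 2 + 3) ^ 3 / m ^ 3" using m \<open>\<mu>1 \<le> \<mu>2\<close> assms(1) by simp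
    show "(\<lambda>k. (- 1) ^ n * approx_coeff (N k) (\<mu> k + 1) (\<mu> k + 2) n)
        \<longlonglongrightarrow> (- 1) ^ n * cross_coeff (\<mu>' + 1) (\<mu>' + 2) n" for n
    proof (intro tendsto_mult tendsto_const tendsto_approx_coeff tendsto_add assms)
      show "0 < \<mu> k + 1" "0 < \<mu> k + 2" for k using assms(1) assms(2)[of k] by auto
    qed (use ge assms(1) in auto)
    show "\<bar>(- 1) ^ n * approx_coeff (N k) (\<mu> k + 1) (\<mu> k + 2) n\<bar> \<le> ((\<mu>2 + 2 + 3) ^ 3 / m ^ 3) ^ n / (fact n)\<^sup>2" for k n
      using approx_coeff_le[of m "\<mu> k + 1" "\<mu> k + 2" "\<mu>2 + 2" "N k" n] m assms(2)[of k] assms(4)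
      by (simp add: abs_mult)
  qed (use assms in auto)
qed

text \<open>Joint continuity in order and argument, in sequential form; the lower bound \<mu>1 > -1
  supplies a common majorant.\<close>

lemma tendsto_cross_fun:
  assumes "- 1 < \<mu>1" "\<And>k. \<mu>1 \<le> \<mu> k" "\<mu> \<longlonglongrightarrow> \<mu>'" "x \<longlonglongrightarrow> x'"
  shows "(\<lambda>k. cross_fun (\<mu> k + 1) (\<mu> k + 2) (x k)) \<longlonglongrightarrow> cross_fun (\<mu>' + 1) (\<mu>' + 2) x'"
proof -
  define m where "m = min 1 (\<mu>1 + 1)"
  have m: "0 < m" "m \<le> 1" "m \<le> \<mu>1 + 1" using assms(1) by (auto simp: m_def)
  have ge: "\<mu>1 \<le> \<mu>'" by (rule LIMSEQ_le_const[OF assms(3)]) (use assms(2) in auto)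
  have "(\<lambda>k. \<Sum>n. (- 1) ^ n * cross_coeff (\<mu> k + 1) (\<mu> k + 2) n * real n ^ 0 * x k ^ n)
    \<longlonglongrightarrow> (\<Sum>n. (- 1) ^ n * cross_coeff (\<mu>' + 1) (\<mu>' + 2) n * real n ^ 0 * x' ^ n)"
  proof (rule tannery_powser)
    show "0 \<le> 1 / m ^ 3" using m by simp
    show "(\<lambda>k. (- 1) ^ n * cross_coeff (\<mu> k + 1) (\<mu> k + 2) n)
        \<longlonglongrightarrow> (- 1) ^ n * cross_coeff (\<mu>' + 1) (\<mu>' + 2) n" for n
      using pochhammer_pos[of "\<mu>' + 1" n] pochhammer_pos[of "\<mu>' + 2" "2 * n"] ge assms(1)
      unfolding cross_coeff_def pochhammer_prod by (intro tendsto_intros assms) auto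
    show "\<bar>(- 1) ^ n * cross_coeff (\<mu> k + 1) (\<mu> k + 2) n\<bar> \<le> (1 / m ^ 3) ^ n / (fact n)\<^sup>2" for k n
      using cross_coeff_le[of m "\<mu> k + 1" "\<mu> k + 2" n] cross_coeff_pos[of "\<mu> k + 1" "\<mu> k + 2" n]
        m assms(1) assms(2)[of k] by (simp add: abs_mult)
  qed (use assms in auto)
  then show ?thesis by (simp add: cross_fun_def)
qed

lemma approx_sum_log_deriv_mono:
  assumes "- 1 < \<mu>1" "\<mu>1 \<le> \<mu>2" "0 \<le> x" "0 < N"
  defines "Q \<equiv> \<lambda>e \<mu>. \<Sum>n. (- 1) ^ n * approx_coeff N (\<mu> + 1) (\<mu> + 2) n * real n ^ e * x ^ n"
  assumes "\<And>\<mu>. \<mu> \<in> {\<mu>1..\<mu>2} \<Longrightarrow> Q 0 \<mu> \<noteq> 0"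
  shows "Q 1 \<mu>1 / Q 0 \<mu>1 \<le> Q 1 \<mu>2 / Q 0 \<mu>2"
proof -
  define d where "d j \<mu> = approx_factor N (\<mu> + 1) (\<mu> + 2) j" for j \<mu>
  define s where "s = 1 / real N ^ 4"
  have Q: "Q e \<mu> = (\<Sum>n\<le>N. (- s) ^ n * of_nat (N choose n) * (\<Prod>j<2 * N. 1 + real n / d j \<mu>) * real n ^ e * x ^ n)" for e \<mu>
  proof -
    have "Q e \<mu> = (\<Sum>n\<le>N. (- 1) ^ n * approx_coeff N (\<mu> + 1) (\<mu> + 2) n * real n ^ e * x ^ n)"
      unfolding Q_def by (rule suminf_finite) (auto simp: approx_coeff_def binomial_eq_0)
    also have "\<dots> = (\<Sum>n\<le>N. (- s) ^ n * of_nat (N choose n) * (\<Prod>j<2 * N. 1 + real n / d j \<mu>) * real n ^ e * x ^ n)"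
      unfolding approx_coeff_factor power_minus[of s]
      by (simp add: s_def d_def power_one_over power_mult mult.assoc)
    finally show ?thesis .
  qed
  show ?thesis
    unfolding Q
  proof (rule log_deriv_mono_approx)
    show "(d j has_real_derivative (if j < N then 1 else 1 / 2)) (at \<mu>)" for j \<mu>
      unfolding d_def approx_factor_def by (auto intro!: derivative_eq_intros)
    show "0 < d j \<mu>" if "\<mu> \<in> {\<mu>1..\<mu>2}" for j \<mu>
      unfolding d_def using that assms(1) by (intro approx_factor_pos) auto
    show "0 < s" using assms(4) by (simp add: s_def)
    show "(\<Sum>n\<le>N. (- s) ^ n * of_nat (N choose n) * (\<Prod>j<2 * N. 1 + real n / d j \<mu>) * real n ^ 0 * x ^ n) \<noteq> 0"
      if "\<mu> \<in> {\<mu>1..\<mu>2}" for \<mu>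
      using assms(6)[OF that] unfolding Q .
  qed (use assms in auto)
qed

theorem cross_fun_log_deriv_mono:
  assumes "- 1 < \<mu>1" "\<mu>1 \<le> \<mu>2" "0 \<le> x"
    and nz: "\<And>\<mu>. \<mu> \<in> {\<mu>1..\<mu>2} \<Longrightarrow> cross_fun (\<mu> + 1) (\<mu> + 2) x \<noteq> 0"
  shows "x * deriv (cross_fun (\<mu>1 + 1) (\<mu>1 + 2)) x / cross_fun (\<mu>1 + 1) (\<mu>1 + 2) x
    \<le> x * deriv (cross_fun (\<mu>2 + 1) (\<mu>2 + 2)) x / cross_fun (\<mu>2 + 1) (\<mu>2 + 2) x"
proof -
  define Q where "Q N e \<mu> = (\<Sum>n. (- 1) ^ n * approx_coeff N (\<mu> + 1) (\<mu> + 2) n * real n ^ e * x ^ n)" for N e \<mu>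
  define R where "R e \<mu> = (\<Sum>n. (- 1) ^ n * cross_coeff (\<mu> + 1) (\<mu> + 2) n * real n ^ e * x ^ n)" for e \<mu>
  have R0: "R 0 \<mu> = cross_fun (\<mu> + 1) (\<mu> + 2) x" for \<mu>
    by (simp add: R_def cross_fun_def)
  have R1: "R 1 \<mu> = x * deriv (cross_fun (\<mu> + 1) (\<mu> + 2)) x" if "\<mu> \<in> {\<mu>1..\<mu>2}" for \<mu>
    using cross_fun_theta[of "\<mu> + 1" "\<mu> + 2" x] that assms(1) by (simp add: R_def sums_iff)
  \<comment> \<open>Otherwise approximants with N k \<rightarrow> \<infinity> vanish at orders \<mu>
    k. By compactness these accumulate at some l in the interval, where the limit would vanish as
    well, against \<open>nz\<close>.\<close>
  have ev: "eventually (\<lambda>N. \<forall>\<mu>\<in>{\<mu>1..\<mu>2}. Q N 0 \<mu> \<noteq> 0) sequentially"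
  proof (rule ccontr)
    assume "\<not> ?thesis"
    then have "\<forall>k. \<exists>N\<ge>Suc k. \<exists>\<mu>\<in>{\<mu>1..\<mu>2}. Q N 0 \<mu> = 0"
      unfolding eventually_sequentially by metis
    then obtain N \<mu> where N: "\<And>k. Suc k \<le> N k" and \<mu>: "\<And>k. \<mu> k \<in> {\<mu>1..\<mu>2}" and Q0: "\<And>k. Q (N k) 0 (\<mu> k) = 0"
      by metis
    obtain l r where l: "l \<in> {\<mu>1..\<mu>2}" and r: "strict_mono (r :: nat \<Rightarrow> nat)" "(\<mu> \<circ> r) \<longlonglongrightarrow> l"
      using compact_Icc[of \<mu>1 \<mu>2] \<mu> unfolding compact_def by meson
    have "filterlim (\<lambda>k. N (r k)) at_top sequentially"
    proof (rule filterlim_at_top_mono[OF filterlim_ident])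
      have "k \<le> N (r k)" for k
        using N[of "r k"] seq_suble[OF r(1), of k] by linarith
      then show "eventually (\<lambda>k. k \<le> N (r k)) sequentially" by simp
    qed
    moreover have "0 < N k" for k using N[of k] by simp
    ultimately have "(\<lambda>k. Q (N (r k)) 0 ((\<mu> \<circ> r) k)) \<longlonglongrightarrow> R 0 l"
      unfolding Q_def R_def using \<mu> r(2) by (intro tendsto_approx_sum[OF assms(1), of _ \<mu>2]) (simp_all add: o_def)
    then have "R 0 l = 0" using Q0 by (simp add: o_def LIMSEQ_const_iff)
    then show False using nz[OF l] R0 by simp
  qed
  have lim: "(\<lambda>k. Q (Suc k) e \<mu>) \<longlonglongrightarrow> R e \<mu>" if "\<mu> \<in> {\<mu>1..\<mu>2}" "e \<le> 1" for \<mu> e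
    unfolding Q_def R_def using that
    by (intro tendsto_approx_sum[OF assms(1), of _ \<mu>2]) (auto simp: filterlim_Suc)
  have "R 1 \<mu>1 / R 0 \<mu>1 \<le> R 1 \<mu>2 / R 0 \<mu>2"
  proof (rule tendsto_le[OF sequentially_bot])
    show "(\<lambda>k. Q (Suc k) 1 \<mu>1 / Q (Suc k) 0 \<mu>1) \<longlonglongrightarrow> R 1 \<mu>1 / R 0 \<mu>1"
      "(\<lambda>k. Q (Suc k) 1 \<mu>2 / Q (Suc k) 0 \<mu>2) \<longlonglongrightarrow> R 1 \<mu>2 / R 0 \<mu>2"
      using assms(2) nz by (auto intro!: tendsto_divide lim simp flip: R0)
    have "eventually (\<lambda>k. \<forall>\<mu>\<in>{\<mu>1..\<mu>2}. Q (Suc k) 0 \<mu> \<noteq> 0) sequentially"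
      using ev by (subst eventually_sequentially_Suc)
    then show "eventually (\<lambda>k. Q (Suc k) 1 \<mu>1 / Q (Suc k) 0 \<mu>1 \<le> Q (Suc k) 1 \<mu>2 / Q (Suc k) 0 \<mu>2) sequentially"
    proof eventually_elim
      case (elim k)
      then show ?case
        unfolding Q_def by (intro approx_sum_log_deriv_mono assms) auto
    qed
  qed
  then show ?thesis using R0 R1 assms(2) by simp
qed

section \<open>Comparison of the series for two orders\<close>

lemma cross_fun_differentiable:
  "0 < b \<Longrightarrow> 0 < c \<Longrightarrow> (cross_fun b c has_real_derivative deriv (cross_fun b c) x) (at x)"
  by (metis DERIV_imp_deriv cross_fun_deriv)

text \<open>The inequality between the logarithmic derivatives is integrated from 0, where both
  functions equal 1.\<close>

lemma cross_fun_mono_aux: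
  assumes "- 1 < \<mu>1" "\<mu>1 \<le> \<mu>2" "0 \<le> x"
    and pos: "\<And>\<mu> t. \<mu> \<in> {\<mu>1..\<mu>2} \<Longrightarrow> t \<in> {0..x} \<Longrightarrow> 0 < cross_fun (\<mu> + 1) (\<mu> + 2) t"
  shows "cross_fun (\<mu>1 + 1) (\<mu>1 + 2) x \<le> cross_fun (\<mu>2 + 1) (\<mu>2 + 2) x"
proof -
  define F where "F \<mu> = cross_fun (\<mu> + 1) (\<mu> + 2)" for \<mu>
  define g where "g t = ln (F \<mu>2 t) - ln (F \<mu>1 t)" for t
  have F: "(F \<mu> has_real_derivative deriv (F \<mu>) t) (at t)" if "\<mu> \<in> {\<mu>1..\<mu>2}" for \<mu> t
    unfolding F_def using that assms(1) by (intro cross_fun_differentiable) auto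
  have Fpos: "0 < F \<mu> t" if "\<mu> \<in> {\<mu>1..\<mu>2}" "t \<in> {0..x}" for \<mu> t
    unfolding F_def by (rule pos[OF that])
  have \<mu>: "\<mu>1 \<in> {\<mu>1..\<mu>2}" "\<mu>2 \<in> {\<mu>1..\<mu>2}" using assms(2) by auto
  have g: "(g has_real_derivative deriv (F \<mu>2) t / F \<mu>2 t - deriv (F \<mu>1) t / F \<mu>1 t) (at t)" if "t \<in> {0..x}" for t
    unfolding g_def[abs_def]
    using DERIV_diff[OF DERIV_chain2[OF DERIV_ln[OF Fpos[OF \<mu>(2) that]] F[OF \<mu>(2)]]
        DERIV_chain2[OF DERIV_ln[OF Fpos[OF \<mu>(1) that]] F[OF \<mu>(1)]]]
    by (simp add: field_simps)
  have "g 0 \<le> g x"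
  proof (rule DERIV_nonneg_imp_increasing_open[OF assms(3)])
    show "continuous_on {0..x} g"
      by (intro continuous_at_imp_continuous_on ballI DERIV_isCont[OF g])
    fix t assume t: "0 < t" "t < x"
    have "t * deriv (F \<mu>1) t / F \<mu>1 t \<le> t * deriv (F \<mu>2) t / F \<mu>2 t"
      unfolding F_def using t pos[of _ t] by (intro cross_fun_log_deriv_mono assms) (auto simp: less_imp_neq[THEN not_sym])
    then have "t * (deriv (F \<mu>1) t / F \<mu>1 t) \<le> t * (deriv (F \<mu>2) t / F \<mu>2 t)" by simp
    then have "deriv (F \<mu>1) t / F \<mu>1 t \<le> deriv (F \<mu>2) t / F \<mu>2 t" using t by (simp only: mult_le_cancel_left_pos)
    then show "\<exists>y. (g has_real_derivative y) (at t) \<and> 0 \<le> y"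
      using g[of t] t by (intro exI conjI) auto
  qed
  then have "ln (F \<mu>1 x) \<le> ln (F \<mu>2 x)" by (simp add: g_def F_def cross_fun_0)
  then show ?thesis using Fpos[of \<mu>1 x] Fpos[of \<mu>2 x] \<mu> assms(3) by (simp add: F_def)
qed

theorem cross_fun_mono:
  assumes "- 1 < \<mu>1" "\<mu>1 \<le> \<mu>2" "0 \<le> x"
    and pos: "\<And>t. t \<in> {0..x} \<Longrightarrow> 0 < cross_fun (\<mu>1 + 1) (\<mu>1 + 2) t"
  shows "cross_fun (\<mu>1 + 1) (\<mu>1 + 2) x \<le> cross_fun (\<mu>2 + 1) (\<mu>2 + 2) x"
proof (rule cross_fun_mono_aux[OF assms(1-3)], rule ccontr)
  define F where "F \<mu> = cross_fun (\<mu> + 1) (\<mu> + 2)" for \<mu>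
  fix \<mu>0 t0
  assume 0: "\<mu>0 \<in> {\<mu>1..\<mu>2}" "t0 \<in> {0..x}" "\<not> 0 < cross_fun (\<mu>0 + 1) (\<mu>0 + 2) t0"
  \<comment> \<open>Up to the smallest parameter \<open>\<mu>\<close> with a zero on \<open>[0, x]\<close> the function only increases, so no zero can appear.\<close>
  define Z where "Z = {p \<in> {\<mu>1..\<mu>2} \<times> {0..x}. F (fst p) (snd p) \<le> 0}"
  have cont: "continuous_on ({\<mu>1..\<mu>2} \<times> {0..x}) (\<lambda>p. F (fst p) (snd p))"
    unfolding continuous_on_sequentially
  proof (intro allI ballI impI, elim conjE)
    fix u p assume u: "\<forall>n. u n \<in> {\<mu>1..\<mu>2} \<times> {0..x}" "u \<longlonglongrightarrow> p"
    then have "(\<lambda>n. fst (u n)) \<longlonglongrightarrow> fst p" "(\<lambda>n. snd (u n)) \<longlonglongrightarrow> snd p"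
      by (auto intro: tendsto_fst tendsto_snd)
    moreover have "\<mu>1 \<le> fst (u n)" for n using u(1) by (metis atLeastAtMost_iff mem_Times_iff)
    ultimately show "((\<lambda>p. F (fst p) (snd p)) \<circ> u) \<longlonglongrightarrow> F (fst p) (snd p)"
      unfolding F_def o_def by (intro tendsto_cross_fun[OF assms(1)])
  qed
  have "compact Z"
  proof -
    have "closed Z"
      using continuous_closed_preimage[OF cont _ closed_atMost[of 0]]
      by (simp add: Z_def closed_Times vimage_def Int_def)
    moreover have "Z = ({\<mu>1..\<mu>2} \<times> {0..x}) \<inter> Z" by (auto simp: Z_def)
    ultimately show ?thesis
      by (metis compact_Icc compact_Int_closed compact_Times)
  qed
  moreover have "(\<mu>0, t0) \<in> Z" using 0 by (auto simp: Z_def F_def)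
  then have "Z \<noteq> {}" by blast
  moreover have "continuous_on Z fst" by (intro continuous_intros)
  ultimately obtain p where p: "p \<in> Z" "\<And>q. q \<in> Z \<Longrightarrow> fst p \<le> fst q"
    using continuous_attains_inf by metis
  define \<mu> where "\<mu> = fst p"
  define t where "t = snd p"
  have \<mu>t: "\<mu> \<in> {\<mu>1..\<mu>2}" "t \<in> {0..x}" "F \<mu> t \<le> 0" using p(1) by (auto simp: Z_def \<mu>_def t_def)
  have F1: "0 < F \<mu>1 t" unfolding F_def by (rule pos[OF \<mu>t(2)])
  have "\<mu>1 < \<mu>" using \<mu>t F1 by (cases "\<mu> = \<mu>1") auto
  have le: "F \<mu>1 t \<le> F \<nu> t" if "\<mu>1 \<le> \<nu>" "\<nu> < \<mu>" for \<nu>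
    unfolding F_def
  proof (rule cross_fun_mono_aux[OF assms(1) that(1)])
    fix \<kappa> r assume *: "\<kappa> \<in> {\<mu>1..\<nu>}" "r \<in> {0..t}"
    have "(\<kappa>, r) \<notin> Z" using p(2)[of "(\<kappa>, r)"] * that by (auto simp: \<mu>_def)
    then show "0 < cross_fun (\<kappa> + 1) (\<kappa> + 2) r"
      using * that \<mu>t by (auto simp: Z_def F_def)
  qed (use \<mu>t in auto)
  \<comment> \<open>Orders approaching \<mu> from below, starting at u 0 = \<mu>1: the comparison is
    available only strictly below the minimal \<mu>, and continuity carries it to \<mu>.\<close>
  define u where "u k = \<mu> - (\<mu> - \<mu>1) * inverse (real (Suc k))" for k
  have "u \<longlonglongrightarrow> \<mu> - (\<mu> - \<mu>1) * 0"
    unfolding u_def by (intro tendsto_intros LIMSEQ_inverse_real_of_nat)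
  moreover have u: "\<mu>1 \<le> u k" "u k < \<mu>" for k
  proof -
    have "inverse (real (Suc k)) \<le> 1" "0 < inverse (real (Suc k))" by (auto simp: field_simps)
    then have "(\<mu> - \<mu>1) * inverse (real (Suc k)) \<le> (\<mu> - \<mu>1) * 1" "0 < (\<mu> - \<mu>1) * inverse (real (Suc k))"
      using \<open>\<mu>1 < \<mu>\<close> by (auto simp del: of_nat_Suc intro!: mult_left_mono mult_pos_pos)
    then show "\<mu>1 \<le> u k" "u k < \<mu>" by (simp_all add: u_def del: of_nat_Suc)
  qed
  ultimately have "(\<lambda>k. F (u k) t) \<longlonglongrightarrow> F \<mu> t"
    unfolding F_def by (intro tendsto_cross_fun[OF assms(1)]) auto
  then have "F \<mu>1 t \<le> F \<mu> t"
    by (rule LIMSEQ_le_const) (use le u in auto)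
  with F1 \<mu>t show False by simp
qed

section \<open>Zeros, signs and concavity\<close>

text \<open>The sum of the reciprocal zeros is - F'(0), which the power series shows to be the first
  coefficient.\<close>

lemma cross_fun_zero_product:
  assumes "0 < b" "0 < c"
  shows "\<exists>a. zero_product a (cross_fun b c) \<and> suminf a = cross_coeff b c 1"
proof -
  obtain a where a: "decseq a" "\<And>i::nat. 0 < a i" "summable a"
    "\<And>x. (\<lambda>n. \<Prod>i<n. 1 - a i * x) \<longlonglongrightarrow> cross_fun b c x"
    using cross_fun_product[OF assms] by blast
  interpret zero_product a "cross_fun b c"
    using a cross_fun_deriv[OF assms] by unfold_locales (auto simp: field_differentiable_def)
  have "(cross_fun b c has_real_derivative - cross_coeff b c 1) (at 0)"
    using cross_fun_deriv[OF assms, of 0] unfolding powser_zero by (simp add: diffs_def)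
  moreover have "(cross_fun b c has_real_derivative - S 1 0) (at 0)"
    using F_deriv[of 0] F_0 by simp
  ultimately have "suminf a = cross_coeff b c 1"
    using DERIV_unique sum_a by fastforce
  then show ?thesis using zero_product_axioms by blast
qed

lemma cross_fun_simple_zeros:
  assumes "0 < b" "0 < c" "0 < x" "cross_fun b c x = 0"
  shows "deriv (cross_fun b c) x \<noteq> 0"
proof
  assume "deriv (cross_fun b c) x = 0"
  have double: "cross_fun (b + real k) c x = 0 \<and> deriv (cross_fun (b + real k) c) x = 0" for k
  proof (induction k)
    case 0
    show ?case using assms(4) \<open>deriv (cross_fun b c) x = 0\<close> by simp
  next
    case (Suc k)
    define B where "B = b + real k"
    have B: "0 < B" "0 < B + 1" using assms(1) by (auto simp: B_def)
    obtain a where "zero_product a (cross_fun (B + 1) c)"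
      using cross_fun_zero_product[OF B(2) assms(2)] by blast
    then interpret zero_product a "cross_fun (B + 1) c" .
    have shift: "cross_fun B c = (\<lambda>y. cross_fun (B + 1) c y + y * deriv (cross_fun (B + 1) c) y / B)"
      by (rule ext) (rule cross_fun_shift[OF B(1) assms(2)])
    have "cross_fun B c x = 0" "(cross_fun B c has_real_derivative 0) (at x)"
      using Suc cross_fun_differentiable[OF B(1) assms(2), of x] by (simp_all add: B_def)
    then have "cross_fun (B + 1) c x = 0 \<and> deriv (cross_fun (B + 1) c) x = 0"
      by (intro double_zero_shift[OF B(1) assms(3)]) (simp_all only: shift)
    then show ?case by (simp add: B_def add_ac)
  qed
  \<comment> \<open>For this K the sum of the reciprocal zeros, 1/((b + K) c (c + 1)), is below 1/x,
    although the zero x makes 1/x one of its summands.\<close>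
  define K where "K = nat \<lceil>x / (c * (c + 1))\<rceil> + 1"
  have K: "x / (c * (c + 1)) < real K" unfolding K_def by linarith
  have "0 < b + real K" using assms(1) by simp
  then obtain a where a: "zero_product a (cross_fun (b + real K) c)" "suminf a = cross_coeff (b + real K) c 1"
    using cross_fun_zero_product assms(2) by blast
  interpret zero_product a "cross_fun (b + real K) c" by (rule a)
  obtain i where i: "a i * x = 1"
    using F_zero_iff[of x] double[of K] by (auto simp: regular_def)
  have "(\<Sum>i\<in>{i}. a i) \<le> suminf a"
    using pos by (intro sum_le_suminf summ) (auto simp: less_imp_le)
  then have "a i \<le> 1 / ((b + real K) * (c * (c + 1)))"
    unfolding a(2) by (simp add: cross_coeff_def pochhammer_Suc numeral_2_eq_2)
  then have "1 \<le> 1 / ((b + real K) * (c * (c + 1))) * x"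
    using mult_right_mono[of "a i" _ x] assms(3) i by fastforce
  moreover have "0 < (b + real K) * (c * (c + 1))" using assms(1,2) by simp
  ultimately have "(b + real K) * (c * (c + 1)) \<le> x"
    by (simp only: times_divide_eq_left mult_1 le_divide_eq_1_pos)
  moreover have "x < real K * (c * (c + 1))"
    using K assms(2) by (simp add: pos_divide_less_eq)
  moreover have "0 < b * (c * (c + 1))" using assms by simp
  ultimately show False unfolding distrib_right[of b] by linarith
qed

locale bessel_zeros =
  fixes \<nu> :: real and a :: "nat \<Rightarrow> real"
  assumes nu: "- 1 < \<nu>" and product: "zero_product a (cross_fun (\<nu> + 1) (\<nu> + 2))"
begin

sublocale zero_product a "cross_fun (\<nu> + 1) (\<nu> + 2)"
  by (rule product)

abbreviation F :: "real \<Rightarrow> real" where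
  "F \<equiv> cross_fun (\<nu> + 1) (\<nu> + 2)"

abbreviation W :: "real \<Rightarrow> real" where
  "W \<equiv> norm_bessel_cross \<nu>"

text \<open>The positive solution of a n x^4/16 = 1. The index starts at 0, so \<open>gam n\<close>
  is the zero number n + 1.\<close>

definition gam :: "nat \<Rightarrow> real" where
  "gam n = root 4 (16 / a n)"

lemma W_eq: "W x = F (x ^ 4 / 16)"
  by (rule norm_bessel_cross_eq[OF nu])

lemma W_abs: "W \<bar>x\<bar> = W x"
  by (simp add: W_eq)

text \<open>Equal entries would make 1 / a i a double zero of F, which
  \<open>cross_fun_simple_zeros\<close> excludes.\<close>

lemma strict_a: "i < j \<Longrightarrow> a j < a i"
proof -
  assume "i < j"
  have "F (1 / a i) = 0" using pos[of i] by (auto simp: F_zero_iff regular_def)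
  then have "deriv F (1 / a i) \<noteq> 0"
    using nu pos[of i] by (intro cross_fun_simple_zeros) auto
  then have "a i \<noteq> a j"
    using double_zero[of i j] \<open>i < j\<close> DERIV_imp_deriv by blast
  moreover have "a j \<le> a i" using dec \<open>i < j\<close> by (simp add: decseq_def)
  ultimately show "a j < a i" by simp
qed

section \<open>The positive zeros and their enumeration\<close>

lemma gam_pos: "0 < gam n"
  using pos[of n] by (simp add: gam_def)

lemma gam_pow: "gam n ^ 4 = 16 / a n"
  unfolding gam_def using pos[of n] by (intro real_root_pow_pos2) auto

lemma power4_less_iff: "0 \<le> u \<Longrightarrow> 0 \<le> v \<Longrightarrow> u < v \<longleftrightarrow> u ^ 4 < (v :: real) ^ 4"
  using power_mono_iff[of v u 4] by linarith

lemma gam_less_iff: "0 \<le> x \<Longrightarrow> gam n < x \<longleftrightarrow> 1 < a n * (x ^ 4 / 16)"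
proof -
  assume "0 \<le> x"
  have "gam n < x \<longleftrightarrow> gam n ^ 4 < x ^ 4"
    using \<open>0 \<le> x\<close> gam_pos[of n] by (intro power4_less_iff) auto
  also have "\<dots> \<longleftrightarrow> 1 < a n * (x ^ 4 / 16)"
    unfolding gam_pow using pos[of n] by (simp add: field_simps)
  finally show ?thesis .
qed

lemma less_gam_iff: "0 \<le> x \<Longrightarrow> x < gam n \<longleftrightarrow> a n * (x ^ 4 / 16) < 1"
proof -
  assume "0 \<le> x"
  have "x < gam n \<longleftrightarrow> x ^ 4 < gam n ^ 4"
    using \<open>0 \<le> x\<close> gam_pos[of n] by (intro power4_less_iff) auto
  also have "\<dots> \<longleftrightarrow> a n * (x ^ 4 / 16) < 1"
    unfolding gam_pow using pos[of n] by (simp add: field_simps)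
  finally show ?thesis .
qed

lemma gam_strict_mono: "strict_mono gam"
  unfolding strict_mono_def gam_def using strict_a pos
  by (auto intro!: divide_strict_left_mono mult_pos_pos)

lemma gam_le: "gam i \<le> gam j \<longleftrightarrow> i \<le> j"
  using gam_strict_mono by (rule strict_mono_less_eq)

lemma W_zero_iff: "0 \<le> x \<Longrightarrow> W x = 0 \<longleftrightarrow> (\<exists>n. x = gam n)"
proof -
  assume x: "0 \<le> x"
  have "a n * (x ^ 4 / 16) = 1 \<longleftrightarrow> x = gam n" for n
    using gam_less_iff[OF x, of n] less_gam_iff[OF x, of n] by linarith
  then show ?thesis by (simp add: W_eq F_zero_iff regular_def)
qed

lemma bessel_cross_zero_iff: "0 < x \<Longrightarrow> bessel_cross \<nu> x = 0 \<longleftrightarrow> (\<exists>n. x = gam n)"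
  using bessel_cross_norm[OF nu] W_zero_iff[of x]
  by (metis less_imp_le less_irrefl mult_eq_0_iff powr_gt_zero)

text \<open>Exactly m + 1 zeros lie in (0, \<open>gam m\<close>], so the count determines the zero;
  this gives both existence and uniqueness for the definite description.\<close>

lemma bessel_cross_zero_eq: "bessel_cross_zero \<nu> (Suc n) = gam n"
proof -
  have card: "card {y \<in> {0<..gam m}. bessel_cross \<nu> y = 0} = Suc m" for m
  proof -
    have "{y \<in> {0<..gam m}. bessel_cross \<nu> y = 0} = gam ` {..m}"
      using bessel_cross_zero_iff gam_pos gam_le by auto
    then show ?thesis
      using card_image[of gam "{..m}"] strict_mono_imp_inj_on[OF gam_strict_mono] by (simp add: inj_on_subset)
  qed
  show ?thesis
    unfolding bessel_cross_zero_def
  proof (rule the_equality)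
    show "0 < gam n \<and> bessel_cross \<nu> (gam n) = 0 \<and> card {y \<in> {0<..gam n}. bessel_cross \<nu> y = 0} = Suc n"
      using gam_pos[of n] bessel_cross_zero_iff[of "gam n"] card by auto
    fix x assume x: "0 < x \<and> bessel_cross \<nu> x = 0 \<and> card {y \<in> {0<..x}. bessel_cross \<nu> y = 0} = Suc n"
    then obtain m where m: "x = gam m" using bessel_cross_zero_iff by blast
    then have "m = n" using x card[of m] by simp
    with m show "x = gam n" by simp
  qed
qed

lemma bessel_cross_zero_1: "bessel_cross_zero \<nu> 1 = gam 0"
  using bessel_cross_zero_eq[of 0] by simp

text \<open>Index shift n = k + 1: the zeros numbered 2n - 1 and 2n are \<open>gam (2 * k)\<close>
  and \<open>gam (2 * k + 1)\<close>.\<close>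

lemma S2_iff: "x \<in> S2 \<nu> \<longleftrightarrow> (\<exists>k. gam (2 * k) \<le> x \<and> x \<le> gam (2 * k + 1))"
proof -
  have "bessel_cross_zero \<nu> (2 * Suc k - 1) = gam (2 * k)" "bessel_cross_zero \<nu> (2 * Suc k) = gam (2 * k + 1)" for k
    using bessel_cross_zero_eq[of "2 * k"] bessel_cross_zero_eq[of "2 * k + 1"] by simp_all
  moreover have "x \<in> S2 \<nu> \<longleftrightarrow> (\<exists>k. x \<in> {bessel_cross_zero \<nu> (2 * Suc k - 1)..bessel_cross_zero \<nu> (2 * Suc k)})"
    unfolding S2_def by (metis (no_types, lifting) UN_iff atLeast_iff le_add1 not0_implies_Suc not_one_le_zero plus_1_eq_Suc)
  ultimately show ?thesis by simp
qed

lemma S1_iff: "x \<in> S1 \<nu> \<longleftrightarrow> - x \<in> S2 \<nu>"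
  unfolding S1_def S2_def by force

lemma S2_pos: "x \<in> S2 \<nu> \<Longrightarrow> 0 < x"
  using S2_iff gam_pos by (meson less_le_trans)

lemma S12_iff: "x \<in> S1 \<nu> \<union> S2 \<nu> \<longleftrightarrow> \<bar>x\<bar> \<in> S2 \<nu>"
proof (cases "0 \<le> x")
  case True
  then have "- x \<notin> S2 \<nu>" using S2_pos[of "- x"] by auto
  with True show ?thesis by (simp add: S1_iff)
next
  case False
  then have "x \<notin> S2 \<nu>" using S2_pos[of x] by auto
  with False show ?thesis by (simp add: S1_iff)
qed

section \<open>Signs between the zeros\<close>

lemma W_sign:
  assumes "0 \<le> x" "\<And>i. i < m \<Longrightarrow> gam i < x" "\<And>i. m \<le> i \<Longrightarrow> x < gam i"
  shows "0 < (- 1) ^ m * W x"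
  unfolding W_eq by (rule sign) (use assms gam_less_iff less_gam_iff in auto)

lemma W_neg: "gam (2 * k) < x \<Longrightarrow> x < gam (2 * k + 1) \<Longrightarrow> W x < 0"
proof -
  assume x: "gam (2 * k) < x" "x < gam (2 * k + 1)"
  have "0 < (- 1) ^ (2 * k + 1) * W x"
  proof (rule W_sign)
    show "0 \<le> x" using x(1) gam_pos[of "2 * k"] by linarith
    show "gam i < x" if "i < 2 * k + 1" for i
      using gam_le[of i "2 * k"] x(1) that by simp
    show "x < gam i" if "2 * k + 1 \<le> i" for i
      using gam_le[of "2 * k + 1" i] x(2) that by simp
  qed
  then show "W x < 0" by simp
qed

text \<open>The number m of zeros below x is even, since m = 2k + 1 would place x between
  \<open>gam (2 * k)\<close> and \<open>gam (2 * k + 1)\<close>.\<close>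

lemma W_pos: "0 \<le> x \<Longrightarrow> x \<notin> S2 \<nu> \<Longrightarrow> 0 < W x"
proof -
  assume x: "0 \<le> x" "x \<notin> S2 \<nu>"
  have ne: "x \<noteq> gam i" for i
  proof
    assume "x = gam i"
    \<comment> \<open>Every zero is an endpoint of one of the closed intervals, the left one for
      even i and the right one for odd i.\<close>
    then have "gam (2 * (i div 2)) \<le> x" "x \<le> gam (2 * (i div 2) + 1)"
      by (auto simp: gam_le)
    with x(2) show False by (auto simp: S2_iff)
  qed
  have ex: "\<exists>i. x < gam i"
  proof -
    obtain n where "\<And>i. i \<ge> n \<Longrightarrow> a i * (x ^ 4 / 16) \<le> 1 / 2" using small_tail by blast
    from this[of n] have "a n * (x ^ 4 / 16) < 1" by simp
    then show ?thesis using less_gam_iff[OF x(1)] by blast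
  qed
  define m where "m = (LEAST i. x < gam i)"
  have m: "x < gam m" unfolding m_def by (rule LeastI_ex[OF ex])
  have less: "gam i < x" if "i < m" for i
    using not_less_Least[of i "\<lambda>i. x < gam i"] that ne[of i] by (auto simp: m_def)
  have sgn: "0 < (- 1) ^ m * W x"
  proof (rule W_sign[OF x(1) less])
    show "x < gam i" if "m \<le> i" for i using m gam_le[of m i] that by simp
  qed
  show "0 < W x"
  proof (cases "even m")
    case True
    with sgn show ?thesis by simp
  next
    case False
    then obtain k where k: "m = 2 * k + 1" by (rule oddE)
    then have "gam (2 * k) \<le> x" "x \<le> gam (2 * k + 1)" using less[of "2 * k"] m by auto
    with x(2) show ?thesis by (auto simp: S2_iff)
  qed
qed

lemma W_pos': "x \<notin> S1 \<nu> \<union> S2 \<nu> \<Longrightarrow> 0 < W x"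
  using W_pos[of "\<bar>x\<bar>"] S12_iff W_abs by auto

text \<open>The intervals are closed and their endpoints are zeros, so strict negativity can be
  claimed only away from the zeros.\<close>

lemma W_nonpos:
  assumes "x \<in> S1 \<nu> \<union> S2 \<nu>"
  shows "W x \<le> 0 \<and> ((\<forall>n\<ge>1. \<bar>x\<bar> \<noteq> bessel_cross_zero \<nu> n) \<longrightarrow> W x < 0)"
proof -
  obtain k where k: "gam (2 * k) \<le> \<bar>x\<bar>" "\<bar>x\<bar> \<le> gam (2 * k + 1)"
    using assms S12_iff S2_iff by blast
  show ?thesis
  proof (cases "\<exists>n. \<bar>x\<bar> = gam n")
    case True
    then obtain n where n: "\<bar>x\<bar> = gam n" by blast
    then have "W x = 0" using W_zero_iff[of "\<bar>x\<bar>"] W_abs[of x] by auto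
    moreover have "\<exists>n\<ge>1. \<bar>x\<bar> = bessel_cross_zero \<nu> n"
      using n bessel_cross_zero_eq[of n] by (intro exI[of _ "Suc n"]) simp
    ultimately show ?thesis by auto
  next
    case False
    then have "gam (2 * k) < \<bar>x\<bar>" "\<bar>x\<bar> < gam (2 * k + 1)"
      using k by (metis order.not_eq_order_implies_strict)+
    then show ?thesis using W_neg[of k "\<bar>x\<bar>"] W_abs[of x] by auto
  qed
qed

lemma F_pos: "0 \<le> x \<Longrightarrow> a 0 * x < 1 \<Longrightarrow> 0 < F x"
proof -
  assume x: "0 \<le> x" "a 0 * x < 1"
  have "a i * x < 1" for i
    using mult_right_mono[OF a_le[of i] x(1)] x(2) by linarith
  then show "0 < F x" using sign[of 0 x] by simp
qed

text \<open>Proved for F in the variable x^4/16: there the derivative - S 1 F is negative even at 0,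
  whereas W' vanishes at 0.\<close>

lemma W_antimono:
  assumes "0 \<le> x" "x < y" "y < gam 0"
  shows "W y < W x"
proof -
  have xy: "x ^ 4 / 16 < y ^ 4 / 16" using assms by (simp add: power_strict_mono)
  have y: "a 0 * (y ^ 4 / 16) < 1" using assms less_gam_iff[of y 0] by simp
  have z: "a 0 * z < 1" if "z \<le> y ^ 4 / 16" for z
    using y mult_left_mono[OF that, of "a 0"] pos[of 0] by linarith
  have "F (y ^ 4 / 16) < F (x ^ 4 / 16)"
  proof (rule DERIV_neg_imp_decreasing_open[OF xy])
    show "continuous_on {x ^ 4 / 16..y ^ 4 / 16} F"
      using diff by (intro continuous_at_imp_continuous_on) (auto intro: field_differentiable_imp_continuous_at)
    fix z assume "x ^ 4 / 16 < z" "z < y ^ 4 / 16"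
    moreover have "0 \<le> x ^ 4 / 16" by simp
    ultimately have "0 \<le> z" "a 0 * z < 1" using z[of z] by linarith+
    then have "0 < F z" "0 < S 1 z" using F_pos S_pos[of z 1] by auto
    then show "\<exists>d. (F has_real_derivative d) (at z) \<and> d < 0"
      using F_deriv[of z] by (intro exI[of _ "- S 1 z * F z"]) auto
  qed
  then show ?thesis by (simp add: W_eq)
qed

section \<open>Logarithmic derivative and concavity\<close>

lemma W_deriv:
  assumes "W z \<noteq> 0"
  shows "(W has_real_derivative - S 1 (z ^ 4 / 16) * (z ^ 3 / 4) * W z) (at z)"
proof -
  have "((\<lambda>z. z ^ 4 / 16) has_real_derivative z ^ 3 / 4) (at z)"
    by (auto intro!: derivative_eq_intros)
  moreover have "(F has_real_derivative - S 1 (z ^ 4 / 16) * F (z ^ 4 / 16)) (at (z ^ 4 / 16))"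
    using assms by (intro F_deriv) (simp add: W_eq)
  ultimately have "((\<lambda>z. F (z ^ 4 / 16)) has_real_derivative - S 1 (z ^ 4 / 16) * F (z ^ 4 / 16) * (z ^ 3 / 4)) (at z)"
    by (rule DERIV_chain2[rotated])
  then show ?thesis by (simp add: W_eq[abs_def] mult_ac)
qed

lemma ln_W_deriv:
  assumes "0 < W z"
  shows "((\<lambda>z. ln (W z)) has_real_derivative - (S 1 (z ^ 4 / 16) * (z ^ 3 / 4))) (at z)"
proof -
  have "inverse w * (- p * q * w) = - (p * q)" if "w \<noteq> 0" for w p q :: real
    using that by simp
  then show ?thesis
    using DERIV_chain2[OF DERIV_ln[OF assms] W_deriv[of z]] assms by (metis less_irrefl)
qed

text \<open>The function compared is - (ln W)' where W > 0. Its derivative is z^2/4 (3 S 1 + 4 X S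
  2) at X = z^4/16; as S 1 may be negative beyond the first zero, three copies of S 1 + X S 2 > 0
  are split off, which leaves X S 2 \<ge> 0.\<close>

lemma cubic_S_mono:
  assumes "x < y" "\<And>z. z \<in> {x..y} \<Longrightarrow> W z \<noteq> 0"
  shows "S 1 (x ^ 4 / 16) * (x ^ 3 / 4) < S 1 (y ^ 4 / 16) * (y ^ 3 / 4)"
proof -
  define g where "g z = S 1 (z ^ 4 / 16) * (z ^ 3 / 4)" for z
  have reg: "regular (z ^ 4 / 16)" if "z \<in> {x..y}" for z
    using assms(2)[OF that] F_zero_iff by (auto simp: W_eq)
  have deriv: "(g has_real_derivative z\<^sup>2 / 4 *
      (3 * (S 1 (z ^ 4 / 16) + z ^ 4 / 16 * S 2 (z ^ 4 / 16)) + z ^ 4 / 16 * S 2 (z ^ 4 / 16))) (at z)"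
    if z: "z \<in> {x..y}" for z
  proof -
    have "((\<lambda>z. z ^ 4 / 16) has_real_derivative z ^ 3 / 4) (at z)"
      by (auto intro!: derivative_eq_intros)
    moreover have "(S 1 has_real_derivative S 2 (z ^ 4 / 16)) (at (z ^ 4 / 16))"
      using S_deriv[OF reg[OF z], of 1] by (simp add: numeral_2_eq_2)
    ultimately have "((\<lambda>z. S 1 (z ^ 4 / 16)) has_real_derivative S 2 (z ^ 4 / 16) * (z ^ 3 / 4)) (at z)"
      by (rule DERIV_chain2[rotated])
    moreover have "((\<lambda>z. z ^ 3 / 4) has_real_derivative 3 * z\<^sup>2 / 4) (at z)"
      by (auto intro!: derivative_eq_intros)
    ultimately have "(g has_real_derivative
        S 2 (z ^ 4 / 16) * (z ^ 3 / 4) * (z ^ 3 / 4) + 3 * z\<^sup>2 / 4 * S 1 (z ^ 4 / 16)) (at z)"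
      unfolding g_def[abs_def] by (rule DERIV_mult)
    moreover have "q * (z ^ 3 / 4) * (z ^ 3 / 4) + 3 * z\<^sup>2 / 4 * p
        = z\<^sup>2 / 4 * (3 * (p + z ^ 4 / 16 * q) + z ^ 4 / 16 * q)" for p q
      by (simp add: field_simps eval_nat_numeral)
    ultimately show ?thesis by (simp only:)
  qed
  have cont: "continuous_on {u..v} g" if "{u..v} \<subseteq> {x..y}" for u v
    using that deriv by (intro continuous_at_imp_continuous_on ballI) (meson DERIV_isCont subsetD)
  \<comment> \<open>The derivative vanishes at z = 0, so an interval with 0 in its interior is cut
    there.\<close>
  have step: "g u < g v" if uv: "u < v" "{u..v} \<subseteq> {x..y}" "0 \<notin> {u<..<v}" for u v
  proof (rule DERIV_pos_imp_increasing_open[OF uv(1) _ cont[OF uv(2)]])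
    fix z assume z: "u < z" "z < v"
    then have nz: "z \<noteq> 0" and mem: "z \<in> {x..y}" using uv by auto
    define X where "X = z ^ 4 / 16"
    have "0 < X" using nz by (simp add: X_def zero_less_power_eq)
    then have p: "0 < X * S 2 X" "0 < S 1 X + X * S 2 X"
      using S_Laguerre[OF reg[OF mem]] S_2_pos[OF reg[OF mem]] by (auto simp: X_def)
    have "0 < 3 * (S 1 X + X * S 2 X) + X * S 2 X"
      by (rule add_pos_pos[OF mult_pos_pos[OF _ p(2)] p(1)]) simp
    then have "0 < z\<^sup>2 / 4 * (3 * (S 1 X + X * S 2 X) + X * S 2 X)" using nz by simp
    then show "\<exists>d. (g has_real_derivative d) (at z) \<and> 0 < d"
      using deriv[OF mem] unfolding X_def by blast
  qed
  have "g x < g y"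
  proof (cases "x < 0 \<and> 0 < y")
    case True
    then have "g x < g 0" "g 0 < g y" by (auto intro!: step)
    then show ?thesis by simp
  next
    case False
    then show ?thesis using assms(1) by (intro step) auto
  qed
  then show ?thesis by (simp add: g_def)
qed

lemma convex_Icc_subset: "convex K \<Longrightarrow> x \<in> K \<Longrightarrow> y \<in> K \<Longrightarrow> {x..y} \<subseteq> (K :: real set)"
  by (metis atLeastatMost_empty_iff2 closed_segment_eq_real_ivl closed_segment_subset empty_subsetI)

lemma W_log_concave: "strictly_log_concave_on (UNIV - (S1 \<nu> \<union> S2 \<nu>)) W"
  unfolding strictly_log_concave_on_def
proof (intro conjI ballI allI impI, goal_cases)
  case (1 x)
  then show ?case using W_pos' by blast
next
  case (2 K)
  then have K: "K \<subseteq> UNIV - (S1 \<nu> \<union> S2 \<nu>)" "convex K" by simp_all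
  then have pos: "0 < W z" if "z \<in> K" for z using W_pos' that by blast
  show "strictly_concave_on K (\<lambda>x. ln (W x))"
  proof (rule strictly_concave_on_deriv[OF K(2) ln_W_deriv[OF pos]])
    fix x y assume xy: "x \<in> K" "y \<in> K" "x < y"
    have "W z \<noteq> 0" if "z \<in> {x..y}" for z
      using convex_Icc_subset[OF K(2) xy(1,2)] that pos[of z] by auto
    then show "- (S 1 (y ^ 4 / 16) * (y ^ 3 / 4)) < - (S 1 (x ^ 4 / 16) * (x ^ 3 / 4))"
      using cubic_S_mono[OF xy(3)] by simp
  qed
qed

text \<open>In t = ln x, with X = exp (4t)/16, the first derivative of ln W is - 4 X S 1 X and the
  second is - 16 X (S 1 X + X S 2 X), so the Laguerre inequality is exactly what is
  required.\<close>

lemma W_geom_concave: "strictly_geom_concave_on ({0<..} - S2 \<nu>) W"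
  unfolding strictly_geom_concave_on_def
proof (intro conjI ballI allI impI, blast, goal_cases)
  case (1 x)
  then show ?case using W_pos[of x] by auto
next
  case (2 K)
  then have pos: "0 < W (exp t)" if "t \<in> K" for t
    using W_pos[of "exp t"] that by auto
  have X: "((\<lambda>t. exp t ^ 4 / 16) has_real_derivative 4 * (exp t ^ 4 / 16)) (at t)" for t :: real
    by (auto intro!: derivative_eq_intros simp: eval_nat_numeral)
  have reg: "regular (exp t ^ 4 / 16)" if "t \<in> K" for t
    using pos[OF that] F_zero_iff[of "exp t ^ 4 / 16"] by (auto simp: W_eq)
  define g where "g t = 4 * (exp t ^ 4 / 16 * S 1 (exp t ^ 4 / 16))" for t
  show ?case
  proof (rule strictly_concave_on_deriv)
    show "convex K" using 2 by blast
    show "((\<lambda>t. ln (W (exp t))) has_real_derivative - g t) (at t)" if "t \<in> K" for t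
    proof -
      have "((\<lambda>t. ln (W (exp t))) has_real_derivative - (S 1 (exp t ^ 4 / 16) * (exp t ^ 3 / 4)) * exp t) (at t)"
        by (rule DERIV_chain2[OF ln_W_deriv[OF pos[OF that]] DERIV_exp])
      then show ?thesis by (simp add: g_def eval_nat_numeral mult_ac)
    qed
    fix x y assume xy: "x \<in> K" "y \<in> K" "x < y"
    have "g x < g y"
    proof (rule DERIV_pos_imp_increasing[OF xy(3)])
      fix t assume "x \<le> t" "t \<le> y"
      then have t: "t \<in> K" using convex_Icc_subset[of K x y] 2 xy by auto
      define Y where "Y = exp t ^ 4 / 16"
      have "(S 1 has_real_derivative S 2 Y) (at (exp t ^ 4 / 16))"
        using S_deriv[OF reg[OF t], of 1] by (simp add: Y_def numeral_2_eq_2)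
      from DERIV_cmult[OF DERIV_mult[OF X DERIV_chain2[OF this X]], of 4]
      have "(g has_real_derivative 4 * (4 * Y * S 1 Y + S 2 Y * (4 * Y) * Y)) (at t)"
        unfolding g_def[abs_def] Y_def .
      moreover have "4 * (4 * Y * S 1 Y + S 2 Y * (4 * Y) * Y) = 16 * Y * (S 1 Y + Y * S 2 Y)"
        by (simp add: algebra_simps)
      moreover have "0 < 16 * Y * (S 1 Y + Y * S 2 Y)"
        using S_Laguerre[OF reg[OF t]] by (simp add: Y_def)
      ultimately show "\<exists>d. (g has_real_derivative d) (at t) \<and> 0 < d" by metis
    qed
    then show "- g y < - g x" by simp
  qed
qed

text \<open>The power of x adds (2\<nu> + 1) ln x to ln W, which is concave for \<nu> \<ge> - 1/2;
  strictness comes from W.\<close>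

lemma bessel_cross_log_concave:
  assumes "- 1 / 2 \<le> \<nu>"
  shows "strictly_log_concave_on ({0<..} - S2 \<nu>) (bessel_cross \<nu>)"
proof -
  obtain k where k: "0 < k" "\<And>x. 0 < x \<Longrightarrow> bessel_cross \<nu> x = k * x powr (2 * \<nu> + 1) * W x"
    using bessel_cross_norm[OF nu] by blast
  have Wp: "0 < W x" if "x \<in> {0<..} - S2 \<nu>" for x
    using W_pos[of x] that by auto
  have ln_eq: "ln (bessel_cross \<nu> x) = ln k + (2 * \<nu> + 1) * ln x + ln (W x)" if "0 < x" "0 < W x" for x
    using k that by (simp add: ln_mult ln_powr)
  \<comment> \<open>Open, so that the formula for the logarithm holds near each point of K and can
    be differentiated there.\<close>
  define A where "A = {x. 0 < x} \<inter> {x. 0 < W x}"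
  have "continuous_on UNIV F"
    using diff by (intro continuous_at_imp_continuous_on) (auto intro: field_differentiable_imp_continuous_at)
  then have contW: "continuous_on UNIV W"
    unfolding W_eq[abs_def] by (rule continuous_on_compose2) (auto intro!: continuous_intros)
  then have "open A"
    unfolding A_def by (intro open_Int open_Collect_less continuous_intros)
  show ?thesis
    unfolding strictly_log_concave_on_def
  proof (intro conjI ballI allI impI, goal_cases)
    case (1 x)
    then show ?case using k(1) k(2)[of x] Wp[OF 1] by simp
  next
    case (2 K)
    have KA: "x \<in> A" if "x \<in> K" for x using 2 that Wp by (auto simp: A_def)
    show ?case
    proof (rule strictly_concave_on_deriv)
      show "convex K" using 2 by blast
      fix x assume "x \<in> K"
      then have x: "x \<in> A" by (rule KA)
      then have "((\<lambda>x. ln k + (2 * \<nu> + 1) * ln x + ln (W x)) has_real_derivative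
          0 + (2 * \<nu> + 1) * (1 / x) + - (S 1 (x ^ 4 / 16) * (x ^ 3 / 4))) (at x)"
        by (intro DERIV_add DERIV_const DERIV_cmult ln_W_deriv) (auto simp: A_def intro!: derivative_eq_intros)
      then show "((\<lambda>x. ln (bessel_cross \<nu> x)) has_real_derivative
          (2 * \<nu> + 1) / x - S 1 (x ^ 4 / 16) * (x ^ 3 / 4)) (at x)"
        using has_field_derivative_transform_within_open[OF _ \<open>open A\<close> x]
        by (auto simp: A_def ln_eq)
    next
      fix x y assume xy: "x \<in> K" "y \<in> K" "x < y"
      have "W z \<noteq> 0" if "z \<in> {x..y}" for z
        using convex_Icc_subset[of K x y] 2 xy that KA[of z] by (auto simp: A_def)
      then have "S 1 (x ^ 4 / 16) * (x ^ 3 / 4) < S 1 (y ^ 4 / 16) * (y ^ 3 / 4)"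
        by (rule cubic_S_mono[OF xy(3)])
      moreover have "(2 * \<nu> + 1) / y \<le> (2 * \<nu> + 1) / x"
        using assms xy KA[of x] by (intro divide_left_mono) (auto simp: A_def)
      ultimately show "(2 * \<nu> + 1) / y - S 1 (y ^ 4 / 16) * (y ^ 3 / 4)
          < (2 * \<nu> + 1) / x - S 1 (x ^ 4 / 16) * (x ^ 3 / 4)"
        by linarith
    qed
  qed
qed

text \<open>The fourth root turns W into F (x/16). Below its first zero all sums S k with k \<ge> 1
  are positive, and the derivative of T k is k T (k + 1), so derivatives of every order of T 1 = (-
  ln F (x/16))' are nonnegative.\<close>

lemma absolutely_monotonic:
  shows "absolutely_monotonic_on {0<..<gam 0 ^ 4} (deriv (\<lambda>x. - ln (W (root 4 x))))"
    and "absolutely_monotonic_on {0<..<gam 0 ^ 4} (\<lambda>x. 1 / W (root 4 x))"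
proof -
  define A where "A = {0<..<gam 0 ^ 4}"
  have "open A" by (simp add: A_def)
  have A: "0 < x / 16" "a 0 * (x / 16) < 1" if "x \<in> A" for x
    using that pos[of 0] by (auto simp: A_def gam_pow field_simps)
  have reg: "regular (x / 16)" and Fp: "0 < F (x / 16)" if "x \<in> A" for x
    using F_pos[of "x / 16"] A[OF that] F_zero_iff[of "x / 16"] by auto
  have W_root: "W (root 4 x) = F (x / 16)" if "0 < x" for x
    using that by (simp add: W_eq)
  define T where "T k x = S k (x / 16) / 16 ^ k" for k x
  have T_deriv: "(T k has_real_derivative real k * T (Suc k) x) (at x)" if "x \<in> A" "1 \<le> k" for k x
  proof -
    have "((\<lambda>x. x / 16) has_real_derivative 1 / 16) (at x)"
      by (auto intro!: derivative_eq_intros)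
    from DERIV_cdivide[OF DERIV_chain2[OF S_deriv[OF reg[OF that(1)] that(2)] this], of "16 ^ k"]
    show ?thesis by (simp add: T_def[abs_def] field_simps)
  qed
  have T_nonneg: "0 \<le> T k x" if "x \<in> A" "1 \<le> k" for k x
    using S_pos[OF A(2)[OF that(1)] that(2)] by (simp add: T_def)
  have T: "nonneg_derivs m A (T k)" if "1 \<le> k" for m k
    using that
  proof (induction m arbitrary: k)
    case (Suc m)
    show ?case
    proof (rule nonneg_derivs_SucI[OF \<open>open A\<close>])
      show "nonneg_derivs m A (\<lambda>x. real k * T (Suc k) x)"
        by (intro nonneg_derivs_mult[OF \<open>open A\<close>] nonneg_derivs_const Suc.IH) auto
    qed (use T_deriv T_nonneg Suc.prems in auto)
  qed (use T_nonneg in auto)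
  have F16: "((\<lambda>x. F (x / 16)) has_real_derivative - T 1 x * F (x / 16)) (at x)" if "x \<in> A" for x
  proof -
    have "((\<lambda>x. x / 16) has_real_derivative 1 / 16) (at x)"
      by (auto intro!: derivative_eq_intros)
    from DERIV_chain2[OF F_deriv this] Fp[OF that] show ?thesis by (simp add: T_def mult_ac)
  qed
  have "deriv (\<lambda>x. - ln (W (root 4 x))) x = T 1 x" if x: "x \<in> A" for x
  proof (rule DERIV_imp_deriv)
    have "((\<lambda>x. - ln (F (x / 16))) has_real_derivative - (inverse (F (x / 16)) * (- T 1 x * F (x / 16)))) (at x)"
      by (rule DERIV_minus[OF DERIV_chain2[OF DERIV_ln[OF Fp[OF x]] F16[OF x]]])
    moreover have "- (inverse w * (- p * w)) = p" if "0 < w" for w p :: real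
      using that by simp
    ultimately have "((\<lambda>x. - ln (F (x / 16))) has_real_derivative T 1 x) (at x)"
      using Fp[OF x] by metis
    then show "((\<lambda>x. - ln (W (root 4 x))) has_real_derivative T 1 x) (at x)"
      by (rule has_field_derivative_transform_within_open[OF _ \<open>open A\<close> x]) (simp add: A_def W_root)
  qed
  then have "nonneg_derivs m A (deriv (\<lambda>x. - ln (W (root 4 x))))" for m
    by (intro nonneg_derivs_cong[OF \<open>open A\<close> _ T]) auto
  then show "absolutely_monotonic_on {0<..<gam 0 ^ 4} (deriv (\<lambda>x. - ln (W (root 4 x))))"
    unfolding A_def[symmetric] by (rule absolutely_monotonic_onI)
  \<comment> \<open>The derivative of 1/F (x/16) is 1/F (x/16) times T 1, so order m yields order m
    + 1 through closure under products.\<close>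
  have H: "nonneg_derivs m A (\<lambda>x. 1 / F (x / 16))" for m
  proof (induction m)
    case 0
    then show ?case using Fp by (auto simp: less_imp_le)
  next
    case (Suc m)
    show ?case
    proof (rule nonneg_derivs_SucI[OF \<open>open A\<close>])
      show "nonneg_derivs m A (\<lambda>x. 1 / F (x / 16) * T 1 x)"
        by (intro nonneg_derivs_mult[OF \<open>open A\<close>] Suc.IH T) simp
      fix x assume x: "x \<in> A"
      show "0 \<le> 1 / F (x / 16)" using Fp[OF x] by simp
      have "((\<lambda>x. 1 / F (x / 16)) has_real_derivative
          (0 * F (x / 16) - 1 * (- T 1 x * F (x / 16))) / (F (x / 16) * F (x / 16))) (at x)"
        using Fp[OF x] by (intro DERIV_divide DERIV_const F16[OF x]) auto
      then show "((\<lambda>x. 1 / F (x / 16)) has_real_derivative 1 / F (x / 16) * T 1 x) (at x)"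
        using Fp[OF x] by simp
    qed
  qed
  have "nonneg_derivs m A (\<lambda>x. 1 / W (root 4 x))" for m
    by (rule nonneg_derivs_cong[OF \<open>open A\<close> _ H]) (simp add: A_def W_root)
  then show "absolutely_monotonic_on {0<..<gam 0 ^ 4} (\<lambda>x. 1 / W (root 4 x))"
    unfolding A_def[symmetric] by (rule absolutely_monotonic_onI)
qed

end

lemma bessel_zeros_exist: "- 1 < \<nu> \<Longrightarrow> \<exists>a. bessel_zeros \<nu> a"
  using cross_fun_zero_product[of "\<nu> + 1" "\<nu> + 2"] by (auto simp: bessel_zeros_def)

text \<open>The first zero for the smaller order limits x, which supplies the positivity at \<mu>1
  that \<open>cross_fun_mono\<close> asks for.\<close>

lemma norm_bessel_cross_mono:
  assumes "- 1 < \<mu>1" "\<mu>1 \<le> \<mu>2" "\<bar>x\<bar> < bessel_cross_zero \<mu>1 1"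
  shows "norm_bessel_cross \<mu>1 x \<le> norm_bessel_cross \<mu>2 x"
proof -
  obtain a where "bessel_zeros \<mu>1 a" using bessel_zeros_exist[OF assms(1)] by blast
  then interpret bessel_zeros \<mu>1 a .
  have "a 0 * (x ^ 4 / 16) < 1"
    using less_gam_iff[of "\<bar>x\<bar>" 0] assms(3) unfolding bessel_cross_zero_1 by simp
  then have "0 < F t" if "t \<in> {0..x ^ 4 / 16}" for t
    using that mult_left_mono[of t "x ^ 4 / 16" "a 0"] pos[of 0]
    by (intro F_pos) (auto simp del: le_divide_eq_numeral1)
  then show ?thesis
    unfolding norm_bessel_cross_eq[OF assms(1)] norm_bessel_cross_eq[OF less_le_trans[OF assms(1,2)]]
    by (intro cross_fun_mono[OF assms(1,2)]) auto
qed

text \<open>For X = x^4/16 the operator x d/dx is 4 X d/dX.\<close>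

lemma norm_bessel_cross_log_deriv:
  assumes "- 1 < \<mu>"
  shows "x * deriv (norm_bessel_cross \<mu>) x / norm_bessel_cross \<mu> x
    = 4 * (x ^ 4 / 16 * deriv (cross_fun (\<mu> + 1) (\<mu> + 2)) (x ^ 4 / 16) / cross_fun (\<mu> + 1) (\<mu> + 2) (x ^ 4 / 16))"
proof -
  have "((\<lambda>z. z ^ 4 / 16) has_real_derivative x ^ 3 / 4) (at x)"
    by (auto intro!: derivative_eq_intros)
  then have "((\<lambda>z. cross_fun (\<mu> + 1) (\<mu> + 2) (z ^ 4 / 16)) has_real_derivative
      deriv (cross_fun (\<mu> + 1) (\<mu> + 2)) (x ^ 4 / 16) * (x ^ 3 / 4)) (at x)"
    using assms by (intro DERIV_chain2[OF cross_fun_differentiable]) auto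
  then have "deriv (norm_bessel_cross \<mu>) x = deriv (cross_fun (\<mu> + 1) (\<mu> + 2)) (x ^ 4 / 16) * (x ^ 3 / 4)"
    unfolding norm_bessel_cross_eq[OF assms, abs_def] by (rule DERIV_imp_deriv)
  moreover have "x * (D * (x ^ 3 / 4)) / C = 4 * (x ^ 4 / 16 * D / C)" for C D :: real
    by (simp add: eval_nat_numeral)
  ultimately show ?thesis
    by (simp only: norm_bessel_cross_eq[OF assms])
qed

text \<open>As a function of the order the quotient is singular where x is a zero, so monotonicity
  is asserted on intervals of orders that avoid this.\<close>

lemma norm_bessel_cross_log_deriv_mono:
  assumes K: "K \<subseteq> {\<mu>. - 1 < \<mu> \<and> norm_bessel_cross \<mu> x \<noteq> 0}" "convex K"
  shows "mono_on K (\<lambda>\<mu>. x * deriv (norm_bessel_cross \<mu>) x / norm_bessel_cross \<mu> x)"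
proof (rule mono_onI)
  fix \<mu>1 \<mu>2 assume \<mu>: "\<mu>1 \<in> K" "\<mu>2 \<in> K" "\<mu>1 \<le> \<mu>2"
  have "{\<mu>1..\<mu>2} \<subseteq> K"
    using closed_segment_subset[OF \<mu>(1,2) K(2)] \<mu>(3) by (simp add: closed_segment_eq_real_ivl)
  then have nz: "cross_fun (\<mu> + 1) (\<mu> + 2) (x ^ 4 / 16) \<noteq> 0" if "\<mu> \<in> {\<mu>1..\<mu>2}" for \<mu>
  proof -
    have "\<mu> \<in> K" using \<open>{\<mu>1..\<mu>2} \<subseteq> K\<close> that by blast
    then have "- 1 < \<mu>" "norm_bessel_cross \<mu> x \<noteq> 0" using K(1) by auto
    then show ?thesis by (simp only: norm_bessel_cross_eq not_False_eq_True)
  qed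
  have "- 1 < \<mu>1" "- 1 < \<mu>2" using K(1) \<mu> by auto
  then show "x * deriv (norm_bessel_cross \<mu>1) x / norm_bessel_cross \<mu>1 x
      \<le> x * deriv (norm_bessel_cross \<mu>2) x / norm_bessel_cross \<mu>2 x"
    using cross_fun_log_deriv_mono[OF _ \<mu>(3) _ nz] by (simp only: norm_bessel_cross_log_deriv) simp
qed

theorem theorem1:
  fixes \<nu> :: real
  assumes "\<nu> > - 1"
  shows
    "(\<forall>x\<in>S1 \<nu> \<union> S2 \<nu>. norm_bessel_cross \<nu> x \<le> 0 \<and>
        ((\<forall>n\<ge>1. \<bar>x\<bar> \<noteq> bessel_cross_zero \<nu> n) \<longrightarrow> norm_bessel_cross \<nu> x < 0))
     \<and> (\<forall>x\<in>UNIV - (S1 \<nu> \<union> S2 \<nu>). norm_bessel_cross \<nu> x > 0)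
     \<and> strict_mono_on {- bessel_cross_zero \<nu> 1<..0} (norm_bessel_cross \<nu>)
     \<and> strict_antimono_on {0..<bessel_cross_zero \<nu> 1} (norm_bessel_cross \<nu>)
     \<and> strictly_log_concave_on (UNIV - (S1 \<nu> \<union> S2 \<nu>)) (norm_bessel_cross \<nu>)
     \<and> strictly_geom_concave_on ({0<..} - S2 \<nu>) (norm_bessel_cross \<nu>)
     \<and> (\<nu> \<ge> - 1 / 2 \<longrightarrow> strictly_log_concave_on ({0<..} - S2 \<nu>) (bessel_cross \<nu>))
     \<and> (\<forall>\<mu>\<^sub>1 \<mu>\<^sub>2 x. - 1 < \<mu>\<^sub>1 \<and> \<mu>\<^sub>1 \<le> \<mu>\<^sub>2 \<and>
        x \<in> {- bessel_cross_zero \<mu>\<^sub>1 1<..<bessel_cross_zero \<mu>\<^sub>1 1} \<longrightarrow>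
        norm_bessel_cross \<mu>\<^sub>1 x \<le> norm_bessel_cross \<mu>\<^sub>2 x)
     \<and> (\<forall>x. \<forall>K. K \<subseteq> {\<mu>. \<mu> > - 1 \<and> norm_bessel_cross \<mu> x \<noteq> 0} \<and> convex K \<longrightarrow>
        mono_on K (\<lambda>\<mu>. x * deriv (norm_bessel_cross \<mu>) x / norm_bessel_cross \<mu> x))
     \<and> absolutely_monotonic_on {0<..<bessel_cross_zero \<nu> 1 ^ 4}
        (deriv (\<lambda>x. - ln (norm_bessel_cross \<nu> (root 4 x))))
     \<and> absolutely_monotonic_on {0<..<bessel_cross_zero \<nu> 1 ^ 4}
        (\<lambda>x. 1 / norm_bessel_cross \<nu> (root 4 x))"
proof -
  obtain a where "bessel_zeros \<nu> a" using bessel_zeros_exist[OF assms] by blast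
  then interpret bessel_zeros \<nu> a .
  \<comment> \<open>W is even, so the increase to the left of 0 mirrors the decrease to the
    right.\<close>
  have "W x < W y" if "- gam 0 < x" "x < y" "y \<le> 0" for x y
    using W_antimono[of "- y" "- x"] that W_abs[of x] W_abs[of y] by simp
  then have incr: "strict_mono_on {- gam 0<..0} W"
    by (auto intro!: strict_mono_onI)
  have decr: "strict_antimono_on {0..<gam 0} W"
    by (auto intro!: monotone_onI W_antimono)
  have mono: "norm_bessel_cross \<mu>1 x \<le> norm_bessel_cross \<mu>2 x"
    if "- 1 < \<mu>1 \<and> \<mu>1 \<le> \<mu>2 \<and> x \<in> {- bessel_cross_zero \<mu>1 1<..<bessel_cross_zero \<mu>1 1}" for \<mu>1 \<mu>2 x
    using that by (intro norm_bessel_cross_mono) auto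
  show ?thesis
    unfolding bessel_cross_zero_1
    using W_nonpos W_pos' incr decr W_log_concave W_geom_concave bessel_cross_log_concave mono
      norm_bessel_cross_log_deriv_mono absolutely_monotonic
    by (intro conjI ballI allI impI) blast+
qed

end
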